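(* Let $\Delta$ be a finite simplicial complex with $\operatorname{depth}\Delta=d-1$, and let $r$ be an integer with $2\le r\le d/2$. Let $\mathcal{A},\mathcal{B}$ be nonempty cross-intersecting families consisting of $r$-element faces of $\Delta$. If $\Delta$ is shifted with respect to $\{v_1<\cdots<v_r\}$, then \[|\mathcal{A}|+|\mathcal{B}|\le f_r(\Delta)-\gamma+1,\] where $\gamma$ is the number of $r$-element faces of $\Delta$ containing no element of $\{v_1,\dots,v_r\}$.
   Context: A simplicial complex is a nonempty finite family of sets closed under subsets; $f_k(\Delta)$ is the number of $k$-element faces; $\operatorname{link}_\Delta A=\{B\in\Delta:A\cap B=\emptyset,A\cup B\in\Delta\}$. Fix a field $\mathbb{F}$. A complex $\Gamma$ is Cohen-Macaulay if $\tilde H_i(\operatorname{link}_\Gamma A;\mathbb{F})=0$ for all faces $A$ (including $\emptyset$) and all $i<\dim\operatorname{link}_\Gamma A$ (a face $A$ has dimension $|A|-1$). The depth of $\Delta$ is the largest $k$ such that the subcomplex of faces of dimension at most $k$ is Cohen-Macaulay. $\Delta$ is shifted with respect to $\{v_1<\cdots<v_t\}$ if for every $i\le t$, every face $B$, and every $w\in B$ with $w\notin\{v_1,\dots,v_i\}$ and $v_i\notin B$, the set $(B\setminus\{w\})\cup\{v_i\}$ is a face. Families $\mathcal{A},\mathcal{B}$ are cross-intersecting if $A\cap B\neq\emptyset$ for all $A\in\mathcal{A}$, $B\in\mathcal{B}$. *)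

theory Defs
  imports Main
begin

definition simplicial_complex :: "'a set set \<Rightarrow> bool" where
  "simplicial_complex K \<longleftrightarrow> K \<noteq> {} \<and> finite K \<and> (\<forall>A\<in>K. \<forall>B. B \<subseteq> A \<longrightarrow> B \<in> K)"

definition fcount :: "nat \<Rightarrow> 'a set set \<Rightarrow> nat" where
  "fcount k K = card {F\<in>K. card F = k}"

definition link :: "'a set set \<Rightarrow> 'a set \<Rightarrow> 'a set set" where
  "link K A = {B\<in>K. A \<inter> B = {} \<and> A \<union> B \<in> K}"

definition cdim :: "'a set set \<Rightarrow> int" where
  "cdim K = int (Max (card ` K)) - 1"

definition skeleton :: "int \<Rightarrow> 'a set set \<Rightarrow> 'a set set" where
  "skeleton k K = {F\<in>K. int (card F) - 1 \<le> k}"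

text \<open>A k-chain: an F-valued function supported on k-element faces (faces of dimension k-1);
  the empty face gives the augmentation in degree -1. Orientation is induced by the
  linear order on the vertex type.\<close>
definition is_chain :: "'a set set \<Rightarrow> nat \<Rightarrow> ('a set \<Rightarrow> 'f::field) \<Rightarrow> bool" where
  "is_chain K k c \<longleftrightarrow> (\<forall>\<sigma>. c \<sigma> \<noteq> 0 \<longrightarrow> \<sigma> \<in> K \<and> card \<sigma> = k)"

definition bdry :: "'a::linorder set set \<Rightarrow> ('a set \<Rightarrow> 'f::field) \<Rightarrow> 'a set \<Rightarrow> 'f" where
  "bdry K c \<tau> = (\<Sum>v\<in>{v. v \<notin> \<tau> \<and> insert v \<tau> \<in> K}.
                    (-1) ^ card {u\<in>\<tau>. u < v} * c (insert v \<tau>))"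

definition red_hom_vanishes :: "'f::field itself \<Rightarrow> 'a::linorder set set \<Rightarrow> int \<Rightarrow> bool" where
  "red_hom_vanishes F K i \<longleftrightarrow>
     (i < -1 \<or>
      (\<forall>c :: 'a set \<Rightarrow> 'f. is_chain K (nat (i+1)) c \<and> bdry K c = (\<lambda>_. 0) \<longrightarrow>
         (\<exists>b :: 'a set \<Rightarrow> 'f. is_chain K (nat (i+2)) b \<and> bdry K b = c)))"

definition cohen_macaulay :: "'f::field itself \<Rightarrow> 'a::linorder set set \<Rightarrow> bool" where
  "cohen_macaulay F K \<longleftrightarrow>
     (\<forall>A\<in>K. \<forall>i. i < cdim (link K A) \<longrightarrow> red_hom_vanishes F (link K A) i)"

definition depth :: "'f::field itself \<Rightarrow> 'a::linorder set set \<Rightarrow> int" where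
  "depth F K = Max {k. -1 \<le> k \<and> k \<le> cdim K \<and> cohen_macaulay F (skeleton k K)}"

definition shifted_wrt :: "'a set set \<Rightarrow> 'a list \<Rightarrow> bool" where
  "shifted_wrt K vs \<longleftrightarrow>
     (\<forall>i<length vs. \<forall>B\<in>K. \<forall>w\<in>B.
        w \<notin> set (take (Suc i) vs) \<and> vs ! i \<notin> B \<longrightarrow> insert (vs ! i) (B - {w}) \<in> K)"

definition cross_intersecting :: "'a set set \<Rightarrow> 'a set set \<Rightarrow> bool" where
  "cross_intersecting \<A> \<B> \<longleftrightarrow> (\<forall>A\<in>\<A>. \<forall>B\<in>\<B>. A \<inter> B \<noteq> {})"

end

theory Submission
  imports Defs "HOL-Library.Function_Algebras" "HOL-Algebra.Algebraic_Closure_Type"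
begin

text \<open>Shifting both families towards \<open>v\<^sub>1, \<dots>, v\<^sub>r\<close> makes every member meet these vertices, and up
  to the relevant dimension \<open>\<Delta>\<close> is the join of the simplex on them with their link \<open>\<Gamma>\<close>. In \<open>\<Gamma>\<close> there
  are no vertices to shift towards; as in exterior algebraic shifting, generic linear forms
  \<open>\<theta>\<^sub>0, \<theta>\<^sub>1, \<dots>\<close> over the algebraic closure take their place. A space of chains of \<open>\<Gamma>\<close> is split into
  the image and the kernel of the contraction with \<open>\<theta>\<^sub>0\<close>, each part is split by \<open>\<theta>\<^sub>1\<close>, and so on, which
  writes its dimension as a sum over the \<open>q\<close>-subsets of the \<open>r + q\<close> points
  \<open>v\<^sub>1, \<dots>, v\<^sub>r, \<theta>\<^sub>0, \<dots>, \<theta>\<^bsub>q-1\<^esub>\<close>, for \<open>q \<le> r\<close>. Because wedge products of chains of cross-intersecting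
  families vanish, the summands of \<open>\<A>\<close> and \<open>\<B>\<close> belonging to disjoint \<open>q\<close>-sets add up to at most a number
  \<open>h\<^sub>q\<close>; the Cohen-Macaulay property, in the form that chains killed by \<open>\<theta>\<^sub>0, \<dots>, \<theta>\<^bsub>q-1\<^esub>\<close> are
  contractions, shows that every summand of the space of all chains is at least \<open>h\<^sub>q\<close>. The expansion
  property of Kneser graphs turns this into the bound.\<close>

section \<open>Rank and eigenvalues in finite-dimensional subspaces\<close>

text \<open>The rule for when to stop splitting makes the pieces comparable. If S is the trace of a
  face on the shifted vertices, chains of degree r - |S| are split until a kernel is taken for the
  (|S| + 1)-st time. If this happens at \<open>th q\<close>, exactly q - |S| images were taken
  before, so the piece has degree r - q and is killed by \<open>th 0\<close>, ...,
  \<open>th q\<close>, whatever S is. All pieces of index q lie in one space \<open>base q\<close>,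
  whose dimension is h_q. The saving comes from the q-set made of all q forms and no vertex: it
  belongs to the empty trace, where both shifted families are empty. Let C_q be the number of
  q-sets. For q < r strict expansion turns this one zero weight into the bound (C_q - 1) h_q, which
  the pieces of all chains with nonempty trace can pay. For q = r the Kneser graph is a perfect
  matching and nothing is saved, but h_r is at most 1: this is the final + 1. The algebraic closure
  serves twice: generic forms need an infinite field, and exactness for several forms needs an
  eigenvalue. The condition 2 r <= d also serves twice: it lets every r-face be joined with all
  shifted vertices, and it leaves depth r in their link.\<close>

locale linear_space = vector_space scale
  for scale :: "'a::field \<Rightarrow> 'b::ab_group_add \<Rightarrow> 'b"
begin

text \<open>\<open>dim\<close> is the \<open>card\<close> of a basis and says nothing when bases are
  infinite. The ambient spaces of functions may be infinite-dimensional, so finiteness is recorded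
  for the subset at hand.\<close>

definition fin_dim :: "'b set \<Rightarrow> bool" where
  "fin_dim S \<longleftrightarrow> (\<exists>B. finite B \<and> S \<subseteq> span B)"

text \<open>Indexed families rather than sets: when vectors are perturbed two of them may coincide,
  and this has to count as a dependence.\<close>

definition indep_family :: "'c set \<Rightarrow> ('c \<Rightarrow> 'b) \<Rightarrow> bool" where
  "indep_family Y f \<longleftrightarrow> (\<forall>c. (\<Sum>y\<in>Y. scale (c y) (f y)) = 0 \<longrightarrow> (\<forall>y\<in>Y. c y = 0))"

lemma linear_endoI:
  assumes "\<And>x y. f (x + y) = f x + f y" "\<And>c x. f (scale c x) = scale c (f x)"
  shows "Vector_Spaces.linear scale scale f"
  using assms vector_space_axioms by (simp add: Vector_Spaces.linear_iff)

lemma indep_familyD: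
  "indep_family Y f \<Longrightarrow> (\<Sum>y\<in>Y. scale (c y) (f y)) = 0 \<Longrightarrow> y \<in> Y \<Longrightarrow> c y = 0"
  unfolding indep_family_def by simp

lemma fin_dim_mono: "fin_dim T \<Longrightarrow> S \<subseteq> T \<Longrightarrow> fin_dim S"
  unfolding fin_dim_def by blast

lemma fin_dim_independent:
  assumes "fin_dim S" "independent B" "B \<subseteq> span S"
  shows "finite B"
proof -
  obtain C where C: "finite C" "S \<subseteq> span C" using assms(1) fin_dim_def by blast
  have "B \<subseteq> span C" using assms(3) C(2) span_mono span_span by blast
  thus ?thesis using independent_span_bound[OF C(1) assms(2)] by blast
qed

lemma fin_dim_basis:
  assumes "fin_dim S"
  obtains B where "B \<subseteq> S" "independent B" "S \<subseteq> span B" "finite B" "card B = dim S"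
proof -
  obtain B where B: "B \<subseteq> S" "independent B" "S \<subseteq> span B" "card B = dim S"
    using basis_exists by blast
  have "finite B" using fin_dim_independent[OF assms B(2)] B(1) span_superset by blast
  thus ?thesis using B that by blast
qed

lemma card_le_dim_if_independent:
  assumes "fin_dim S" "independent B" "B \<subseteq> span S"
  shows "card B \<le> dim S"
proof -
  obtain C where C: "C \<subseteq> S" "independent C" "S \<subseteq> span C" "finite C" "card C = dim S"
    using fin_dim_basis[OF assms(1)] by blast
  have "B \<subseteq> span C" using assms(3) C(3) span_mono span_span by blast
  thus ?thesis using independent_span_bound[OF C(4) assms(2)] C(5) by simp
qed

lemma dim_mono_fin_dim:
  assumes "fin_dim T" "S \<subseteq> span T"
  shows "dim S \<le> dim T"
proof -
  obtain B where B: "B \<subseteq> S" "independent B" "S \<subseteq> span B" "card B = dim S"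
    using basis_exists by blast
  show ?thesis using card_le_dim_if_independent[OF assms(1) B(2)] B assms(2) by fastforce
qed

lemma indep_family_iff:
  assumes "finite Y"
  shows "indep_family Y f \<longleftrightarrow> inj_on f Y \<and> independent (f ` Y)"
proof
  assume L: "indep_family Y f"
  have inj: "inj_on f Y"
  proof (rule inj_onI, rule ccontr)
    fix x y assume xy: "x \<in> Y" "y \<in> Y" "f x = f y" "x \<noteq> y"
    let ?c = "\<lambda>z. if z = x then 1 else if z = y then -1 else (0::'a)"
    have "(\<Sum>z\<in>Y. scale (?c z) (f z)) = (\<Sum>z\<in>{x,y}. scale (?c z) (f z))"
      by (rule sum.mono_neutral_right) (use xy assms in auto)
    also have "\<dots> = 0" using xy by simp
    finally have "?c x = 0" using indep_familyD[OF L, of ?c x] xy(1) by blast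
    thus False by simp
  qed
  moreover have "independent (f ` Y)"
  proof (rule independent_if_scalars_zero)
    fix c x assume c: "(\<Sum>x\<in>f ` Y. scale (c x) x) = 0" and x: "x \<in> f ` Y"
    have "(\<Sum>y\<in>Y. scale (c (f y)) (f y)) = 0" using c inj by (simp add: sum.reindex)
    hence "\<forall>y\<in>Y. c (f y) = 0" using indep_familyD[OF L, of "\<lambda>y. c (f y)"] by simp
    thus "c x = 0" using x by blast
  qed (use assms in simp)
  ultimately show "inj_on f Y \<and> independent (f ` Y)" by blast
next
  assume R: "inj_on f Y \<and> independent (f ` Y)"
  show "indep_family Y f" unfolding indep_family_def
  proof (intro allI impI ballI)
    fix c y assume c: "(\<Sum>y\<in>Y. scale (c y) (f y)) = 0" and y: "y \<in> Y"
    let ?d = "\<lambda>x. c (inv_into Y f x)"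
    have "(\<Sum>x\<in>f ` Y. scale (?d x) x) = 0"
      using R c by (simp add: sum.reindex cong: sum.cong)
    hence "?d (f y) = 0" using independentD[of "f ` Y" "f ` Y" ?d "f y"] R assms y by auto
    thus "c y = 0" using R y by simp
  qed
qed

lemma indep_family_card_le:
  assumes "fin_dim S" "indep_family Y f" "finite Y" "f ` Y \<subseteq> span S"
  shows "card Y \<le> dim S"
  using card_le_dim_if_independent[OF assms(1), of "f ` Y"] assms indep_family_iff[OF assms(3), of f]
  by (simp add: card_image)

lemma rank_nullity:
  assumes f: "Vector_Spaces.linear scale scale f" and M: "subspace M" "fin_dim M"
  shows "dim M = dim {x\<in>M. f x = 0} + dim (f ` M)"
proof -
  interpret f: Vector_Spaces.linear scale scale f by (rule f)
  let ?K = "{x\<in>M. f x = 0}"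
  have K: "subspace ?K" 
  proof -
    have "?K = M \<inter> {x. f x = 0}" by blast
    thus ?thesis using subspace_inter[OF M(1) f.subspace_kernel] by simp
  qed
  have fdK: "fin_dim ?K" by (rule fin_dim_mono[OF M(2)]) blast
  obtain B where B: "B \<subseteq> ?K" "independent B" "?K \<subseteq> span B" "finite B" "card B = dim ?K"
    by (rule fin_dim_basis[OF fdK])
  have BM: "B \<subseteq> M" using B(1) by blast
  obtain C where C: "B \<subseteq> C" "C \<subseteq> M" "independent C" "M \<subseteq> span C"
    using maximal_independent_subset_extend[OF BM B(2)] by metis
  have finC: "finite C" using fin_dim_independent[OF M(2) C(3)] C(2) span_superset by blast
  have spC: "span C = M" using span_subspace[OF C(2) C(4) M(1)] .
  let ?D = "C - B"
  have ker0: "x = 0" if x: "x \<in> span ?D" "f x = 0" for x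
  proof -
    have "x \<in> M" using x(1) span_mono[of ?D C] spC by auto
    hence "x \<in> span B" using x(2) B(3) by auto
    then obtain u where u: "x = (\<Sum>b\<in>B. scale (u b) b)" using B(4) span_finite by auto
    obtain w where w: "x = (\<Sum>b\<in>?D. scale (w b) b)" using x(1) finC span_finite[of ?D] by auto
    let ?c = "\<lambda>b. if b \<in> B then - u b else w b"
    have "(\<Sum>b\<in>C. scale (?c b) b) = (\<Sum>b\<in>C - B. scale (?c b) b) + (\<Sum>b\<in>B. scale (?c b) b)"
      using sum.subset_diff[OF C(1) finC] by blast
    also have "(\<Sum>b\<in>C - B. scale (?c b) b) = x" unfolding w by (rule sum.cong) auto
    also have "(\<Sum>b\<in>B. scale (?c b) b) = - x" unfolding u sum_negf[symmetric] by (rule sum.cong) auto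
    finally have "(\<Sum>b\<in>C. scale (?c b) b) = 0" by simp
    hence "\<And>b. b \<in> C \<Longrightarrow> ?c b = 0" using independentD[OF C(3) finC subset_refl, of ?c] by blast
    hence "\<And>b. b \<in> ?D \<Longrightarrow> w b = 0" by (metis DiffE)
    thus "x = 0" unfolding w by simp
  qed
  have inj: "inj_on f (span ?D)"
    using f.inj_on_iff_eq_0[OF subspace_span] ker0 by blast
  have ind: "independent (f ` ?D)"
    using f.independent_injective_image[OF independent_mono[OF C(3)] inj] by blast
  have span: "f ` M \<subseteq> span (f ` ?D)"
  proof -
    have "f ` C \<subseteq> span (f ` ?D)"
    proof
      fix y assume "y \<in> f ` C"
      then obtain c where c: "c \<in> C" "y = f c" by auto
      show "y \<in> span (f ` ?D)"
      proof (cases "c \<in> B")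
        case True hence "y = 0" using c B(1) by auto
        thus ?thesis by (simp add: span_zero)
      next
        case False thus ?thesis using c by (auto intro: span_base)
      qed
    qed
    hence "span (f ` C) \<subseteq> span (f ` ?D)" by (simp add: span_minimal)
    thus ?thesis using spC f.span_image[of C] by simp
  qed
  have "dim (f ` M) = card (f ` ?D)"
    using dim_unique[of "f ` ?D" "f ` M" "card (f ` ?D)"] span ind C(2) by auto
  also have "\<dots> = card ?D" by (rule card_image) (use inj inj_on_subset span_superset in blast)
  finally have "dim (f ` M) = card C - card B" using card_Diff_subset[OF B(4) C(1)] by simp
  moreover have "card B \<le> card C" by (rule card_mono[OF finC C(1)])
  moreover have "dim M = card C" using basis_card_eq_dim[OF C(2,4,3)] by simp
  ultimately show ?thesis using B(5) by simp
qed

lemma dim_add_le_if_Int_zero: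
  assumes Z: "subspace Z" "Z \<subseteq> H" and Y: "subspace Y" "Y \<subseteq> H" and H: "fin_dim H"
    and ZY: "Z \<inter> Y \<subseteq> {0}"
  shows "dim Z + dim Y \<le> dim H"
proof -
  obtain B where B: "B \<subseteq> Z" "independent B" "Z \<subseteq> span B" "finite B" "card B = dim Z"
    using fin_dim_basis[OF fin_dim_mono[OF H Z(2)]] by blast
  obtain C where C: "C \<subseteq> Y" "independent C" "Y \<subseteq> span C" "finite C" "card C = dim Y"
    using fin_dim_basis[OF fin_dim_mono[OF H Y(2)]] by blast
  have dis: "B \<inter> C = {}"
    using B(1,2) C(1) ZY dependent_zero by blast
  have "independent (B \<union> C)"
  proof (rule independent_if_scalars_zero)
    fix c x assume c: "(\<Sum>x\<in>B \<union> C. scale (c x) x) = 0" and x: "x \<in> B \<union> C"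
    let ?b = "\<Sum>x\<in>B. scale (c x) x" and ?c = "\<Sum>x\<in>C. scale (c x) x"
    have s: "?b + ?c = 0" using c dis B(4) C(4) by (simp add: sum.union_disjoint)
    have b: "?b \<in> Z" by (rule subspace_sum[OF Z(1)]) (use B Z subspace_scale in blast)
    have "?c \<in> Y" by (rule subspace_sum[OF Y(1)]) (use C Y subspace_scale in blast)
    hence "- ?c \<in> Y" using subspace_neg Y by blast
    moreover have bc: "?b = - ?c" using s by (simp add: eq_neg_iff_add_eq_0)
    ultimately have b0: "?b = 0" using b ZY by auto
    hence c0: "?c = 0" using bc by simp
    show "c x = 0"
      using x independentD[OF B(2,4) subset_refl b0] independentD[OF C(2,4) subset_refl c0] by blast
  qed (use B C in simp)
  moreover have "B \<union> C \<subseteq> span H" using B C Z Y span_superset by blast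
  ultimately have "card (B \<union> C) \<le> dim H" using card_le_dim_if_independent[OF H] by blast
  thus ?thesis using dis B C by (simp add: card_Un_disjoint)
qed

lemma dim_zero_space: "S \<subseteq> {0} \<Longrightarrow> dim S = 0"
  using dim_le_card[of S "{}"] by simp

lemma family_dependence:
  assumes "finite B" "\<And>i. v i \<in> span B"
  obtains c :: "nat \<Rightarrow> 'a" and j where "j \<le> card B" "c j \<noteq> 0" "(\<Sum>i\<le>card B. scale (c i) (v i)) = 0"
proof -
  have fdB: "fin_dim B" using assms(1) span_superset fin_dim_def by blast
  have "\<not> indep_family {..card B} v"
  proof
    assume "indep_family {..card B} v"
    hence "card {..card B} \<le> dim B" using indep_family_card_le[OF fdB] assms by blast
    thus False using dim_le_card[OF span_superset assms(1)] by simp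
  qed
  thus ?thesis unfolding indep_family_def using that by blast
qed

text \<open>Eigenvectors for distinct eigenvalues are independent, so \<open>dim W\<close> bounds
  their number.\<close>

lemma finite_eigenvalues:
  assumes T: "Vector_Spaces.linear scale scale T" and W: "fin_dim W"
  shows "finite {l. \<exists>x\<in>W. x \<noteq> 0 \<and> T x = scale l x}" (is "finite ?E")
proof -
  interpret T: Vector_Spaces.linear scale scale T by (rule T)
  define x where "x l = (SOME x. x \<in> W \<and> x \<noteq> 0 \<and> T x = scale l x)" for l
  have x: "x l \<in> W" "x l \<noteq> 0" "T (x l) = scale l (x l)" if "l \<in> ?E" for l
    using someI_ex[of "\<lambda>x. x \<in> W \<and> x \<noteq> 0 \<and> T x = scale l x"] that unfolding x_def by blast+
  have ind: "indep_family S x" if "finite S" "S \<subseteq> ?E" for S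
    using that
  proof (induction S rule: finite_induct)
    case empty thus ?case by (simp add: indep_family_def)
  next
    case (insert m S)
    show ?case unfolding indep_family_def
    proof (intro allI impI)
      fix c assume c: "(\<Sum>y\<in>insert m S. scale (c y) (x y)) = 0"
      have e: "(\<Sum>y\<in>insert m S. scale (c y * y) (x y)) = 0"
      proof -
        have "T (\<Sum>y\<in>insert m S. scale (c y) (x y)) = (\<Sum>y\<in>insert m S. scale (c y) (T (x y)))"
          by (simp only: T.sum T.scale)
        also have "\<dots> = (\<Sum>y\<in>insert m S. scale (c y * y) (x y))"
        proof (rule sum.cong[OF refl])
          fix y assume "y \<in> insert m S"
          hence "y \<in> ?E" using insert.prems by blast
          thus "scale (c y) (T (x y)) = scale (c y * y) (x y)" using x(3) by simp
        qed
        finally show ?thesis using c T.zero by simp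
      qed
      have "(\<Sum>y\<in>insert m S. scale (c y * (y - m)) (x y)) =
          (\<Sum>y\<in>insert m S. scale (c y * y) (x y)) - scale m (\<Sum>y\<in>insert m S. scale (c y) (x y))"
        unfolding scale_sum_right sum_subtractf[symmetric]
        by (rule sum.cong) (auto simp: algebra_simps)
      hence "(\<Sum>y\<in>S. scale (c y * (y - m)) (x y)) = 0" using e c insert by simp
      hence "\<forall>y\<in>S. c y * (y - m) = 0"
        using indep_familyD[of S x "\<lambda>y. c y * (y - m)"] insert by simp
      hence s: "\<forall>y\<in>S. c y = 0" using insert.hyps(2) by force
      hence "scale (c m) (x m) = 0" using c insert by simp
      hence "c m = 0" using x[of m] insert by simp
      thus "\<forall>y\<in>insert m S. c y = 0" using s by blast
    qed
  qed
  have "card S \<le> dim W" if "finite S" "S \<subseteq> ?E" for S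
  proof (rule indep_family_card_le[OF W ind[OF that] that(1)])
    have "x l \<in> W" if "l \<in> S" for l by (rule x(1)) (use that \<open>S \<subseteq> ?E\<close> in blast)
    thus "x ` S \<subseteq> span W" by (auto intro: span_base)
  qed
  thus ?thesis by (intro finite_if_finite_subsets_card_bdd[THEN conjunct1])
qed

text \<open>Project to the span of the vectors \<open>f y\<close> and let \<open>T\<close> send
  \<open>f y\<close> to the projection of \<open>g y\<close>. A dependence at \<open>t\<close>
  becomes \<open>z + t T z = 0\<close> with \<open>z\<close> nonzero, that is, the eigenvalue
  \<open>-1/t\<close> of \<open>T\<close>; there are only finitely many of these.\<close>

lemma finite_dependent_perturbations:
  assumes Y: "finite Y" and ind: "indep_family Y f"
  shows "finite {t. \<not> indep_family Y (\<lambda>y. f y + scale t (g y))}" (is "finite ?bad")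
proof -
  have fY: "inj_on f Y" "independent (f ` Y)" using indep_family_iff[OF Y, of f] ind by auto
  interpret p: vector_space_pair scale scale ..
  let ?W = "span (f ` Y)"
  have "Vector_Spaces.linear scale scale (\<lambda>x. x)"
    by (rule linear_endoI) simp_all
  then obtain \<pi> where \<pi>: "\<pi> ` UNIV \<subseteq> ?W" "Vector_Spaces.linear scale scale \<pi>" "\<And>v. v \<in> ?W \<Longrightarrow> \<pi> v = v"
    using p.linear_exists_right_inverse_on[of "\<lambda>x. x" ?W] by auto
  interpret \<pi>: Vector_Spaces.linear scale scale \<pi> by (rule \<pi>(2))
  obtain T where T: "Vector_Spaces.linear scale scale T"
      "\<And>v. v \<in> f ` Y \<Longrightarrow> T v = \<pi> (g (inv_into Y f v))"
    using p.linear_independent_extend[OF fY(2), of "\<lambda>v. \<pi> (g (inv_into Y f v))"] by blast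
  interpret T: Vector_Spaces.linear scale scale T by (rule T)
  have Tf: "T (f y) = \<pi> (g y)" if "y \<in> Y" for y using T(2)[of "f y"] fY(1) that by simp
  have fdW: "fin_dim ?W" unfolding fin_dim_def using Y by blast
  let ?E = "{l. \<exists>x\<in>?W. x \<noteq> 0 \<and> T x = scale l x}"
  have "- inverse t \<in> ?E" if t: "t \<in> ?bad" for t
  proof -
    obtain c y where c: "(\<Sum>y\<in>Y. scale (c y) (f y + scale t (g y))) = 0" "y \<in> Y" "c y \<noteq> 0"
      using t unfolding indep_family_def by blast
    define z where "z = (\<Sum>y\<in>Y. scale (c y) (f y))"
    have zW: "z \<in> ?W" unfolding z_def by (intro span_sum span_scale span_base) auto
    have z0: "z \<noteq> 0" using indep_familyD[OF ind, of c] c(2,3) unfolding z_def by blast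
    have Tz: "T z = \<pi> (\<Sum>y\<in>Y. scale (c y) (g y))"
      unfolding z_def by (simp add: T.sum T.scale \<pi>.sum \<pi>.scale Tf cong: sum.cong)
    have "z + scale t (\<Sum>y\<in>Y. scale (c y) (g y)) = 0"
      using c(1) unfolding z_def scale_sum_right sum.distrib[symmetric]
      by (simp add: algebra_simps)
    hence "\<pi> (z + scale t (\<Sum>y\<in>Y. scale (c y) (g y))) = 0" by (simp add: \<pi>.zero)
    hence e: "z + scale t (T z) = 0" using \<pi>(3)[OF zW] Tz by (simp add: \<pi>.add \<pi>.scale)
    hence t0: "t \<noteq> 0" using z0 by auto
    have "scale (inverse t) (z + scale t (T z)) = 0" using e by simp
    hence "T z + scale (inverse t) z = 0" using t0 by (simp add: scale_right_distrib add.commute)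
    hence "T z = scale (- inverse t) z" by (simp add: eq_neg_iff_add_eq_0)
    thus ?thesis using zW z0 by blast
  qed
  hence "(\<lambda>t. - inverse t) ` ?bad \<subseteq> ?E" by blast
  hence "finite ((\<lambda>t. - inverse t) ` ?bad)"
    using finite_eigenvalues[OF T(1) fdW] finite_subset by blast
  moreover have "inj_on (\<lambda>t. - inverse t) ?bad" by (auto simp: inj_on_def)
  ultimately show ?thesis using finite_image_iff by blast
qed

lemma linear_add_scale:
  assumes "Vector_Spaces.linear scale scale f" "Vector_Spaces.linear scale scale g"
  shows "Vector_Spaces.linear scale scale (\<lambda>x. f x + scale t (g x))"
proof -
  interpret f: Vector_Spaces.linear scale scale f by (rule assms)
  interpret g: Vector_Spaces.linear scale scale g by (rule assms)
  show ?thesis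
    by (rule linear_endoI) (simp_all add: f.add g.add f.scale g.scale scale_right_distrib ac_simps)
qed

lemma fin_dim_image:
  assumes "Vector_Spaces.linear scale scale f" "fin_dim M"
  shows "fin_dim (f ` M)"
proof -
  interpret f: Vector_Spaces.linear scale scale f by (rule assms)
  obtain B where "finite B" "M \<subseteq> span B" using assms(2) fin_dim_def by blast
  thus ?thesis using f.spans_image[of M B] unfolding fin_dim_def by blast
qed

lemma image_basis:
  assumes "fin_dim (f ` M)"
  obtains Y where "Y \<subseteq> M" "finite Y" "indep_family Y f" "f ` M \<subseteq> span (f ` Y)" "card Y = dim (f ` M)"
proof -
  obtain B where B: "B \<subseteq> f ` M" "independent B" "f ` M \<subseteq> span B" "finite B" "card B = dim (f ` M)"
    using fin_dim_basis[OF assms] by blast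
  obtain Y where Y: "Y \<subseteq> M" "inj_on f Y" "f ` Y = B" using B(1) subset_image_inj by metis
  have fin: "finite Y" by (rule finite_imageD[OF _ Y(2)]) (simp add: Y(3) B(4))
  have "indep_family Y f" unfolding indep_family_iff[OF fin] using Y B(2) by simp
  moreover have "card Y = dim (f ` M)" using card_image[OF Y(2)] Y(3) B(5) by simp
  moreover have "f ` M \<subseteq> span (f ` Y)" using B(3) Y(3) by simp
  ultimately show ?thesis by (intro that[OF Y(1) fin])
qed

text \<open>Semicontinuity of rank along a line: vectors of \<open>M\<close> whose images under
  \<open>f\<close> form a basis of the image keep independent images for all but finitely many
  \<open>t\<close>.\<close>

lemma finite_rank_drops:
  assumes f: "Vector_Spaces.linear scale scale f" and g: "Vector_Spaces.linear scale scale g"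
    and M: "fin_dim M"
  shows "finite {t. dim ((\<lambda>x. f x + scale t (g x)) ` M) < dim (f ` M)}"
proof -
  obtain Y where Y: "Y \<subseteq> M" "finite Y" "indep_family Y f" "f ` M \<subseteq> span (f ` Y)" "card Y = dim (f ` M)"
    by (rule image_basis[OF fin_dim_image[OF f M]])
  have "{t. dim ((\<lambda>x. f x + scale t (g x)) ` M) < dim (f ` M)}
      \<subseteq> {t. \<not> indep_family Y (\<lambda>y. f y + scale t (g y))}"
  proof (rule subsetI, rule CollectI, rule notI, elim CollectE)
    fix t assume "dim ((\<lambda>x. f x + scale t (g x)) ` M) < dim (f ` M)"
      and i: "indep_family Y (\<lambda>y. f y + scale t (g y))"
    moreover have "card Y \<le> dim ((\<lambda>x. f x + scale t (g x)) ` M)"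
      by (rule indep_family_card_le[OF fin_dim_image[OF linear_add_scale[OF f g] M] i Y(2)])
        (use Y(1) in \<open>auto intro: span_base\<close>)
    ultimately show False using Y(5) by simp
  qed
  thus ?thesis using finite_dependent_perturbations[OF Y(2,3)] finite_subset by blast
qed

text \<open>If \<open>g x\<close> were not in the image of \<open>f\<close>, then \<open>f + t g\<close> would have larger rank for some \<open>t\<close>.\<close>

lemma kernel_maps_into_image_if_max_rank:
  assumes f: "Vector_Spaces.linear scale scale f" and g: "Vector_Spaces.linear scale scale g"
    and M: "subspace M" "fin_dim M" and inf: "infinite (UNIV :: 'a set)"
    and max: "\<And>t. dim ((\<lambda>x. f x + scale t (g x)) ` M) \<le> dim (f ` M)"
    and x: "x \<in> M" "f x = 0"
  shows "g x \<in> f ` M"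
proof (rule ccontr)
  assume n: "g x \<notin> f ` M"
  interpret f: Vector_Spaces.linear scale scale f by (rule f)
  interpret g: Vector_Spaces.linear scale scale g by (rule g)
  obtain Y where Y: "Y \<subseteq> M" "finite Y" "indep_family Y f" "f ` M \<subseteq> span (f ` Y)" "card Y = dim (f ` M)"
    by (rule image_basis[OF fin_dim_image[OF f M(2)]])
  have fY: "inj_on f Y" "independent (f ` Y)"
    using Y(3) unfolding indep_family_iff[OF Y(2)] by simp_all
  have "span (f ` Y) = f ` M"
    by (rule span_subspace[OF image_mono[OF Y(1)] Y(4) f.subspace_image[OF M(1)]])
  hence gx: "g x \<notin> span (f ` Y)" using n by simp
  have g0: "g x \<noteq> 0" using gx span_zero[of "f ` Y"] by metis
  have xY: "x \<notin> Y"
  proof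
    assume "x \<in> Y"
    hence "0 \<in> f ` Y" using x(2) by force
    thus False using fY(2) dependent_zero by blast
  qed
  let ?Y = "insert x Y"
  \<comment> \<open>At \<open>x\<close> the map \<open>f + t g\<close> has the value
    \<open>t g x\<close>. For \<open>t \<noteq> 0\<close> this can be normalised to
    \<open>g x\<close>, so the family is not perturbed at \<open>x\<close>, and it has one member
    more than the rank of \<open>f\<close>.\<close>
  let ?f = "\<lambda>y. if y = x then g x else f y" and ?g = "\<lambda>y. if y = x then 0 else g y"
  have im: "?f ` ?Y = insert (g x) (f ` Y)" using xY by auto
  have "independent (?f ` ?Y)" unfolding im
    using independent_insertI[OF gx fY(2)] .
  moreover have "inj_on ?f ?Y"
  proof -
    have "?f ` (Y - {x}) = f ` Y" using xY by (intro image_cong) auto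
    moreover have "inj_on ?f Y = inj_on f Y" by (rule inj_on_cong) (use xY in auto)
    moreover have "g x \<notin> f ` Y" using gx span_superset[of "f ` Y"] by blast
    ultimately show ?thesis using fY(1) by (simp only: inj_on_insert) simp
  qed
  ultimately have "indep_family ?Y ?f" unfolding indep_family_iff[OF finite.insertI[OF Y(2)]] by simp
  from finite_dependent_perturbations[OF _ this, of ?g]
  have "finite (insert 0 {t. \<not> indep_family ?Y (\<lambda>y. ?f y + scale t (?g y))})" using Y(2) by simp
  from ex_new_if_finite[OF inf this]
  obtain t where t: "t \<noteq> 0" "indep_family ?Y (\<lambda>y. ?f y + scale t (?g y))" by blast
  let ?h = "\<lambda>x. f x + scale t (g x)"
  interpret h: Vector_Spaces.linear scale scale ?h by (rule linear_add_scale[OF f g])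
  have sub: "subspace (?h ` M)" by (rule h.subspace_image[OF M(1)])
  have "g x \<in> ?h ` M"
  proof -
    have "?h (scale (inverse t) x) = g x" using x t(1) by (simp add: f.scale g.scale)
    moreover have "?h (scale (inverse t) x) \<in> ?h ` M" using subspace_scale[OF M(1) x(1)] by (rule imageI)
    ultimately show ?thesis by (simp only:)
  qed
  hence "(\<lambda>y. ?f y + scale t (?g y)) ` ?Y \<subseteq> ?h ` M" using Y(1) by auto
  hence "(\<lambda>y. ?f y + scale t (?g y)) ` ?Y \<subseteq> span (?h ` M)" using span_superset by (rule order_trans)
  hence "card ?Y \<le> dim (?h ` M)"
    by (rule indep_family_card_le[OF fin_dim_image[OF linear_add_scale[OF f g] M(2)] t(2) finite.insertI[OF Y(2)]])
  thus False using max[of t] Y(2,5) xY by simp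
qed

end

section \<open>Polynomials in an endomorphism over an algebraically closed field\<close>

locale alg_closed_linear_space = linear_space scale
  for scale :: "'a::alg_closed_field \<Rightarrow> 'b::ab_group_add \<Rightarrow> 'b"
begin

definition poly_act :: "('b \<Rightarrow> 'b) \<Rightarrow> 'a poly \<Rightarrow> 'b \<Rightarrow> 'b" where
  "poly_act \<phi> p x = (\<Sum>i\<le>degree p. scale (coeff p i) ((\<phi> ^^ i) x))"

lemma poly_act_eq:
  assumes "degree p \<le> n"
  shows "poly_act \<phi> p x = (\<Sum>i\<le>n. scale (coeff p i) ((\<phi> ^^ i) x))"
  unfolding poly_act_def
  by (rule sum.mono_neutral_left) (use assms in \<open>auto simp: coeff_eq_0\<close>)

context
  fixes \<phi> :: "'b \<Rightarrow> 'b"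
  assumes lin: "Vector_Spaces.linear scale scale \<phi>"
begin

interpretation \<phi>: Vector_Spaces.linear scale scale \<phi> by (rule lin)

lemma poly_act_pCons: "poly_act \<phi> (pCons a p) x = scale a x + \<phi> (poly_act \<phi> p x)"
proof -
  have "poly_act \<phi> (pCons a p) x = (\<Sum>i\<le>Suc (degree p). scale (coeff (pCons a p) i) ((\<phi> ^^ i) x))"
    by (rule poly_act_eq) (rule degree_pCons_le)
  also have "\<dots> = scale a x + (\<Sum>i\<le>degree p. scale (coeff p i) (\<phi> ((\<phi> ^^ i) x)))"
    by (subst sum.atMost_Suc_shift) simp
  also have "(\<Sum>i\<le>degree p. scale (coeff p i) (\<phi> ((\<phi> ^^ i) x))) = \<phi> (poly_act \<phi> p x)"
    unfolding poly_act_def by (simp add: \<phi>.sum \<phi>.scale)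
  finally show ?thesis .
qed

lemma poly_act_0: "poly_act \<phi> 0 x = 0" by (simp add: poly_act_def)

lemma poly_act_add: "poly_act \<phi> (p + q) x = poly_act \<phi> p x + poly_act \<phi> q x"
  by (induction p q rule: poly_induct2)
    (simp_all add: poly_act_0 poly_act_pCons \<phi>.add algebra_simps)

lemma poly_act_smult: "poly_act \<phi> (smult a p) x = scale a (poly_act \<phi> p x)"
  by (induction p) (simp_all add: poly_act_0 poly_act_pCons \<phi>.scale algebra_simps)

lemma poly_act_mult: "poly_act \<phi> (p * q) x = poly_act \<phi> p (poly_act \<phi> q x)"
  by (induction p) (simp_all add: poly_act_0 poly_act_pCons poly_act_add poly_act_smult)

lemma poly_act_vec_0: "poly_act \<phi> p 0 = 0"
  by (induction p) (simp_all add: poly_act_0 poly_act_pCons \<phi>.zero)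

lemma annihilating_poly_vector:
  assumes "fin_dim Z" "\<And>x. x \<in> Z \<Longrightarrow> \<phi> x \<in> Z" "x \<in> Z"
  shows "\<exists>p. p \<noteq> 0 \<and> poly_act \<phi> p x = 0"
proof -
  obtain B where B: "finite B" "Z \<subseteq> span B" using assms(1) fin_dim_def by blast
  have "(\<phi> ^^ i) x \<in> Z" for i by (induction i) (use assms in auto)
  hence "(\<phi> ^^ i) x \<in> span B" for i using B by blast
  then obtain c j where c: "j \<le> card B" "c j \<noteq> 0" "(\<Sum>i\<le>card B. scale (c i) ((\<phi> ^^ i) x)) = 0"
    using family_dependence[OF B(1), of "\<lambda>i. (\<phi> ^^ i) x"] by metis
  let ?p = "Abs_poly (\<lambda>i. if i \<le> card B then c i else 0)"
  have co: "coeff ?p = (\<lambda>i. if i \<le> card B then c i else 0)"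
    by (rule Abs_poly_inverse) (auto simp: MOST_iff_cofinite intro: finite_subset[of _ "{..card B}"])
  have "?p \<noteq> 0" using c co by (metis coeff_0)
  moreover have "degree ?p \<le> card B" by (rule degree_le) (simp add: co)
  hence "poly_act \<phi> ?p x = (\<Sum>i\<le>card B. scale (coeff ?p i) ((\<phi> ^^ i) x))" by (rule poly_act_eq)
  moreover have "\<dots> = (\<Sum>i\<le>card B. scale (c i) ((\<phi> ^^ i) x))"
    by (rule sum.cong) (simp_all add: co)
  ultimately show ?thesis using c(3) by (intro exI[of _ ?p]) simp
qed

text \<open>Run through a basis: if \<open>p\<close> kills the vectors so far and \<open>q\<close>
  annihilates what \<open>p\<close> makes of the next one, then \<open>q * p\<close> kills all of
  them.\<close>

lemma annihilating_poly:
  assumes "fin_dim Z" "\<And>x. x \<in> Z \<Longrightarrow> \<phi> x \<in> Z" "subspace Z"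
  shows "\<exists>p. p \<noteq> 0 \<and> (\<forall>x\<in>Z. poly_act \<phi> p x = 0)"
proof -
  have inv: "poly_act \<phi> p x \<in> Z" if "x \<in> Z" for p x
    by (induction p) (use that assms in
      \<open>auto simp: poly_act_0 poly_act_pCons subspace_0 subspace_add subspace_scale\<close>)
  have *: "\<exists>p. p \<noteq> 0 \<and> (\<forall>x\<in>B. poly_act \<phi> p x = 0)" if "finite B" "B \<subseteq> Z" for B
    using that
  proof (induction B rule: finite_induct)
    case empty
    show ?case by (intro exI[of _ 1]) simp
  next
    case (insert b B)
    then obtain p where p: "p \<noteq> 0" "\<forall>x\<in>B. poly_act \<phi> p x = 0" by auto
    obtain q where q: "q \<noteq> 0" "poly_act \<phi> q (poly_act \<phi> p b) = 0"
      using annihilating_poly_vector[OF assms(1,2) inv] insert.prems by blast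
    show ?case
      by (intro exI[of _ "q * p"]) (use p q in \<open>simp add: poly_act_mult poly_act_vec_0\<close>)
  qed
  obtain B where B: "B \<subseteq> Z" "independent B" "Z \<subseteq> span B" "finite B" "card B = dim Z"
    by (rule fin_dim_basis[OF assms(1)])
  obtain p where p: "p \<noteq> 0" "\<forall>x\<in>B. poly_act \<phi> p x = 0" using *[OF B(4,1)] by (elim exE conjE)
  have "Vector_Spaces.linear scale scale (poly_act \<phi> p)"
  proof -
    have "poly_act \<phi> p (x + y) = poly_act \<phi> p x + poly_act \<phi> p y"
      "poly_act \<phi> p (scale c x) = scale c (poly_act \<phi> p x)" for x y c
      by (induction p) (simp_all add: poly_act_0 poly_act_pCons \<phi>.add \<phi>.scale algebra_simps)
    thus ?thesis by (intro linear_endoI)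
  qed
  then interpret P: Vector_Spaces.linear scale scale "poly_act \<phi> p" .
  have "poly_act \<phi> p x = 0" if "x \<in> Z" for x
    by (rule P.eq_0_on_span[of B x]) (use p(2) B(3) that in auto)
  thus ?thesis using p(1) by (intro exI[of _ p]) simp
qed

text \<open>An endomorphism of a finite-dimensional space over an algebraically closed field has an
  eigenvalue; here this is applied to the quotient \<open>Z / I\<close>, without forming it.\<close>

lemma subset_if_pencil_surjective:
  assumes Z: "subspace Z" "fin_dim Z" "\<And>x. x \<in> Z \<Longrightarrow> \<phi> x \<in> Z"
    and I: "subspace I" "\<And>x. x \<in> I \<Longrightarrow> \<phi> x \<in> I"
    and surj: "\<And>l x. x \<in> Z \<Longrightarrow> \<exists>z\<in>Z. x - (\<phi> z - scale l z) \<in> I"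
  shows "Z \<subseteq> I"
proof -
  \<comment> \<open>If every \<open>\<phi> - l\<close> is onto modulo \<open>I\<close>, so is every
    nonzero polynomial in \<open>\<phi>\<close>, by splitting off roots. For a polynomial that
    annihilates \<open>Z\<close> this says that \<open>Z\<close> is contained in
    \<open>I\<close>.\<close>
  have *: "\<exists>z\<in>Z. x - poly_act \<phi> p z \<in> I" if "p \<noteq> 0" "degree p = n" "x \<in> Z" for p n x
    using that
  proof (induction n arbitrary: p x)
    case 0
    then obtain c where c: "p = [:c:]" "c \<noteq> 0" by (metis degree_eq_zeroE pCons_0_0)
    have "x - poly_act \<phi> p (scale (inverse c) x) = 0"
      using c by (simp add: poly_act_pCons poly_act_0 \<phi>.zero)
    thus ?case using subspace_0[OF I(1)] subspace_scale[OF Z(1) 0(3)] by metis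
  next
    case (Suc n)
    obtain l where "poly p l = 0" using alg_closed_imp_poly_has_root[of p] Suc.prems by auto
    then obtain q where q: "p = [:- l, 1:] * q" unfolding poly_eq_0_iff_dvd by (auto simp: dvd_def)
    have q0: "q \<noteq> 0" using q Suc.prems(1) by auto
    have "degree p = degree [:- l, 1:] + degree q" unfolding q by (rule degree_mult_eq) (use q0 in auto)
    hence q1: "degree q = n" using Suc.prems(2) by simp
    obtain y where y: "y \<in> Z" "x - (\<phi> y - scale l y) \<in> I" using surj Suc.prems(3) by blast
    obtain z where z: "z \<in> Z" "y - poly_act \<phi> q z \<in> I" using Suc.IH[OF q0 q1 y(1)] by blast
    let ?w = "y - poly_act \<phi> q z"
    have "poly_act \<phi> p z = \<phi> (poly_act \<phi> q z) - scale l (poly_act \<phi> q z)"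
      unfolding q poly_act_mult by (simp add: poly_act_pCons poly_act_0 \<phi>.zero)
    hence "x - poly_act \<phi> p z = (x - (\<phi> y - scale l y)) + (\<phi> ?w - scale l ?w)"
      by (simp add: \<phi>.diff algebra_simps)
    moreover have "\<dots> \<in> I"
      by (rule subspace_add[OF I(1) y(2)
            subspace_diff[OF I(1) I(2)[OF z(2)] subspace_scale[OF I(1) z(2), of l]]])
    ultimately show ?case using z(1) by (intro bexI[of _ z]) (simp_all only:)
  qed
  have "\<exists>p. p \<noteq> 0 \<and> (\<forall>x\<in>Z. poly_act \<phi> p x = 0)"
    by (rule annihilating_poly[OF Z(2,3,1)])
  then obtain p where p: "p \<noteq> 0" "\<forall>x\<in>Z. poly_act \<phi> p x = 0" by (elim exE conjE)
  show ?thesis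
  proof
    fix x assume "x \<in> Z"
    then obtain z where "z \<in> Z" "x - poly_act \<phi> p z \<in> I" using *[OF p(1) refl] by blast
    thus "x \<in> I" using p(2) by simp
  qed
qed

end

end

section \<open>Contractions and wedge products of chains\<close>

definition smul :: "'k::field \<Rightarrow> ('i \<Rightarrow> 'k) \<Rightarrow> 'i \<Rightarrow> 'k" where
  "smul c x = (\<lambda>i. c * x i)"

lemma smul_apply [simp]: "smul c x i = c * x i"
  by (simp add: smul_def)

global_interpretation fs: linear_space "smul :: 'k::field \<Rightarrow> ('i \<Rightarrow> 'k) \<Rightarrow> 'i \<Rightarrow> 'k"
  by unfold_locales (auto simp: fun_eq_iff algebra_simps)

global_interpretation afs:
  alg_closed_linear_space "smul :: 'k::alg_closed_field \<Rightarrow> ('i \<Rightarrow> 'k) \<Rightarrow> 'i \<Rightarrow> 'k"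
  by unfold_locales

abbreviation lin_endo :: "(('i \<Rightarrow> 'k::field) \<Rightarrow> ('i \<Rightarrow> 'k)) \<Rightarrow> bool" where
  "lin_endo \<equiv> Vector_Spaces.linear smul smul"

lemma fun_sum_apply: "sum f A i = (\<Sum>a\<in>A. f a (i::'i) :: 'k::comm_monoid_add)"
  by (induction A rule: infinite_finite_induct) simp_all

lemma indep_indicators:
  assumes "finite A"
  shows "fs.indep_family A (\<lambda>a i. if i = a then 1 else (0::'k::field))"
  unfolding fs.indep_family_def
proof (intro allI impI ballI)
  fix c a assume c: "(\<Sum>y\<in>A. smul (c y) (\<lambda>i. if i = y then 1 else (0::'k))) = 0" and a: "a \<in> A"
  have "(\<Sum>y\<in>A. smul (c y) (\<lambda>i. if i = y then 1 else 0)) a = (\<Sum>y\<in>A. if a = y then c y else 0)"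
    unfolding fun_sum_apply by (rule sum.cong) auto
  also have "\<dots> = c a" using assms a by simp
  finally show "c a = 0" unfolding c by simp
qed

definition esgn :: "'a::linorder set \<Rightarrow> 'a \<Rightarrow> 'k::field" where
  "esgn \<tau> v = (-1) ^ card {u\<in>\<tau>. u < v}"

lemma esgn_sq [simp]: "esgn \<tau> v * esgn \<tau> v = 1" "esgn \<tau> v * (esgn \<tau> v * c) = c"
  by (simp_all add: esgn_def flip: power_mult_distrib mult.assoc)

lemma esgn_nonzero [simp]: "esgn \<tau> v \<noteq> (0::'k::field)"
  by (simp add: esgn_def)

lemma esgn_insert:
  assumes "finite \<tau>" "v \<notin> \<tau>"
  shows "esgn (insert v \<tau>) w = (if v < w then - esgn \<tau> w else esgn \<tau> w)"
proof -
  have "{u\<in>insert v \<tau>. u < w} = (if v < w then insert v {u\<in>\<tau>. u < w} else {u\<in>\<tau>. u < w})" by auto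
  thus ?thesis using assms by (simp add: esgn_def)
qed

lemma esgn_Diff_self: "esgn (\<tau> - {v}) v = esgn \<tau> v"
  unfolding esgn_def by (rule arg_cong[of _ _ "\<lambda>s. (-1) ^ card s"]) auto

lemma esgn_Diff:
  assumes "finite \<tau>" "v \<in> \<tau>"
  shows "esgn (\<tau> - {v}) w = (if v < w then - esgn \<tau> w else esgn \<tau> w)"
proof -
  have h: "esgn \<tau> w = (if v < w then - esgn (\<tau> - {v}) w else esgn (\<tau> - {v}) w :: 'b)"
    using esgn_insert[of "\<tau> - {v}" v w] assms by (simp only: insert_Diff finite_Diff) simp
  show ?thesis unfolding h by simp
qed

text \<open>Chains are elements of the exterior algebra on the vertices: \<open>pd v\<close> contracts with the dual
  of \<open>v\<close> and \<open>ext v\<close> multiplies by \<open>v\<close> from the left. Infinite sets are excluded because the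
  sign would be meaningless there (\<open>card\<close> is 0).\<close>

definition pd :: "'a::linorder \<Rightarrow> ('a set \<Rightarrow> 'k::field) \<Rightarrow> 'a set \<Rightarrow> 'k" where
  "pd v x = (\<lambda>\<tau>. if finite \<tau> \<and> v \<notin> \<tau> then esgn \<tau> v * x (insert v \<tau>) else 0)"

definition ext :: "'a::linorder \<Rightarrow> ('a set \<Rightarrow> 'k::field) \<Rightarrow> 'a set \<Rightarrow> 'k" where
  "ext v x = (\<lambda>\<tau>. if finite \<tau> \<and> v \<in> \<tau> then esgn \<tau> v * x (\<tau> - {v}) else 0)"

definition contr :: "'a::linorder set \<Rightarrow> ('a \<Rightarrow> 'k::field) \<Rightarrow> ('a set \<Rightarrow> 'k) \<Rightarrow> 'a set \<Rightarrow> 'k" where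
  "contr V \<theta> x = (\<Sum>v\<in>V. smul (\<theta> v) (pd v x))"

lemma contr_apply: "contr V \<theta> x \<tau> = (\<Sum>v\<in>V. \<theta> v * pd v x \<tau>)"
  by (simp add: contr_def fun_sum_apply)

lemma lin_pd: "lin_endo (pd v)"
  by (rule fs.linear_endoI) (auto simp: pd_def fun_eq_iff algebra_simps)

lemma lin_ext: "lin_endo (ext v)"
  by (rule fs.linear_endoI) (auto simp: ext_def fun_eq_iff algebra_simps)

global_interpretation pd: Vector_Spaces.linear smul smul "pd v" for v by (rule lin_pd)

lemma lin_contr: "lin_endo (contr V \<theta>)"
proof (rule fs.linear_endoI)
  show "contr V \<theta> (x + y) = contr V \<theta> x + contr V \<theta> y" for x y
    by (simp add: contr_def pd.add fs.scale_right_distrib sum.distrib)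
  show "contr V \<theta> (smul c x) = smul c (contr V \<theta> x)" for c x
    by (simp add: contr_def pd.scale fs.scale_sum_right mult.commute)
qed

global_interpretation ext: Vector_Spaces.linear smul smul "ext v" for v by (rule lin_ext)
global_interpretation contr: Vector_Spaces.linear smul smul "contr V \<theta>" for V \<theta> by (rule lin_contr)

text \<open>The presence of the smaller vertex flips the sign at the larger one but not conversely,
  so the two orders differ by exactly one sign.\<close>

lemma pd_anticomm: "pd v (pd w x) = - pd w (pd v x)"
proof
  fix \<tau>
  show "pd v (pd w x) \<tau> = (- pd w (pd v x)) \<tau>"
  proof (cases "finite \<tau> \<and> v \<notin> \<tau> \<and> w \<notin> \<tau> \<and> v \<noteq> w")
    case True
    thus ?thesis by (cases v w rule: linorder_cases)
        (auto simp: pd_def esgn_insert insert_commute[of v w])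
  qed (auto simp: pd_def)
qed

lemma pd_pd [simp]: "pd v (pd v x) = 0"
  by (auto simp: pd_def fun_eq_iff)

lemma pd_ext_neq:
  assumes "v \<noteq> w"
  shows "pd v (ext w x) = - ext w (pd v x)"
proof
  fix \<tau>
  show "pd v (ext w x) \<tau> = (- ext w (pd v x)) \<tau>"
  proof (cases "finite \<tau> \<and> v \<notin> \<tau> \<and> w \<in> \<tau>")
    case True
    have "insert v \<tau> - {w} = insert v (\<tau> - {w})" using assms by auto
    thus ?thesis using True assms
      by (cases v w rule: linorder_cases) (auto simp: pd_def ext_def esgn_insert esgn_Diff)
  qed (use assms in \<open>auto simp: pd_def ext_def\<close>)
qed

lemma pd_ext_same:
  fixes x :: "'a::linorder set \<Rightarrow> 'k::field"
  shows "pd v (ext v x) \<tau> = (if finite \<tau> \<and> v \<notin> \<tau> then x \<tau> else 0)"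
proof -
  have "esgn (insert v \<tau>) v = (esgn \<tau> v :: 'k)" if "finite \<tau>" "v \<notin> \<tau>"
    using esgn_insert[OF that, of v] by simp
  thus ?thesis by (auto simp: pd_def ext_def)
qed

lemma ext_pd_same: "ext v (pd v x) \<tau> = (if finite \<tau> \<and> v \<in> \<tau> then x \<tau> else 0)"
  by (auto simp: pd_def ext_def esgn_Diff_self insert_absorb)

lemma pd_contr: "pd v (contr V \<theta> x) = - contr V \<theta> (pd v x)"
proof -
  have "pd v (contr V \<theta> x) = (\<Sum>w\<in>V. smul (\<theta> w) (pd v (pd w x)))"
    unfolding contr_def by (simp add: pd.sum pd.scale)
  also have "\<dots> = (\<Sum>w\<in>V. - smul (\<theta> w) (pd w (pd v x)))"
    by (rule sum.cong) (simp_all add: pd_anticomm[of v] fun_eq_iff)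
  finally show ?thesis by (simp add: contr_def sum_negf)
qed

lemma contr_anticomm: "contr V \<theta> (contr V \<eta> x) = - contr V \<eta> (contr V \<theta> x)"
proof -
  have "contr V \<theta> (contr V \<eta> x) = (\<Sum>v\<in>V. smul (\<theta> v) (- contr V \<eta> (pd v x)))"
    unfolding contr_def[of V \<theta>] by (simp add: pd_contr)
  also have "\<dots> = - contr V \<eta> (\<Sum>v\<in>V. smul (\<theta> v) (pd v x))"
    by (simp add: contr.sum contr.scale sum_negf)
  finally show ?thesis by (simp add: contr_def)
qed

lemma contr_contr_eq_0:
  assumes "contr V \<theta> x = 0"
  shows "contr V \<theta> (contr V \<eta> x) = 0"
proof -
  have "- contr V \<eta> (contr V \<theta> x) = 0" unfolding assms by (simp only: contr.zero) (rule minus_zero)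
  thus ?thesis using contr_anticomm[of V \<theta> \<eta> x] by (rule trans[rotated])
qed

text \<open>In characteristic 2 this does not follow from \<open>contr_anticomm\<close> with
  \<open>\<eta> = \<theta>\<close>; hence the induction on \<open>V\<close>.\<close>

lemma contr_contr [simp]: "contr V \<theta> (contr V \<theta> x) = 0"
proof (induction V rule: infinite_finite_induct)
  case (insert v V)
  have i: "contr (insert v V) \<theta> y = smul (\<theta> v) (pd v y) + contr V \<theta> y" for y
    using insert by (simp add: contr_def)
  show ?case unfolding i
    by (simp add: pd.add pd.scale contr.add contr.scale pd_contr insert.IH fun_eq_iff)
qed (simp_all add: contr_def)

text \<open>The Leibniz rule for the product of \<open>v\<close> and \<open>x\<close>:
  \<open>ext v\<close> is a contracting homotopy up to the factor \<open>\<theta> v\<close>. The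
  case \<open>\<theta> v = 0\<close> matters just as much later on.\<close>

lemma contr_ext:
  assumes "finite V" "v \<in> V" "\<And>\<tau>. infinite \<tau> \<Longrightarrow> x \<tau> = 0"
  shows "contr V \<theta> (ext v x) = smul (\<theta> v) x - ext v (contr V \<theta> x)"
proof -
  have s: "contr V \<theta> y = smul (\<theta> v) (pd v y) + (\<Sum>w\<in>V - {v}. smul (\<theta> w) (pd w y))" for y
    unfolding contr_def using assms by (simp add: sum.remove)
  have "(\<Sum>w\<in>V - {v}. smul (\<theta> w) (pd w (ext v x))) = (\<Sum>w\<in>V - {v}. - smul (\<theta> w) (ext v (pd w x)))"
    by (rule sum.cong) (simp_all add: pd_ext_neq fun_eq_iff)
  also have "\<dots> = - ext v (\<Sum>w\<in>V - {v}. smul (\<theta> w) (pd w x))"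
    by (simp add: sum_negf ext.sum ext.scale)
  finally have "contr V \<theta> (ext v x) + ext v (contr V \<theta> x) = smul (\<theta> v) (pd v (ext v x) + ext v (pd v x))"
    unfolding s by (simp add: ext.add ext.scale fun_eq_iff algebra_simps)
  also have "pd v (ext v x) + ext v (pd v x) = x"
    using assms(3) by (auto simp: fun_eq_iff pd_ext_same ext_pd_same)
  finally show ?thesis by (simp only: eq_diff_eq)
qed

definition xsgn :: "'a::linorder set \<Rightarrow> 'a set \<Rightarrow> 'k::field" where
  "xsgn C D = (-1) ^ card {(c, d). c \<in> C \<and> d \<in> D \<and> d < c}"

text \<open>For disjoint \<open>C\<close> and \<open>D\<close>, \<open>xsgn C D\<close> is the sign
  of the shuffle that sorts \<open>C\<close> followed by \<open>D\<close>, so this is the exterior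
  product in the basis of increasing monomials.\<close>

definition wedge :: "('a::linorder set \<Rightarrow> 'k::field) \<Rightarrow> ('a set \<Rightarrow> 'k) \<Rightarrow> 'a set \<Rightarrow> 'k" where
  "wedge m n = (\<lambda>\<tau>. if finite \<tau> then \<Sum>C\<in>Pow \<tau>. xsgn C (\<tau> - C) * m C * n (\<tau> - C) else 0)"

text \<open>The grading involution lets the Leibniz rule be stated for inhomogeneous chains.\<close>

definition grade_inv :: "('a set \<Rightarrow> 'k::field) \<Rightarrow> 'a set \<Rightarrow> 'k" where
  "grade_inv m = (\<lambda>C. (-1) ^ card C * m C)"

definition esgn_above :: "'a::linorder set \<Rightarrow> 'a \<Rightarrow> 'k::field" where
  "esgn_above \<tau> v = (-1) ^ card {u\<in>\<tau>. v < u}"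

lemma xsgn_insert_left:
  assumes "finite C" "finite D" "v \<notin> C"
  shows "xsgn (insert v C) D = xsgn C D * esgn D v"
proof -
  have e: "{(c, d). c \<in> insert v C \<and> d \<in> D \<and> d < c} =
      {(c, d). c \<in> C \<and> d \<in> D \<and> d < c} \<union> Pair v ` {u\<in>D. u < v}" by auto
  have f: "finite {(c, d). c \<in> C \<and> d \<in> D \<and> d < c}"
    by (rule finite_subset[of _ "C \<times> D"]) (use assms in auto)
  have "card {(c, d). c \<in> insert v C \<and> d \<in> D \<and> d < c} =
      card {(c, d). c \<in> C \<and> d \<in> D \<and> d < c} + card {u\<in>D. u < v}"
    unfolding e by (subst card_Un_disjoint) (use assms f in \<open>auto simp: card_image inj_on_def\<close>)
  thus ?thesis by (simp add: xsgn_def esgn_def power_add)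
qed

lemma xsgn_insert_right:
  assumes "finite C" "finite D" "v \<notin> D"
  shows "xsgn C (insert v D) = xsgn C D * esgn_above C v"
proof -
  have e: "{(c, d). c \<in> C \<and> d \<in> insert v D \<and> d < c} =
      {(c, d). c \<in> C \<and> d \<in> D \<and> d < c} \<union> (\<lambda>c. (c, v)) ` {u\<in>C. v < u}" by auto
  have f: "finite {(c, d). c \<in> C \<and> d \<in> D \<and> d < c}"
    by (rule finite_subset[of _ "C \<times> D"]) (use assms in auto)
  have "card {(c, d). c \<in> C \<and> d \<in> insert v D \<and> d < c} =
      card {(c, d). c \<in> C \<and> d \<in> D \<and> d < c} + card {u\<in>C. v < u}"
    unfolding e by (subst card_Un_disjoint) (use assms f in \<open>auto simp: card_image inj_on_def\<close>)
  thus ?thesis by (simp add: xsgn_def esgn_above_def power_add)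
qed

lemma esgn_above_eq:
  assumes "finite C" "v \<notin> C"
  shows "esgn_above C v = ((-1) ^ card C * esgn C v :: 'k::field)"
proof -
  have "C = {u\<in>C. u < v} \<union> {u\<in>C. v < u}" using assms by (auto simp: not_less le_less)
  hence "card C = card ({u\<in>C. u < v} \<union> {u\<in>C. v < u})" by (rule arg_cong)
  also have "\<dots> = card {u\<in>C. u < v} + card {u\<in>C. v < u}"
    by (rule card_Un_disjoint) (use assms in auto)
  finally have "(-1) ^ card C = (esgn C v * esgn_above C v :: 'k)"
    by (simp add: esgn_def esgn_above_def power_add)
  thus ?thesis by (simp add: mult.commute mult.left_commute)
qed

lemma esgn_Un:
  assumes "finite C" "finite D" "C \<inter> D = {}"
  shows "esgn (C \<union> D) v = esgn C v * esgn D v"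
proof -
  have "{u\<in>C \<union> D. u < v} = {u\<in>C. u < v} \<union> {u\<in>D. u < v}" by auto
  moreover have "card ({u\<in>C. u < v} \<union> {u\<in>D. u < v}) = card {u\<in>C. u < v} + card {u\<in>D. u < v}"
    by (rule card_Un_disjoint) (use assms in auto)
  ultimately have "card {u\<in>C \<union> D. u < v} = card {u\<in>C. u < v} + card {u\<in>D. u < v}" by simp
  thus ?thesis by (simp add: esgn_def power_add)
qed

lemma sum_Pow_insert:
  assumes "finite \<tau>" "v \<notin> \<tau>"
  shows "(\<Sum>C\<in>Pow (insert v \<tau>). f C) = (\<Sum>C\<in>Pow \<tau>. f C + f (insert v C))"
proof -
  have "(\<Sum>C\<in>insert v ` Pow \<tau>. f C) = (\<Sum>C\<in>Pow \<tau>. f (insert v C))"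
    by (subst sum.reindex) (use assms in \<open>auto simp: inj_on_def\<close>)
  moreover have "Pow \<tau> \<inter> insert v ` Pow \<tau> = {}" using assms by auto
  ultimately show ?thesis using assms unfolding Pow_insert
    by (simp add: sum.union_disjoint sum.distrib)
qed

text \<open>For \<open>v \<notin> \<tau>\<close> the subsets of \<open>insert v \<tau>\<close> are
  sorted by whether they contain \<open>v\<close>. For \<open>v \<in> \<tau>\<close> the left side
  is 0; on the right the term of the first product at \<open>C\<close> cancels that of the second
  product at \<open>insert v C\<close>.\<close>

lemma pd_wedge:
  fixes m n :: "'a::linorder set \<Rightarrow> 'k::field"
  shows "pd v (wedge m n) = wedge (pd v m) n + wedge (grade_inv m) (pd v n)"
proof
  fix \<tau>
  let ?t = "\<lambda>m n C \<tau>. xsgn C (\<tau> - C) * m C * n (\<tau> - C) :: 'k"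
  let ?p = "pd v" and ?g = grade_inv
  consider "infinite \<tau>" | "finite \<tau>" "v \<notin> \<tau>" | "finite \<tau>" "v \<in> \<tau>" by blast
  thus "?p (wedge m n) \<tau> = (wedge (?p m) n + wedge (?g m) (?p n)) \<tau>"
  proof cases
    case 1 thus ?thesis by (simp add: pd_def wedge_def)
  next
    case 2
    have "?p (wedge m n) \<tau> = (\<Sum>C\<in>Pow \<tau>.
        esgn \<tau> v * (?t m n C (insert v \<tau>) + ?t m n (insert v C) (insert v \<tau>)))"
      using 2 by (simp add: pd_def wedge_def sum_Pow_insert sum_distrib_left)
    also have "\<dots> = (\<Sum>C\<in>Pow \<tau>. ?t (?p m) n C \<tau> + ?t (?g m) (?p n) C \<tau>)"
    proof (rule sum.cong[OF refl])
      fix C assume "C \<in> Pow \<tau>"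
      hence C: "C \<subseteq> \<tau>" "finite C" "v \<notin> C" using 2 finite_subset by auto
      let ?D = "\<tau> - C"
      have D: "finite ?D" "v \<notin> ?D" using 2 by auto
      have e: "insert v \<tau> - C = insert v ?D" "insert v \<tau> - insert v C = ?D" using C 2 by auto
      have s: "esgn \<tau> v = esgn C v * (esgn ?D v :: 'k)"
        using esgn_Un[OF C(2) D(1), of v] C(1) by (simp add: Un_absorb1)
      show "esgn \<tau> v * (?t m n C (insert v \<tau>) + ?t m n (insert v C) (insert v \<tau>)) =
          ?t (?p m) n C \<tau> + ?t (?g m) (?p n) C \<tau>"
        unfolding e s xsgn_insert_left[OF C(2) D(1) C(3)] xsgn_insert_right[OF C(2) D]
          esgn_above_eq[OF C(2,3)]
        using C D by (simp add: pd_def grade_inv_def algebra_simps)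
    qed
    finally show ?thesis using 2 by (simp add: wedge_def sum.distrib)
  next
    case 3
    define \<sigma> where "\<sigma> = \<tau> - {v}"
    have \<sigma>: "\<tau> = insert v \<sigma>" "finite \<sigma>" "v \<notin> \<sigma>" using 3 by (auto simp: \<sigma>_def)
    let ?s = "\<lambda>C. ?t (?p m) n C (insert v \<sigma>) + ?t (?p m) n (insert v C) (insert v \<sigma>) +
      (?t (?g m) (?p n) C (insert v \<sigma>) + ?t (?g m) (?p n) (insert v C) (insert v \<sigma>))"
    have "wedge (?p m) n \<tau> + wedge (?g m) (?p n) \<tau> = (\<Sum>C\<in>Pow \<sigma>. ?s C)"
      using \<sigma> by (simp add: wedge_def sum_Pow_insert sum.distrib)
    also have "\<dots> = (\<Sum>C\<in>Pow \<sigma>. 0)"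
    proof (rule sum.cong[OF refl])
      fix C assume "C \<in> Pow \<sigma>"
      hence C: "C \<subseteq> \<sigma>" "finite C" "v \<notin> C" using \<sigma> finite_subset by auto
      let ?D = "\<sigma> - C"
      have D: "finite ?D" "v \<notin> ?D" using \<sigma> by auto
      have e: "insert v \<sigma> - C = insert v ?D" "insert v \<sigma> - insert v C = ?D" using C \<sigma> by auto
      show "?s C = 0"
        unfolding e xsgn_insert_left[OF C(2) D(1) C(3)] xsgn_insert_right[OF C(2) D]
          esgn_above_eq[OF C(2,3)]
        using C D by (simp add: pd_def grade_inv_def algebra_simps)
    qed
    finally show ?thesis using 3 by (simp add: pd_def)
  qed
qed

definition homog :: "nat \<Rightarrow> ('a set \<Rightarrow> 'k::field) \<Rightarrow> bool" where
  "homog p x \<longleftrightarrow> (\<forall>\<tau>. x \<tau> \<noteq> 0 \<longrightarrow> finite \<tau> \<and> card \<tau> = p)"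

lemma contr_wedge:
  assumes "homog p m"
  shows "contr V \<theta> (wedge m n) = wedge (contr V \<theta> m) n + smul ((-1) ^ p) (wedge m (contr V \<theta> n))"
proof -
  have g: "grade_inv m = smul ((-1) ^ p) m"
    using assms by (auto simp: homog_def grade_inv_def fun_eq_iff)
  have w1: "wedge (contr V \<theta> m) n = (\<Sum>v\<in>V. smul (\<theta> v) (wedge (pd v m) n))"
  proof
    fix \<tau>
    show "wedge (contr V \<theta> m) n \<tau> = (\<Sum>v\<in>V. smul (\<theta> v) (wedge (pd v m) n)) \<tau>"
      unfolding fun_sum_apply wedge_def contr_apply smul_apply
      by (simp add: sum_distrib_left sum_distrib_right mult_ac sum.swap[of _ V "Pow \<tau>"])
  qed
  have w2: "wedge m (contr V \<theta> n) = (\<Sum>v\<in>V. smul (\<theta> v) (wedge m (pd v n)))"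
  proof
    fix \<tau>
    show "wedge m (contr V \<theta> n) \<tau> = (\<Sum>v\<in>V. smul (\<theta> v) (wedge m (pd v n))) \<tau>"
      unfolding fun_sum_apply wedge_def contr_apply smul_apply
      by (simp add: sum_distrib_left sum_distrib_right mult_ac sum.swap[of _ V "Pow \<tau>"])
  qed
  have w3: "wedge (smul c m) y = smul c (wedge m y)" for c y
    by (auto simp: wedge_def fun_eq_iff sum_distrib_left mult_ac intro!: sum.cong)
  show ?thesis
    unfolding w1 w2 contr_def[of V \<theta> "wedge m n"] pd_wedge g w3
    by (simp add: fun_eq_iff fun_sum_apply sum.distrib sum_distrib_left algebra_simps)
qed

lemma contr_homog_0:
  assumes "homog 0 x"
  shows "contr V \<theta> x = 0"
proof
  fix \<tau>
  have "pd v x \<tau> = 0" for v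
    using assms by (auto simp: pd_def homog_def)
  thus "contr V \<theta> x \<tau> = 0 \<tau>" by (simp add: contr_apply)
qed

lemma wedge_homog_0:
  assumes "homog 0 m" "finite \<tau>"
  shows "wedge m n \<tau> = m {} * n \<tau>"
proof -
  have "wedge m n \<tau> = (\<Sum>C\<in>Pow \<tau>. xsgn C (\<tau> - C) * m C * n (\<tau> - C))"
    using assms by (simp add: wedge_def)
  also have "\<dots> = (\<Sum>C\<in>{{}}. xsgn C (\<tau> - C) * m C * n (\<tau> - C))"
    by (rule sum.mono_neutral_right) (use assms in \<open>auto simp: homog_def\<close>)
  finally show ?thesis by (simp add: xsgn_def)
qed

lemma wedge_eq_0_if_intersecting:
  assumes "\<And>C D. m C \<noteq> 0 \<Longrightarrow> n D \<noteq> 0 \<Longrightarrow> C \<inter> D \<noteq> {}"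
  shows "wedge m n = 0"
proof
  fix \<tau>
  have "m C = 0 \<or> n (\<tau> - C) = 0" for C
    using assms[of C "\<tau> - C"] by blast
  hence "(\<Sum>C\<in>Pow \<tau>. xsgn C (\<tau> - C) * m C * n (\<tau> - C)) = 0" by (intro sum.neutral) auto
  thus "wedge m n \<tau> = 0 \<tau>" by (simp only: wedge_def zero_fun_apply if_cancel)
qed

section \<open>Exactness for linear forms with few zeros\<close>

definition ch :: "'a set set \<Rightarrow> ('a set \<Rightarrow> 'k::field) set" where
  "ch \<A> = {x. \<forall>\<tau>. x \<tau> \<noteq> 0 \<longrightarrow> \<tau> \<in> \<A>}"

definition faces :: "nat \<Rightarrow> 'a set set \<Rightarrow> 'a set set" where
  "faces k K = {F\<in>K. card F = k}"

definition del :: "'a set set \<Rightarrow> 'a \<Rightarrow> 'a set set" where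
  "del K v = {F\<in>K. v \<notin> F}"

lemma chI: "(\<And>\<tau>. x \<tau> \<noteq> 0 \<Longrightarrow> \<tau> \<in> \<A>) \<Longrightarrow> x \<in> ch \<A>"
  by (simp add: ch_def)

lemma chD: "x \<in> ch \<A> \<Longrightarrow> x \<tau> \<noteq> 0 \<Longrightarrow> \<tau> \<in> \<A>"
  by (simp add: ch_def)

lemma ch_eq_0: "x \<in> ch \<A> \<Longrightarrow> \<tau> \<notin> \<A> \<Longrightarrow> x \<tau> = 0"
  by (auto simp: ch_def)

lemma ch_empty: "x \<in> ch {} \<Longrightarrow> x = 0"
  by (auto simp: ch_def fun_eq_iff)

lemma ch_mono: "\<A> \<subseteq> \<B> \<Longrightarrow> ch \<A> \<subseteq> ch \<B>"
  by (auto simp: ch_def)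

lemma subspace_ch: "fs.subspace (ch \<A>)"
proof (rule fs.subspaceI)
  show "0 \<in> ch \<A>" by (simp add: ch_def)
  show "x + y \<in> ch \<A>" if "x \<in> ch \<A>" "y \<in> ch \<A>" for x y
  proof (rule chI, rule ccontr)
    fix \<tau> assume "(x + y) \<tau> \<noteq> 0" "\<tau> \<notin> \<A>"
    thus False using ch_eq_0[OF that(1)] ch_eq_0[OF that(2)] by simp
  qed
  show "smul c x \<in> ch \<A>" if "x \<in> ch \<A>" for c x
    using that by (auto simp: ch_def)
qed

definition unit_ch :: "'a set \<Rightarrow> 'a set \<Rightarrow> 'k::field" where
  "unit_ch C = (\<lambda>\<tau>. if \<tau> = C then 1 else 0)"

lemma inj_unit_ch: "inj_on (unit_ch :: 'a set \<Rightarrow> 'a set \<Rightarrow> 'k::field) \<A>"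
proof (rule inj_onI)
  fix C D :: "'a set" assume "unit_ch C = (unit_ch D :: 'a set \<Rightarrow> 'k)"
  hence "unit_ch C C = (unit_ch D C :: 'k)" by simp
  thus "C = D" by (simp add: unit_ch_def split: if_splits)
qed

lemma ch_subset_span:
  assumes "finite \<A>"
  shows "ch \<A> \<subseteq> fs.span (unit_ch ` \<A>)"
proof
  fix x :: "'a set \<Rightarrow> 'b" assume x: "x \<in> ch \<A>"
  have "x = (\<Sum>C\<in>\<A>. smul (x C) (unit_ch C))"
  proof
    fix \<tau>
    have "(\<Sum>C\<in>\<A>. smul (x C) (unit_ch C)) \<tau> = (\<Sum>C\<in>\<A>. if \<tau> = C then x C else 0)"
      unfolding fun_sum_apply by (rule sum.cong) (auto simp: unit_ch_def)
    also have "\<dots> = x \<tau>" using assms ch_eq_0[OF x, of \<tau>] by simp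
    finally show "x \<tau> = (\<Sum>C\<in>\<A>. smul (x C) (unit_ch C)) \<tau>" by simp
  qed
  also have "\<dots> \<in> fs.span (unit_ch ` \<A>)"
    by (intro fs.span_sum fs.span_scale fs.span_base) auto
  finally show "x \<in> fs.span (unit_ch ` \<A>)" .
qed

lemma fin_dim_ch: "finite \<A> \<Longrightarrow> fs.fin_dim (ch \<A>)"
  unfolding fs.fin_dim_def using ch_subset_span by (intro exI[of _ "unit_ch ` \<A>"]) simp

lemma dim_ch:
  assumes "finite \<A>"
  shows "fs.dim (ch \<A> :: ('a set \<Rightarrow> 'k::field) set) = card \<A>"
proof -
  let ?u = "unit_ch :: 'a set \<Rightarrow> 'a set \<Rightarrow> 'k"
  have "fs.indep_family \<A> ?u" using indep_indicators[OF assms] by (simp add: unit_ch_def[abs_def])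
  hence i: "fs.independent (?u ` \<A>)" unfolding fs.indep_family_iff[OF assms] by simp
  have "?u ` \<A> \<subseteq> ch \<A>" by (auto simp: unit_ch_def ch_def split: if_splits)
  hence "card (?u ` \<A>) = fs.dim (ch \<A> :: ('a set \<Rightarrow> 'k) set)"
    by (rule fs.basis_card_eq_dim[OF _ ch_subset_span[OF assms] i])
  thus ?thesis by (simp add: card_image inj_unit_ch)
qed

lemma pd_ch:
  assumes "x \<in> ch \<A>" "\<And>C. C \<in> \<A> \<Longrightarrow> v \<in> C \<Longrightarrow> C - {v} \<in> \<B>"
  shows "pd v x \<in> ch \<B>"
proof (rule chI)
  fix \<tau> assume "pd v x \<tau> \<noteq> 0"
  hence t: "v \<notin> \<tau>" "x (insert v \<tau>) \<noteq> 0" by (auto simp: pd_def split: if_splits)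
  thus "\<tau> \<in> \<B>" using assms(2)[OF chD[OF assms(1) t(2)]] by simp
qed

lemma contr_ch:
  assumes "x \<in> ch \<A>" "\<And>C v. C \<in> \<A> \<Longrightarrow> v \<in> C \<Longrightarrow> C - {v} \<in> \<B>"
  shows "contr V \<theta> x \<in> ch \<B>"
  unfolding contr_def
  by (intro fs.subspace_sum[OF subspace_ch] fs.subspace_scale[OF subspace_ch] pd_ch[OF assms(1)] assms(2))

lemma contr_cong:
  assumes "x \<in> ch \<A>" "\<And>v. v \<in> \<Union>\<A> \<Longrightarrow> \<theta> v = \<eta> v"
  shows "contr V \<theta> x = contr V \<eta> x"
proof -
  have "smul (\<theta> v) (pd v x) = smul (\<eta> v) (pd v x)" for v
  proof (cases "v \<in> \<Union>\<A>")
    case False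
    have "pd v x \<in> ch {}" by (rule pd_ch[OF assms(1)]) (use False in auto)
    thus ?thesis by (simp add: ch_empty)
  qed (use assms in simp)
  thus ?thesis by (simp only: contr_def)
qed

lemma finite_face:
  assumes "simplicial_complex K" "F \<in> K"
  shows "finite F"
proof -
  have "Pow F \<subseteq> K" "finite K" using assms by (auto simp: simplicial_complex_def)
  hence "finite (Pow F)" by (rule finite_subset)
  thus ?thesis by simp
qed

lemma face_subset: "simplicial_complex K \<Longrightarrow> F \<in> K \<Longrightarrow> G \<subseteq> F \<Longrightarrow> G \<in> K"
  unfolding simplicial_complex_def by blast

lemma empty_face: "simplicial_complex K \<Longrightarrow> {} \<in> K"
  unfolding simplicial_complex_def by blast

lemma complex_link:
  assumes "simplicial_complex K" "A \<in> K"
  shows "simplicial_complex (link K A)"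
  unfolding simplicial_complex_def
proof (intro conjI ballI allI impI)
  have "{} \<in> link K A" using assms empty_face by (auto simp: link_def)
  thus "link K A \<noteq> {}" by blast
  show "finite (link K A)" using assms by (simp add: link_def simplicial_complex_def)
  fix B C assume B: "B \<in> link K A" "C \<subseteq> B"
  hence "A \<union> C \<in> K" using face_subset[OF assms(1), of "A \<union> B" "A \<union> C"] by (auto simp: link_def)
  thus "C \<in> link K A" using B face_subset[OF assms(1), of B C] by (auto simp: link_def)
qed

lemma complex_del:
  assumes "simplicial_complex K"
  shows "simplicial_complex (del K v)"
proof -
  have "{} \<in> del K v" using empty_face[OF assms] by (simp add: del_def)
  moreover have "finite (del K v)" using assms by (simp add: del_def simplicial_complex_def)
  moreover have "B \<in> del K v" if "A \<in> del K v" "B \<subseteq> A" for A B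
    using that face_subset[OF assms, of A B] by (auto simp: del_def)
  ultimately show ?thesis unfolding simplicial_complex_def by auto
qed

lemma finite_faces: "simplicial_complex K \<Longrightarrow> finite (faces k K)"
  by (simp add: faces_def simplicial_complex_def)

lemma contr_faces:
  assumes "simplicial_complex K" "x \<in> ch (faces k K)"
  shows "contr V \<theta> x \<in> ch (faces (k - 1) K)"
  by (rule contr_ch[OF assms(2)])
    (use assms(1) in \<open>auto simp: faces_def intro: face_subset\<close>)

lemma link_empty: "simplicial_complex K \<Longrightarrow> link K {} = K"
  by (auto simp: link_def)

lemma link_link:
  assumes "simplicial_complex K" "A \<inter> B = {}"
  shows "link (link K A) B = link K (A \<union> B)"
proof -
  have "C \<in> link (link K A) B \<longleftrightarrow> C \<in> link K (A \<union> B)" for C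
  proof
    assume "C \<in> link K (A \<union> B)"
    hence C: "(A \<union> B) \<inter> C = {}" "A \<union> B \<union> C \<in> K" by (auto simp: link_def)
    have "C \<in> K" "A \<union> C \<in> K" "B \<union> C \<in> K"
      by (rule face_subset[OF assms(1) C(2)]; blast)+
    thus "C \<in> link (link K A) B" using C assms(2) by (auto simp: link_def Un_assoc)
  qed (auto simp: link_def Un_assoc)
  thus ?thesis by blast
qed

text \<open>Here \<open>k\<close> counts vertices: for the form that is constantly 1 this is
  vanishing of reduced homology in dimension \<open>k - 1\<close>.\<close>

definition exact_at :: "'a::linorder set \<Rightarrow> ('a \<Rightarrow> 'k::field) \<Rightarrow> nat \<Rightarrow> 'a set set \<Rightarrow> bool" where
  "exact_at V \<theta> k K \<longleftrightarrow>
    (\<forall>x\<in>ch (faces k K). contr V \<theta> x = 0 \<longrightarrow> (\<exists>u\<in>ch (faces (Suc k) K). contr V \<theta> u = x))"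

text \<open>A quantitative form of the Cohen-Macaulay property that survives links and deletions of
  a vertex with a loss of one; for a Cohen-Macaulay complex \<open>\<rho>\<close> may be the size of
  its facets. \<open>V\<close> only has to contain the vertices, so it stays fixed when the complex
  shrinks.\<close>

definition deep :: "'a::linorder set \<Rightarrow> ('a \<Rightarrow> 'k::field) \<Rightarrow> nat \<Rightarrow> 'a set set \<Rightarrow> bool" where
  "deep V \<theta> \<rho> K \<longleftrightarrow> simplicial_complex K \<and> \<Union>K \<subseteq> V \<and>
    (\<forall>C\<in>K. \<forall>k. k + card C < \<rho> \<longrightarrow> exact_at V \<theta> k (link K C))"

lemma exact_atD:
  assumes "exact_at V \<theta> k K" "x \<in> ch (faces k K)" "contr V \<theta> x = 0"
  obtains u where "u \<in> ch (faces (Suc k) K)" "contr V \<theta> u = x"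
  using assms unfolding exact_at_def by blast

lemma pd_in_link:
  assumes L: "simplicial_complex L" and x: "x \<in> ch (faces k L)"
  shows "pd v x \<in> ch (faces (k - 1) (link L {v}))"
proof (rule pd_ch[OF x])
  fix C assume "C \<in> faces k L" "v \<in> C"
  thus "C - {v} \<in> faces (k - 1) (link L {v})"
    using face_subset[OF L, of C "C - {v}"]
    by (auto simp: faces_def link_def insert_absorb)
qed

lemma diff_ext_pd_in_del:
  assumes L: "simplicial_complex L" and x: "x \<in> ch (faces k L)"
  shows "x - ext v (pd v x) \<in> ch (faces k (del L v))"
proof (rule chI)
  fix \<tau> assume t: "(x - ext v (pd v x)) \<tau> \<noteq> 0"
  have "x \<tau> = 0" if "infinite \<tau>"
    by (rule ch_eq_0[OF x]) (use that finite_face[OF L] in \<open>auto simp: faces_def\<close>)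
  hence "(x - ext v (pd v x)) \<tau> = (if v \<in> \<tau> then 0 else x \<tau>)" by (simp add: ext_pd_same)
  hence "v \<notin> \<tau>" "x \<tau> \<noteq> 0" using t by (auto split: if_splits)
  thus "\<tau> \<in> faces k (del L v)" using chD[OF x] by (auto simp: faces_def del_def)
qed

lemma deep_link:
  assumes "deep V \<theta> \<rho> K" "{v} \<in> K"
  shows "deep V \<theta> (\<rho> - 1) (link K {v})"
  unfolding deep_def
proof (intro conjI ballI allI impI)
  have K: "simplicial_complex K" "\<Union>K \<subseteq> V" using assms by (auto simp: deep_def)
  show "simplicial_complex (link K {v})" by (rule complex_link[OF K(1) assms(2)])
  show "\<Union>(link K {v}) \<subseteq> V" using K(2) by (auto simp: link_def)
  fix C k assume C: "C \<in> link K {v}" and k: "k + card C < \<rho> - 1"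
  have vC: "v \<notin> C" "insert v C \<in> K" "C \<in> K" using C by (auto simp: link_def)
  have "k + card (insert v C) < \<rho>"
    using k vC finite_face[OF K(1) vC(3)] by simp
  hence "exact_at V \<theta> k (link K (insert v C))" using assms(1) vC by (simp add: deep_def)
  moreover have "link (link K {v}) C = link K (insert v C)"
    using link_link[OF K(1), of "{v}" C] vC by simp
  ultimately show "exact_at V \<theta> k (link (link K {v}) C)" by simp
qed

text \<open>A filling \<open>u\<close> of \<open>x\<close> in \<open>L\<close> may use
  \<open>v\<close>. Its part \<open>w = pd v u\<close> is a cycle of the link, so \<open>w\<close>
  is the contraction of some \<open>w'\<close> there, and \<open>u - ext v w + \<theta> v w'\<close>
  still fills \<open>x\<close> but avoids \<open>v\<close>.\<close>

lemma exact_at_del: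
  assumes fin: "finite V" and L: "simplicial_complex L" "\<Union>L \<subseteq> V"
    and ex: "exact_at V \<theta> k L" and exl: "{v} \<in> L \<Longrightarrow> exact_at V \<theta> k (link L {v})"
  shows "exact_at V \<theta> k (del L v)"
proof (cases "{v} \<in> L")
  case False
  hence "del L v = L" using face_subset[OF L(1), of _ "{v}"] by (auto simp: del_def)
  thus ?thesis using ex by simp
next
  case True
  show ?thesis unfolding exact_at_def
  proof (intro ballI impI)
    fix x assume x: "x \<in> ch (faces k (del L v))" "contr V \<theta> x = 0"
    have "faces k (del L v) \<subseteq> faces k L" by (auto simp: faces_def del_def)
    hence "x \<in> ch (faces k L)" using x(1) ch_mono by blast
    then obtain u where u: "u \<in> ch (faces (Suc k) L)" "contr V \<theta> u = x"
      using exact_atD[OF ex _ x(2)] by blast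
    define w where "w = pd v u"
    have w: "w \<in> ch (faces k (link L {v}))" unfolding w_def using pd_in_link[OF L(1) u(1)] by simp
    have pdx: "pd v x = 0"
    proof -
      have "pd v x \<in> ch {}" by (rule pd_ch[OF x(1)]) (auto simp: faces_def del_def)
      thus ?thesis by (rule ch_empty)
    qed
    have cw: "contr V \<theta> w = 0" using pd_contr[of v V \<theta> u] pdx u(2) unfolding w_def by simp
    obtain w' where w': "w' \<in> ch (faces (Suc k) (link L {v}))" "contr V \<theta> w' = w"
      using exact_atD[OF exl[OF True] w cw] by blast
    have winf: "w \<tau> = 0" if "infinite \<tau>" for \<tau> using that by (simp add: w_def pd_def)
    have vV: "v \<in> V" using L(2) True by blast
    have "contr V \<theta> (ext v w) = smul (\<theta> v) w - ext v (contr V \<theta> w)"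
      by (rule contr_ext[OF fin vV winf])
    hence cext: "contr V \<theta> (ext v w) = smul (\<theta> v) w" using cw ext.zero by simp
    let ?u = "u - ext v w + smul (\<theta> v) w'"
    have "contr V \<theta> ?u = x"
      by (simp add: contr.add contr.diff contr.scale u(2) cext w'(2))
    moreover have "?u \<in> ch (faces (Suc k) (del L v))"
    proof (rule fs.subspace_add[OF subspace_ch _ fs.subspace_scale[OF subspace_ch]])
      show "w' \<in> ch (faces (Suc k) (del L v))"
        using w'(1) ch_mono[of "faces (Suc k) (link L {v})" "faces (Suc k) (del L v)"]
        by (auto simp: faces_def link_def del_def)
      show "u - ext v w \<in> ch (faces (Suc k) (del L v))"
        unfolding w_def by (rule diff_ext_pd_in_del[OF L(1) u(1)])
    qed
    ultimately show "\<exists>u\<in>ch (faces (Suc k) (del L v)). contr V \<theta> u = x" by blast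
  qed
qed

text \<open>The loss of one is caused by \<open>exact_at_del\<close>, which consults the link of
  \<open>insert v C\<close> in the same degree.\<close>

lemma deep_del:
  assumes "finite V" "deep V \<theta> \<rho> K"
  shows "deep V \<theta> (\<rho> - 1) (del K v)"
  unfolding deep_def
proof (intro conjI ballI allI impI)
  have K: "simplicial_complex K" "\<Union>K \<subseteq> V" using assms by (auto simp: deep_def)
  show "simplicial_complex (del K v)" by (rule complex_del[OF K(1)])
  show "\<Union>(del K v) \<subseteq> V" using K(2) by (auto simp: del_def)
  fix C k assume C: "C \<in> del K v" and k: "k + card C < \<rho> - 1"
  have vC: "v \<notin> C" "C \<in> K" using C by (auto simp: del_def)
  have e: "link (del K v) C = del (link K C) v" using vC by (auto simp: link_def del_def)
  show "exact_at V \<theta> k (link (del K v) C)" unfolding e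
  proof (rule exact_at_del[OF assms(1)])
    show "simplicial_complex (link K C)" by (rule complex_link[OF K(1) vC(2)])
    show "\<Union>(link K C) \<subseteq> V" using K(2) by (auto simp: link_def)
    show "exact_at V \<theta> k (link K C)" using assms(2) vC k by (simp add: deep_def)
    assume v: "{v} \<in> link K C"
    hence v': "insert v C \<in> K" by (simp add: link_def)
    have "k + card (insert v C) < \<rho>"
      using k vC finite_face[OF K(1) vC(2)] by simp
    hence "exact_at V \<theta> k (link K (insert v C))" using assms(2) v' by (simp add: deep_def)
    moreover have "link (link K C) {v} = link K (insert v C)"
      using link_link[OF K(1), of C "{v}"] vC by simp
    ultimately show "exact_at V \<theta> k (link (link K C) {v})" by simp
  qed
qed

lemma exact_at_rescale:
  fixes \<theta> :: "'a::linorder \<Rightarrow> 'k::field"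
  assumes fin: "finite V" and K: "simplicial_complex K"
    and nz: "\<And>v. v \<in> \<Union>K \<Longrightarrow> \<theta> v \<noteq> 0" and ex: "exact_at V (\<lambda>_. 1 :: 'k) k K"
  shows "exact_at V \<theta> k K"
  unfolding exact_at_def
proof (intro ballI impI)
  fix x assume x: "x \<in> ch (faces k K)" "contr V \<theta> x = 0"
  \<comment> \<open>The weights \<open>s\<close> have to be invertible on all sets. Replacing zeros
    by 1 changes \<open>\<theta>\<close> only away from the vertices of \<open>K\<close>, where
    chains do not see it.\<close>
  define \<eta> where "\<eta> v = (if \<theta> v = 0 then 1 else \<theta> v)" for v
  define s where "s \<tau> = prod \<eta> \<tau>" for \<tau>
  have \<eta>: "\<eta> v \<noteq> 0" for v by (simp add: \<eta>_def)
  hence s: "s \<tau> \<noteq> 0" for \<tau>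
    by (cases "finite \<tau>") (simp_all add: s_def)
  have si: "s (insert v \<tau>) = \<eta> v * s \<tau>" if "finite \<tau>" "v \<notin> \<tau>" for v \<tau>
    unfolding s_def using that by simp
  have key: "contr V (\<lambda>_. 1) (\<lambda>\<tau>. s \<tau> * y \<tau>) = (\<lambda>\<tau>. s \<tau> * contr V \<eta> y \<tau>)" for y
  proof
    fix \<tau>
    show "contr V (\<lambda>_. 1) (\<lambda>\<tau>. s \<tau> * y \<tau>) \<tau> = s \<tau> * contr V \<eta> y \<tau>"
      unfolding contr_apply sum_distrib_left by (rule sum.cong) (auto simp: pd_def si)
  qed
  have cong: "contr V \<theta> y = contr V \<eta> y" if "y \<in> ch (faces j K)" for y j
    by (rule contr_cong[OF that]) (use nz in \<open>auto simp: \<eta>_def faces_def\<close>)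
  have A: "(\<lambda>\<tau>. s \<tau> * x \<tau>) \<in> ch (faces k K)" using x(1) by (auto simp: ch_def)
  have B: "contr V (\<lambda>_. 1) (\<lambda>\<tau>. s \<tau> * x \<tau>) = 0"
    unfolding key using x(2) cong[OF x(1)] by (simp add: fun_eq_iff)
  obtain u where u: "u \<in> ch (faces (Suc k) K)" "contr V (\<lambda>_. 1) u = (\<lambda>\<tau>. s \<tau> * x \<tau>)"
    by (rule exact_atD[OF ex A B])
  define w where "w \<tau> = u \<tau> / s \<tau>" for \<tau>
  have w: "w \<in> ch (faces (Suc k) K)" using u(1) by (auto simp: ch_def w_def)
  have "(\<lambda>\<tau>. s \<tau> * w \<tau>) = u" using s by (simp add: w_def fun_eq_iff)
  hence "(\<lambda>\<tau>. s \<tau> * contr V \<eta> w \<tau>) = (\<lambda>\<tau>. s \<tau> * x \<tau>)" using key[of w] u(2) by simp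
  hence "contr V \<eta> w = x" using s by (simp add: fun_eq_iff)
  hence "contr V \<theta> w = x" using cong[OF w] by simp
  thus "\<exists>u\<in>ch (faces (Suc k) K). contr V \<theta> u = x" using w by blast
qed

text \<open>A zero of \<open>\<theta>\<close> is traded for one degree of depth by passing to its link and its deletion; a
  form without zeros is a rescaling of the boundary.\<close>

lemma exact_at_few_zeros:
  fixes \<theta> :: "'a::linorder \<Rightarrow> 'k::field"
  assumes fin: "finite V" and "deep V (\<lambda>_. 1 :: 'k) \<rho> K"
    and "card {v\<in>\<Union>K. \<theta> v = 0} \<le> b" and "k + b < \<rho>"
  shows "exact_at V \<theta> k K"
  using assms(2-4)
proof (induction b arbitrary: K \<rho> k)
  case 0
  have K: "simplicial_complex K" "\<Union>K \<subseteq> V" using 0 by (auto simp: deep_def)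
  have "finite {v\<in>\<Union>K. \<theta> v = 0}" by (rule finite_subset[OF _ fin]) (use K in auto)
  hence z: "{v\<in>\<Union>K. \<theta> v = 0} = {}" using 0(2) by simp
  show ?case
  proof (rule exact_at_rescale[OF fin K(1)])
    show "\<theta> v \<noteq> 0" if "v \<in> \<Union>K" for v using z that by blast
    have "exact_at V (\<lambda>_. 1 :: 'k) k (link K {})"
      using 0(1,3) empty_face[OF K(1)] by (simp add: deep_def)
    thus "exact_at V (\<lambda>_. 1 :: 'k) k K" by (simp add: link_empty[OF K(1)])
  qed
next
  case (Suc b)
  have K: "simplicial_complex K" "\<Union>K \<subseteq> V" using Suc.prems by (auto simp: deep_def)
  show ?case
  proof (cases "card {v\<in>\<Union>K. \<theta> v = 0} \<le> b")
    case True
    thus ?thesis using Suc.IH[OF Suc.prems(1)] Suc.prems(3) by simp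
  next
    case False
    hence "{v\<in>\<Union>K. \<theta> v = 0} \<noteq> {}" by (metis card.empty le0)
    then obtain v where v: "v \<in> \<Union>K" "\<theta> v = 0" by blast
    have vK: "{v} \<in> K" using v(1) face_subset[OF K(1), of _ "{v}"] by blast
    have vV: "v \<in> V" using v(1) K(2) by blast
    have finz: "finite {v\<in>\<Union>K. \<theta> v = 0}" by (rule finite_subset[OF _ fin]) (use K in auto)
    have z: "card {u\<in>\<Union>L. \<theta> u = 0} \<le> b" if "\<Union>L \<subseteq> \<Union>K - {v}" for L
    proof -
      have "{u\<in>\<Union>L. \<theta> u = 0} \<subseteq> {u\<in>\<Union>K. \<theta> u = 0} - {v}" using that by blast
      hence "card {u\<in>\<Union>L. \<theta> u = 0} \<le> card ({u\<in>\<Union>K. \<theta> u = 0} - {v})"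
        using finz by (intro card_mono) auto
      also have "\<dots> = card {u\<in>\<Union>K. \<theta> u = 0} - 1" using v finz by (simp add: card_Diff_singleton)
      finally show ?thesis using Suc.prems(2) by simp
    qed
    have exd: "exact_at V \<theta> k (del K v)"
      by (rule Suc.IH[OF deep_del[OF fin Suc.prems(1)] z]) (use Suc.prems(3) in \<open>auto simp: del_def\<close>)
    have exl: "exact_at V \<theta> (k - 1) (link K {v})" if "k > 0"
      by (rule Suc.IH[OF deep_link[OF Suc.prems(1) vK] z])
        (use Suc.prems(3) that in \<open>auto simp: link_def\<close>)
    show ?thesis unfolding exact_at_def
    proof (intro ballI impI)
      fix x assume x: "x \<in> ch (faces k K)" "contr V \<theta> x = 0"
      define y where "y = pd v x"
      have y: "y \<in> ch (faces (k - 1) (link K {v}))" unfolding y_def by (rule pd_in_link[OF K(1) x(1)])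
      have cy: "contr V \<theta> y = 0" using pd_contr[of v V \<theta> x] x(2) pd.zero unfolding y_def by simp
      obtain w where w: "w \<in> ch (faces k (link K {v}))" "contr V \<theta> w = y"
      \<comment> \<open>For \<open>k = 0\<close> the degree \<open>k - 1\<close> is truncated and
        says nothing; there \<open>x\<close> lives on the empty face, so
        \<open>y = 0\<close>.\<close>
      proof (cases "k = 0")
        case True
        have "y \<in> ch {}" unfolding y_def
        proof (rule pd_ch[OF x(1)])
          fix C assume "C \<in> faces k K" "v \<in> C"
          thus "C - {v} \<in> {}"
            using True finite_face[OF K(1), of C] by (auto simp: faces_def)
        qed
        hence "y = 0" by (rule ch_empty)
        thus ?thesis using that[of 0] fs.subspace_0[OF subspace_ch] contr.zero by metis
      next
        case False
        hence "k > 0" "Suc (k - 1) = k" by auto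
        thus ?thesis using exact_atD[OF exl y cy] that by metis
      qed
      have winf: "w \<tau> = 0" if "infinite \<tau>" for \<tau>
        using that ch_eq_0[OF w(1)] finite_face[OF K(1)]
        by (auto simp: faces_def link_def)
      have "contr V \<theta> (ext v w) = smul (\<theta> v) w - ext v (contr V \<theta> w)"
        by (rule contr_ext[OF fin vV winf])
      \<comment> \<open>Because \<open>\<theta> v = 0\<close>, the part \<open>ext v y\<close> of
        \<open>x\<close> that contains \<open>v\<close> is the contraction of
        \<open>- ext v w\<close>; the rest of \<open>x\<close> lives in the deletion.\<close>
      hence cext: "contr V \<theta> (ext v w) = - ext v y" using v(2) w(2) by (simp add: fun_eq_iff)
      have ew: "ext v w \<in> ch (faces (Suc k) K)"
      proof (rule chI)
        fix \<tau> assume "ext v w \<tau> \<noteq> 0"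
        hence t: "finite \<tau>" "v \<in> \<tau>" "w (\<tau> - {v}) \<noteq> 0" by (auto simp: ext_def split: if_splits)
        moreover have "card \<tau> = Suc (card (\<tau> - {v}))" using card_Suc_Diff1[OF t(1,2)] by simp
        ultimately show "\<tau> \<in> faces (Suc k) K" using chD[OF w(1) t(3)]
          by (simp add: faces_def link_def insert_absorb)
      qed
      let ?r = "x - ext v y"
      have "?r \<in> ch (faces k (del K v))" unfolding y_def by (rule diff_ext_pd_in_del[OF K(1) x(1)])
      moreover have "contr V \<theta> ?r = 0"
      proof -
        have "contr V \<theta> (ext v y) = - contr V \<theta> (contr V \<theta> (ext v w))"
          unfolding cext by (simp add: contr.neg)
        thus ?thesis using x(2) by (simp add: contr.diff)
      qed
      ultimately obtain u where u: "u \<in> ch (faces (Suc k) (del K v))" "contr V \<theta> u = ?r"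
        using exact_atD[OF exd] by blast
      have "u \<in> ch (faces (Suc k) K)"
        using u(1) ch_mono[of "faces (Suc k) (del K v)" "faces (Suc k) K"] by (auto simp: faces_def del_def)
      hence "u - ext v w \<in> ch (faces (Suc k) K)" using fs.subspace_diff[OF subspace_ch] ew by blast
      moreover have "contr V \<theta> (u - ext v w) = x" using u(2) cext by (simp add: contr.diff)
      ultimately show "\<exists>u\<in>ch (faces (Suc k) K). contr V \<theta> u = x" by blast
    qed
  qed
qed

section \<open>Chains killed by several linear forms\<close>

lemma contr_in_form: "contr V (\<lambda>v. \<theta> v - l * \<eta> v) x = contr V \<theta> x - smul l (contr V \<eta> x)"
  unfolding contr_def fs.scale_sum_right sum_subtractf[symmetric]
  by (rule sum.cong) (auto simp: fun_eq_iff algebra_simps)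

lemma contr_add_form: "contr V (\<lambda>v. \<theta> v + l * \<eta> v) x = contr V \<theta> x + smul l (contr V \<eta> x)"
  using contr_in_form[of V \<theta> "- l" \<eta> x] by (simp add: fun_eq_iff)

fun contrs :: "'a::linorder set \<Rightarrow> ('a \<Rightarrow> 'k::field) list \<Rightarrow> ('a set \<Rightarrow> 'k) \<Rightarrow> 'a set \<Rightarrow> 'k" where
  "contrs V [] x = x"
| "contrs V (t # T) x = contr V t (contrs V T x)"

lemma lin_contrs: "lin_endo (contrs V T)"
proof (rule fs.linear_endoI)
  show "contrs V T (x + y) = contrs V T x + contrs V T y" for x y
    by (induction T) (simp_all only: contrs.simps contr.add)
  show "contrs V T (smul c x) = smul c (contrs V T x)" for c x
    by (induction T) (simp_all only: contrs.simps contr.scale)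
qed

global_interpretation contrs: Vector_Spaces.linear smul smul "contrs V T" for V T by (rule lin_contrs)

text \<open>The sign is put on \<open>u\<close>, so that the right-hand side is visibly a value of
  \<open>contrs V T\<close> on a contraction.\<close>

lemma contr_contrs_commute: "contr V t (contrs V T u) = contrs V T (contr V t (smul ((-1) ^ length T) u))"
proof (induction T arbitrary: u)
  case Nil
  have "smul 1 u = u" by (simp add: fun_eq_iff)
  thus ?case by simp
next
  case (Cons s T)
  have "contr V t (contrs V (s # T) u) = - contr V s (contr V t (contrs V T u))"
    using contr_anticomm[of V t s "contrs V T u"] by simp
  also have "\<dots> = contr V s (contrs V T (- contr V t (smul ((-1) ^ length T) u)))"
    by (simp only: Cons.IH contr.neg contrs.neg)
  also have "- contr V t (smul ((-1) ^ length T) u) = contr V t (smul ((-1) ^ length (s # T)) u)"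
    by (simp only: contr.scale length_Cons power_Suc) (simp add: fun_eq_iff)
  finally show ?case by (simp only: contrs.simps)
qed

lemma contr_contrs_mem:
  assumes "t \<in> set T"
  shows "contr V t (contrs V T u) = 0"
  using assms
proof (induction T)
  case (Cons s T)
  show ?case
  proof (cases "t = s")
    case False
    have "contr V t (contrs V T u) = 0" by (rule Cons.IH) (use Cons.prems False in simp)
    thus ?thesis unfolding contrs.simps by (rule contr_contr_eq_0)
  qed simp
qed simp

lemma contrs_faces:
  assumes "simplicial_complex K" "x \<in> ch (faces (k + length T) K)"
  shows "contrs V T x \<in> ch (faces k K)"
  using assms(2)
proof (induction T arbitrary: k)
  case (Cons t T)
  have "contrs V T x \<in> ch (faces (Suc k) K)" by (rule Cons.IH) (use Cons.prems in simp)
  thus ?case using contr_faces[OF assms(1), of _ "Suc k" V t] by simp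
qed simp

definition killed :: "'a::linorder set \<Rightarrow> ('a \<Rightarrow> 'k::field) set \<Rightarrow> ('a set \<Rightarrow> 'k) set" where
  "killed V S = {x. \<forall>t\<in>S. contr V t x = 0}"

lemma subspace_killed: "fs.subspace (killed V S)"
  by (rule fs.subspaceI) (auto simp: killed_def contr.zero contr.add contr.scale)

text \<open>Every linear form whose top coefficient occurs at \<open>t\<close> has at most as many zeros on \<open>W\<close>
  as forms in general position would, up to a defect \<open>b\<close>.\<close>

fun flag :: "'a set \<Rightarrow> nat \<Rightarrow> ('a \<Rightarrow> 'k::field) list \<Rightarrow> bool" where
  "flag W b [] \<longleftrightarrow> True"
| "flag W b (t # T) \<longleftrightarrow> flag W b T \<and>
    (\<forall>c. card {v\<in>W. t v = (\<Sum>i<length T. c i * (T ! i) v)} \<le> b + length T)"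

lemma flag_Suc: "flag W b T \<Longrightarrow> flag W (Suc b) T"
proof (induction T)
  case (Cons t T)
  thus ?case by (auto simp: le_Suc_eq)
qed simp

text \<open>A coincidence of \<open>D1 - l D2\<close> with a combination of \<open>T\<close> is one
  of \<open>D1\<close> with a combination of \<open>D2 # T\<close>. The list becomes shorter by one
  and the defect larger by one, so length plus defect, the quantity that bounds the induction below,
  is preserved.\<close>

lemma flag_pencil:
  assumes "flag W b (D1 # D2 # T)"
  shows "flag W (Suc b) ((\<lambda>v. D1 v - l * D2 v) # T)"
proof -
  have "card {v\<in>W. D1 v - l * D2 v = (\<Sum>i<length T. c i * (T ! i) v)} \<le> Suc b + length T" for c
  proof -
    let ?c = "\<lambda>i. case i of 0 \<Rightarrow> l | Suc i \<Rightarrow> c i"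
    have "(\<Sum>i<length (D2 # T). ?c i * ((D2 # T) ! i) v) = l * D2 v + (\<Sum>i<length T. c i * (T ! i) v)" for v
      by (simp only: length_Cons sum.lessThan_Suc_shift) simp
    hence "{v\<in>W. D1 v - l * D2 v = (\<Sum>i<length T. c i * (T ! i) v)} =
        {v\<in>W. D1 v = (\<Sum>i<length (D2 # T). ?c i * ((D2 # T) ! i) v)}"
      by (simp only: diff_eq_eq add.commute)
    moreover have "card {v\<in>W. D1 v = (\<Sum>i<length (D2 # T). ?c i * ((D2 # T) ! i) v)} \<le> b + length (D2 # T)"
      using assms by (simp only: flag.simps)
    ultimately show ?thesis by simp
  qed
  moreover have "flag W (Suc b) T" by (rule flag_Suc) (use assms in simp)
  ultimately show ?thesis by simp
qed

text \<open>The inductive step compares the forms \<open>D1 - l D2\<close> for all scalars \<open>l\<close>: contracting with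
  \<open>D1\<close> after dividing by \<open>D2\<close> is an endomorphism modulo the desired image,
  and it has no eigenvalue there.\<close>

lemma killed_chain_is_contraction:
  fixes ts :: "('a::linorder \<Rightarrow> 'k::alg_closed_field) list"
  assumes fin: "finite V" and K: "deep V (\<lambda>_. 1 :: 'k) \<rho> K"
    and "flag (\<Union>K) b ts" and "k + length ts + b \<le> \<rho>"
    and "x \<in> ch (faces k K)" and "x \<in> killed V (set ts)"
  shows "\<exists>u\<in>ch (faces (k + length ts) K). contrs V ts u = x"
  using assms(3-)
proof (induction "length ts" arbitrary: ts b k x rule: less_induct)
  case less
  have K': "simplicial_complex K" using K by (simp add: deep_def)
  consider "ts = []" | t where "ts = [t]" | D1 D2 T where "ts = D1 # D2 # T"
    by (metis list.exhaust)
  thus ?case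
  proof cases
    case 1 thus ?thesis using less.prems by simp
  next
    case (2 t)
    have "card {v\<in>\<Union>K. t v = 0} \<le> b" using less.prems(1) 2 by simp
    moreover have "k + b < \<rho>" using less.prems(2) 2 by simp
    ultimately have "exact_at V t k K" by (rule exact_at_few_zeros[OF fin K])
    thus ?thesis using less.prems(3,4) 2 by (simp add: exact_at_def killed_def)
  next
    case (3 D1 D2 T)
    let ?U = "\<lambda>m. ch (faces m K) :: ('a set \<Rightarrow> 'k) set"
    let ?n = "length T"
    \<comment> \<open>\<open>Z\<close> is the space to be captured, \<open>I\<close> the image that
      should contain it, and \<open>Y\<close> the contractions by the remaining forms one degree
      higher, where \<open>D1\<close> and \<open>D2\<close> are compared.\<close>
    define Y where "Y = contrs V T ` ?U (Suc k + ?n)"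
    define Z where "Z = ?U k \<inter> killed V (set ts)"
    define I where "I = (\<lambda>u. contr V D1 (contr V D2 (contrs V T u))) ` ?U (Suc (Suc k) + ?n)"
    have Y: "fs.subspace Y" unfolding Y_def by (rule contrs.subspace_image[OF subspace_ch])
    have YU: "y \<in> ?U (Suc k)" if "y \<in> Y" for y
      using that unfolding Y_def using contrs_faces[OF K', of _ "Suc k" T] by blast
    have YT: "contr V t y = 0" if "y \<in> Y" "t \<in> set T" for y t
      using that unfolding Y_def by (auto simp: contr_contrs_mem)
    have Z: "fs.subspace Z" unfolding Z_def by (intro fs.subspace_inter subspace_ch subspace_killed)
    have Zfin: "fs.fin_dim Z"
      unfolding Z_def by (rule fs.fin_dim_mono[OF fin_dim_ch[OF finite_faces[OF K']]]) blast
    have lD: "lin_endo (\<lambda>u. contr V D1 (contr V D2 (contrs V T u)))"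
      by (rule fs.linear_endoI) (simp_all add: contr.add contr.scale contrs.add contrs.scale)
    have I: "fs.subspace I"
      unfolding I_def by (rule module_hom.subspace_image[OF _ subspace_ch])
        (use lD in \<open>simp add: module_hom_iff_linear\<close>)
    \<comment> \<open>Dropping \<open>D1\<close> from the list pays for one more degree, hence
      \<open>m \<le> Suc k\<close>.\<close>
    have ihA: "\<exists>u\<in>?U (m + Suc ?n). contr V D2 (contrs V T u) = y"
      if "m \<le> Suc k" "y \<in> ?U m" "contr V D2 y = 0" "\<And>t. t \<in> set T \<Longrightarrow> contr V t y = 0" for m y
    proof -
      have "\<exists>u\<in>?U (m + length (D2 # T)). contrs V (D2 # T) u = y"
        by (rule less.hyps[where b = b]) (use less.prems(1,2) 3 that in \<open>simp_all add: killed_def\<close>)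
      thus ?thesis by simp
    qed
    \<comment> \<open>Here the dropped form pays for the defect \<open>Suc b\<close> of the pencil
      member instead.\<close>
    have ihB: "\<exists>u\<in>?U (Suc k + ?n). contr V (\<lambda>v. D1 v - l * D2 v) (contrs V T u) = y"
      if "y \<in> Z" for y l
    proof -
      have "contr V (\<lambda>v. D1 v - l * D2 v) y = 0"
        using that 3 unfolding contr_in_form Z_def killed_def by simp
      moreover have "contr V t y = 0" if "t \<in> set T" for t using that \<open>y \<in> Z\<close> 3 by (simp add: Z_def killed_def)
      moreover have "y \<in> ?U k" using \<open>y \<in> Z\<close> by (simp add: Z_def)
      moreover have "flag (\<Union>K) (Suc b) ((\<lambda>v. D1 v - l * D2 v) # T)"
        by (rule flag_pencil) (use less.prems(1) 3 in blast)
      ultimately have "\<exists>u\<in>?U (k + length ((\<lambda>v. D1 v - l * D2 v) # T)). contrs V ((\<lambda>v. D1 v - l * D2 v) # T) u = y"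
        by (intro less.hyps[where b = "Suc b"]) (use less.prems(2) 3 in \<open>simp_all add: killed_def\<close>)
      thus ?thesis by simp
    qed
    \<comment> \<open>Two preimages in \<open>Y\<close> of one chain under contraction with
      \<open>D2\<close> differ by such a \<open>y\<close>, and contraction with \<open>D1\<close>
      sends \<open>y\<close> into \<open>I\<close>. So dividing by \<open>D2\<close> and then
      contracting with \<open>D1\<close> is well defined modulo \<open>I\<close>; the linear section
      \<open>s\<close> merely fixes representatives.\<close>
    have ker: "\<exists>w. y = contr V D2 w \<and> contr V D1 (contr V D2 w) \<in> I"
      if y: "y \<in> Y" "contr V D2 y = 0" for y
    proof -
      obtain u where u: "u \<in> ?U (Suc k + Suc ?n)" "contr V D2 (contrs V T u) = y"
        using ihA[OF le_refl YU[OF y(1)] y(2) YT[OF y(1)]] by auto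
      have "contr V D1 (contr V D2 (contrs V T u)) \<in> I" unfolding I_def using u(1) by simp
      thus ?thesis using u(2) by (intro exI[of _ "contrs V T u"]) simp
    qed
    interpret p: vector_space_pair "smul :: 'k \<Rightarrow> ('a set \<Rightarrow> 'k) \<Rightarrow> _" "smul :: 'k \<Rightarrow> ('a set \<Rightarrow> 'k) \<Rightarrow> _" ..
    obtain s where s: "s ` UNIV \<subseteq> Y" "lin_endo s" "\<And>v. v \<in> contr V D2 ` Y \<Longrightarrow> contr V D2 (s v) = v"
      using p.linear_exists_right_inverse_on[OF lin_contr[of V D2] Y] by auto
    interpret s: Vector_Spaces.linear smul smul s by (rule s(2))
    have sY: "s v \<in> Y" for v using s(1) by blast
    define \<phi> where "\<phi> x = contr V D1 (s x)" for x
    have lin: "lin_endo \<phi>"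
      by (rule fs.linear_endoI) (simp_all add: \<phi>_def s.add s.scale contr.add contr.scale)
    have "Z \<subseteq> I"
    proof (rule afs.subset_if_pencil_surjective[OF lin Z Zfin _ I])
      fix z assume z: "z \<in> Z"
      hence zD: "contr V D1 z = 0" "contr V D2 z = 0" "\<And>t. t \<in> set T \<Longrightarrow> contr V t z = 0" "z \<in> ?U k"
        using 3 by (auto simp: Z_def killed_def)
      obtain u where u: "u \<in> ?U (k + Suc ?n)" "contr V D2 (contrs V T u) = z"
        using ihA[of k z] zD by auto
      have "contrs V T u \<in> Y" unfolding Y_def using u(1) by simp
      hence D2s: "contr V D2 (s z) = z" using s(3)[of z] u(2) by blast
      have "contr V D1 (s z) \<in> ?U k" using contr_faces[OF K' YU[OF sY], of V D1] by simp
      moreover have "contr V D2 (contr V D1 (s z)) = 0"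
        using contr_anticomm[of V D2 D1 "s z"] D2s zD(1) by simp
      moreover have "contr V t (contr V D1 (s z)) = 0" if "t \<in> set T" for t
        by (rule contr_contr_eq_0[OF YT[OF sY that]])
      ultimately show "\<phi> z \<in> Z" using 3 by (simp add: Z_def killed_def \<phi>_def)
    next
      fix x assume "x \<in> I"
      then obtain u where u: "u \<in> ?U (Suc (Suc k) + ?n)" "x = contr V D1 (contr V D2 (contrs V T u))"
        unfolding I_def by blast
      define y where "y = - contr V D1 (contrs V T u)"
      have "contr V D1 (smul ((-1) ^ ?n) u) \<in> ?U (Suc k + ?n)"
        using contr_faces[OF K' fs.subspace_scale[OF subspace_ch u(1)], of V D1] by simp
      hence "contr V D1 (contrs V T u) \<in> Y" unfolding Y_def contr_contrs_commute by (rule imageI)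
      hence y: "y \<in> Y" unfolding y_def by (rule fs.subspace_neg[OF Y])
      have D2y: "contr V D2 y = x"
        using contr_anticomm[of V D2 D1 "contrs V T u"] by (simp add: y_def contr.neg u(2))
      hence D2s: "contr V D2 (s x) = x" using s(3)[of x] y by blast
      have "s x - y \<in> Y" by (rule fs.subspace_diff[OF Y sY y])
      moreover have "contr V D2 (s x - y) = 0" by (simp add: contr.diff D2s D2y)
      ultimately obtain w where w: "s x - y = contr V D2 w" "contr V D1 (contr V D2 w) \<in> I"
        using ker by blast
      have "\<phi> x = contr V D1 y + contr V D1 (s x - y)" unfolding \<phi>_def by (simp add: contr.diff)
      also have "contr V D1 y = 0" by (simp add: y_def contr.neg)
      finally show "\<phi> x \<in> I" using w by simp
    next
      fix l x assume x: "x \<in> Z"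
      then obtain u where u: "u \<in> ?U (Suc k + ?n)" "contr V (\<lambda>v. D1 v - l * D2 v) (contrs V T u) = x"
        using ihB by blast
      define y where "y = contrs V T u"
      have y: "y \<in> Y" unfolding Y_def y_def using u(1) by (rule imageI)
      have xy: "x = contr V D1 y - smul l (contr V D2 y)" using u(2) by (simp add: contr_in_form y_def)
      have xD: "contr V D2 x = 0" using x 3 by (simp add: Z_def killed_def)
      \<comment> \<open>This \<open>z\<close> solves the equation: \<open>\<phi> z\<close> agrees
        with the contraction of \<open>y\<close> by \<open>D1\<close> modulo \<open>I\<close>, hence
        \<open>\<phi> z - l z\<close> agrees with \<open>x\<close>.\<close>
      define z where "z = contr V D2 y"
      have D21: "contr V D2 (contr V D1 y) = 0" using xD unfolding xy by (simp add: contr.diff contr.scale)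
      have "contr V D1 z = 0" using contr_anticomm[of V D1 D2 y] D21 by (simp add: z_def)
      moreover have "contr V D2 z = 0" by (simp add: z_def)
      moreover have "contr V t z = 0" if "t \<in> set T" for t
        unfolding z_def by (rule contr_contr_eq_0[OF YT[OF y that]])
      moreover have "z \<in> ?U k" using contr_faces[OF K' YU[OF y], of V D2] by (simp add: z_def)
      ultimately have z: "z \<in> Z" using 3 by (simp add: Z_def killed_def)
      have D2s: "contr V D2 (s z) = z" using s(3)[of z] y unfolding z_def by blast
      have "s z - y \<in> Y" by (rule fs.subspace_diff[OF Y sY y])
      moreover have "contr V D2 (s z - y) = 0" by (simp add: contr.diff D2s) (simp add: z_def)
      ultimately obtain w where w: "s z - y = contr V D2 w" "contr V D1 (contr V D2 w) \<in> I"
        using ker by blast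
      have "contr V D1 (s z - y) \<in> I" using w by simp
      hence m: "- contr V D1 (s z - y) \<in> I" by (rule fs.subspace_neg[OF I])
      have "x - (\<phi> z - smul l z) = - contr V D1 (s z - y)"
        unfolding xy \<phi>_def z_def[symmetric] contr.diff by simp
      hence "x - (\<phi> z - smul l z) \<in> I" using m by simp
      thus "\<exists>z\<in>Z. x - (\<phi> z - smul l z) \<in> I" using z by blast
    qed
    moreover have "x \<in> Z" using less.prems(3,4) by (simp add: Z_def)
    ultimately obtain u where "u \<in> ?U (Suc (Suc k) + ?n)" "x = contr V D1 (contr V D2 (contrs V T u))"
      unfolding I_def by blast
    thus ?thesis using 3 by (intro bexI[of _ u]) simp_all
  qed
qed

section \<open>Splitting spaces of chains by generic forms\<close>

declare smul_apply [simp del] zero_fun_apply [simp del]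

text \<open>A node at depth \<open>j\<close> of the binary splitting tree of \<open>M\<close>;
  \<open>I\<close> lists the forms at which the branch goes to the image instead of the kernel. Only
  the part of \<open>I\<close> below \<open>j\<close> matters.\<close>

fun nd :: "'a::linorder set \<Rightarrow> (nat \<Rightarrow> 'a \<Rightarrow> 'k::field) \<Rightarrow> ('a set \<Rightarrow> 'k) set \<Rightarrow> nat \<Rightarrow> nat set \<Rightarrow> ('a set \<Rightarrow> 'k) set" where
  "nd V th M 0 I = M"
| "nd V th M (Suc j) I = (if j \<in> I then contr V (th j) ` nd V th M j I
     else {x\<in>nd V th M j I. contr V (th j) x = 0})"

lemma subspace_nd:
  assumes "fs.subspace M"
  shows "fs.subspace (nd V th M j I)"
proof (induction j)
  case (Suc j)
  have "{x\<in>nd V th M j I. contr V (th j) x = 0} = nd V th M j I \<inter> killed V {th j}"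
    by (auto simp: killed_def)
  thus ?case using contr.subspace_image[OF Suc] fs.subspace_inter[OF Suc subspace_killed] by simp
qed (use assms in simp)

lemma fin_dim_nd:
  assumes "fs.fin_dim M"
  shows "fs.fin_dim (nd V th M j I)"
proof (induction j)
  case (Suc j)
  have "fs.fin_dim {x\<in>nd V th M j I. contr V (th j) x = 0}"
    by (rule fs.fin_dim_mono[OF Suc]) simp
  thus ?case using fs.fin_dim_image[OF lin_contr Suc] by simp
qed (use assms in simp)

lemma nd_cong: "I \<inter> {..<j} = I' \<inter> {..<j} \<Longrightarrow> nd V th M j I = nd V th M j I'"
proof (induction j)
  case (Suc j)
  have "I \<inter> {..<j} = I' \<inter> {..<j}" "j \<in> I \<longleftrightarrow> j \<in> I'"
    using Suc.prems by (auto simp: set_eq_iff less_Suc_eq)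
  thus ?case using Suc.IH by simp
qed simp

lemma nd_cong_forms: "(\<And>i. i < j \<Longrightarrow> th i = th' i) \<Longrightarrow> nd V th M j I = nd V th' M j I"
proof (induction j)
  case (Suc j)
  have "nd V th M j I = nd V th' M j I" by (rule Suc.IH) (use Suc.prems in simp)
  thus ?case using Suc.prems[of j] by simp
qed simp

lemma card_Int_lessThan_Suc:
  "card (I \<inter> {..<Suc j}) = (if j \<in> I then Suc (card (I \<inter> {..<j})) else card (I \<inter> {..<j}))"
proof -
  have "I \<inter> {..<Suc j} = (if j \<in> I then insert j (I \<inter> {..<j}) else I \<inter> {..<j})"
    by (auto simp: less_Suc_eq)
  thus ?thesis by simp
qed

lemma nd_ch:
  assumes K: "simplicial_complex K" and M: "M \<subseteq> ch (faces k K)"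
  shows "nd V th M j I \<subseteq> ch (faces (k - card (I \<inter> {..<j})) K)"
proof (induction j)
  case (Suc j)
  show ?case
  proof (cases "j \<in> I")
    case True
    show ?thesis
    proof
      fix x assume "x \<in> nd V th M (Suc j) I"
      then obtain y where y: "y \<in> nd V th M j I" "x = contr V (th j) y" using True by auto
      have "contr V (th j) y \<in> ch (faces (k - card (I \<inter> {..<j}) - 1) K)"
        by (rule contr_faces[OF K]) (use y Suc in blast)
      thus "x \<in> ch (faces (k - card (I \<inter> {..<Suc j})) K)"
        using True y(2) by (simp add: card_Int_lessThan_Suc)
    qed
  next
    case False
    thus ?thesis using Suc by (auto simp: card_Int_lessThan_Suc)
  qed
qed (use M in simp)

lemma ch_faces_homog:
  assumes "simplicial_complex K" "x \<in> ch (faces k K)"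
  shows "homog k x"
  unfolding homog_def using chD[OF assms(2)] finite_face[OF assms(1)]
  by (auto simp: faces_def)

text \<open>The degree in \<open>nd_ch\<close> is a truncated difference and stays at 0 after
  \<open>k\<close> contractions. What is added here is that contracting a chain of degree 0 gives
  0.\<close>

lemma nd_zero:
  assumes K: "simplicial_complex K" and M: "M \<subseteq> ch (faces k K)"
  shows "k < card (I \<inter> {..<j}) \<Longrightarrow> nd V th M j I \<subseteq> {0}"
proof (induction j)
  case (Suc j)
  show ?case
  proof (cases "k < card (I \<inter> {..<j})")
    case True
    have "nd V th M j I \<subseteq> {0}" by (rule Suc.IH[OF True])
    thus ?thesis by (auto simp: contr.zero)
  next
    case False
    hence c: "j \<in> I" "k = card (I \<inter> {..<j})"
      using Suc.prems by (auto simp: card_Int_lessThan_Suc split: if_splits)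
    have "contr V (th j) y = 0" if "y \<in> nd V th M j I" for y
    proof (rule contr_homog_0[OF ch_faces_homog[OF K]])
      show "y \<in> ch (faces 0 K)" using nd_ch[OF K M, of V th j I] c(2) that by auto
    qed
    thus ?thesis using c(1) by auto
  qed
qed simp

lemma nd_killed: "x \<in> nd V th M j I \<Longrightarrow> i < j \<Longrightarrow> contr V (th i) x = 0"
proof (induction j arbitrary: x)
  case (Suc j)
  show ?case
  proof (cases "j \<in> I")
    case True
    then obtain y where y: "y \<in> nd V th M j I" "x = contr V (th j) y" using Suc.prems(1) by auto
    show ?thesis
    proof (cases "i = j")
      case True thus ?thesis using y(2) by simp
    next
      case False
      hence "contr V (th i) y = 0" using Suc.IH[OF y(1)] Suc.prems(2) by simp
      thus ?thesis unfolding y(2) by (rule contr_contr_eq_0)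
    qed
  next
    case False
    hence "x \<in> nd V th M j I" "contr V (th j) x = 0" using Suc.prems(1) by auto
    thus ?thesis using Suc.IH Suc.prems(2) by (cases "i = j") auto
  qed
qed simp

lemma dim_nd_split:
  assumes "fs.subspace M" "fs.fin_dim M" "I \<subseteq> {..<j}"
  shows "fs.dim (nd V th M j I) =
    fs.dim (nd V th M (Suc j) I) + fs.dim (nd V th M (Suc j) (insert j I))"
proof -
  have "nd V th M j (insert j I) = nd V th M j I" by (rule nd_cong) auto
  moreover have "j \<notin> I" using assms(3) by auto
  ultimately show ?thesis
    using fs.rank_nullity[OF lin_contr[of V "th j"] subspace_nd[OF assms(1), of V th j I]
        fin_dim_nd[OF assms(2), of V th j I]] by simp
qed

text \<open>A branch stops at its kernel step number \<open>r - k + 1\<close>. If that step is the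
  one at \<open>th q\<close>, there were \<open>card I = k + q - r\<close> image steps before it, so
  the leaf has degree \<open>r - q\<close> independently of \<open>k\<close>. The second sum
  collects the branches that have not stopped at depth \<open>j\<close>.\<close>

lemma dim_eq_sum_leaves_aux:
  assumes M: "fs.subspace M" "fs.fin_dim M" and k: "k \<le> r"
  shows "fs.dim M = (\<Sum>q<j. \<Sum>I | I \<subseteq> {..<q} \<and> card I + r = k + q. fs.dim (nd V th M (Suc q) I)) +
    (\<Sum>I | I \<subseteq> {..<j} \<and> k + j \<le> card I + r. fs.dim (nd V th M j I))"
proof (induction j)
  case 0
  have "{I. I \<subseteq> {..<0::nat} \<and> k + 0 \<le> card I + r} = {{}}" using k by auto
  thus ?case by simp
next
  case (Suc j)
  let ?d = "\<lambda>j I. fs.dim (nd V th M j I)"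
  let ?L = "{I. I \<subseteq> {..<j} \<and> card I + r = k + j}"
  let ?S = "{I. I \<subseteq> {..<j} \<and> k + j \<le> card I + r}"
  let ?N = "{I. I \<subseteq> {..<j} \<and> k + Suc j \<le> card I + r}"
  let ?T = "{I. I \<subseteq> {..<Suc j} \<and> k + Suc j \<le> card I + r}"
  have fin: "finite ?S" "finite ?L" "finite ?N"
    by (rule finite_subset[of _ "Pow {..<j}"]; auto)+
  have S: "?S = ?L \<union> ?N" "?L \<inter> ?N = {}" by auto
  have finI: "finite I" "j \<notin> I" if "I \<subseteq> {..<j}" for I
    using that finite_subset by auto
  have T: "?T = ?N \<union> insert j ` ?S"
  proof (rule Set.set_eqI)
    fix I
    show "I \<in> ?T \<longleftrightarrow> I \<in> ?N \<union> insert j ` ?S"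
    proof (cases "j \<in> I")
      case True
      have "I \<notin> ?N" using True by auto
      moreover have "I \<in> insert j ` ?S" if "I \<in> ?T"
      proof (rule image_eqI[of _ _ "I - {j}"])
        have "finite I" using that finite_subset[of I "{..<Suc j}"] by auto
        hence "card I = Suc (card (I - {j}))" using card_Suc_Diff1[of I j] True by simp
        thus "I - {j} \<in> ?S" using that True by (auto simp: less_Suc_eq)
      qed (use True in auto)
      moreover have "I \<in> ?T" if "I \<in> insert j ` ?S"
        using that finI by (auto simp: less_Suc_eq)
      ultimately show ?thesis by blast
    next
      case False
      hence "I \<notin> insert j ` ?S" by auto
      moreover have "I \<subseteq> {..<Suc j} \<longleftrightarrow> I \<subseteq> {..<j}" using False by (auto simp: less_Suc_eq)
      ultimately show ?thesis by simp
    qed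
  qed
  have dis: "?N \<inter> insert j ` ?S = {}" by auto
  have inj: "inj_on (insert j) ?S"
    using finI(2) by (intro inj_onI) (auto simp: insert_eq_iff)
  have "(\<Sum>I\<in>?S. ?d j I) = (\<Sum>I\<in>?S. ?d (Suc j) I + ?d (Suc j) (insert j I))"
    by (rule sum.cong[OF refl], rule dim_nd_split[OF M]) simp
  also have "\<dots> = (\<Sum>I\<in>?S. ?d (Suc j) I) + (\<Sum>I\<in>?S. ?d (Suc j) (insert j I))"
    by (rule sum.distrib)
  also have "(\<Sum>I\<in>?S. ?d (Suc j) I) = (\<Sum>I\<in>?L. ?d (Suc j) I) + (\<Sum>I\<in>?N. ?d (Suc j) I)"
    unfolding S(1) by (rule sum.union_disjoint[OF fin(2,3) S(2)])
  also have "(\<Sum>I\<in>?S. ?d (Suc j) (insert j I)) = (\<Sum>I\<in>insert j ` ?S. ?d (Suc j) I)"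
    by (subst sum.reindex[OF inj]) simp
  also have "(\<Sum>I\<in>?L. ?d (Suc j) I) + (\<Sum>I\<in>?N. ?d (Suc j) I) + (\<Sum>I\<in>insert j ` ?S. ?d (Suc j) I) =
      (\<Sum>I\<in>?L. ?d (Suc j) I) + (\<Sum>I\<in>?T. ?d (Suc j) I)"
    unfolding T by (subst sum.union_disjoint[OF fin(3) _ dis]) (use fin(1) in simp_all)
  finally show ?case using Suc.IH by simp
qed

text \<open>A branch that survives \<open>Suc r\<close> steps has taken more than \<open>k\<close>
  images and is zero by \<open>nd_zero\<close>.\<close>

lemma dim_eq_sum_leaves:
  assumes K: "simplicial_complex K" and M: "fs.subspace M" "M \<subseteq> ch (faces k K)" and k: "k \<le> r"
  shows "fs.dim M = (\<Sum>q\<le>r. \<Sum>I | I \<subseteq> {..<q} \<and> card I + r = k + q. fs.dim (nd V th M (Suc q) I))"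
proof -
  have fd: "fs.fin_dim M" by (rule fs.fin_dim_mono[OF fin_dim_ch[OF finite_faces[OF K]] M(2)])
  have "(\<Sum>I | I \<subseteq> {..<Suc r} \<and> k + Suc r \<le> card I + r. fs.dim (nd V th M (Suc r) I)) = 0"
  proof (rule sum.neutral, rule ballI)
    fix I assume I: "I \<in> {I. I \<subseteq> {..<Suc r} \<and> k + Suc r \<le> card I + r}"
    hence "I \<inter> {..<Suc r} = I" by auto
    hence "k < card (I \<inter> {..<Suc r})" using I by simp
    thus "fs.dim (nd V th M (Suc r) I) = 0" by (rule fs.dim_zero_space[OF nd_zero[OF K M(2)]])
  qed
  thus ?thesis using dim_eq_sum_leaves_aux[OF M(1) fd k, where j = "Suc r" and V = V and th = th]
    by (simp only: lessThan_Suc_atMost)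
qed

text \<open>Contract the vanishing product of the parent chains and expand by the Leibniz rule. As
  \<open>I\<close> and \<open>J\<close> are disjoint, at most one of the two branches goes to an
  image at each step, and the other chain is killed by the form, so only the wanted term
  survives.\<close>

lemma nd_wedge:
  assumes K: "simplicial_complex K" and M: "M \<subseteq> ch (faces k K)"
    and MN: "\<And>m n. m \<in> M \<Longrightarrow> n \<in> N \<Longrightarrow> wedge m n = 0" and IJ: "I \<inter> J = {}"
  shows "m \<in> nd V th M j I \<Longrightarrow> n \<in> nd V th N j J \<Longrightarrow> wedge m n = 0"
proof (induction j arbitrary: m n)
  case 0
  thus ?case using MN by simp
next
  case (Suc j)
  have rule: "wedge (contr V (th j) m') n' + smul ((-1) ^ (k - card (I \<inter> {..<j}))) (wedge m' (contr V (th j) n')) = 0"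
    if "m' \<in> nd V th M j I" "n' \<in> nd V th N j J" for m' n'
  proof -
    have h: "homog (k - card (I \<inter> {..<j})) m'"
      using nd_ch[OF K M, of V th j I] that(1) ch_faces_homog[OF K] by blast
    show ?thesis using contr_wedge[OF h, of V "th j" n'] Suc.IH[OF that] by (simp only: contr.zero)
  qed
  consider "j \<in> I" "j \<notin> J" | "j \<notin> I" "j \<in> J" | "j \<notin> I" "j \<notin> J" using IJ by blast
  thus ?case
  proof cases
    case 1
    then obtain m' where m': "m' \<in> nd V th M j I" "m = contr V (th j) m'" using Suc.prems by auto
    have n: "n \<in> nd V th N j J" "contr V (th j) n = 0" using Suc.prems 1 by auto
    have w: "wedge m' 0 = 0" by (simp add: wedge_def fun_eq_iff zero_fun_apply)
    show ?thesis using rule[OF m'(1) n(1)] unfolding n(2) w m'(2)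
      by (simp only: fs.scale_zero_right add_0_right)
  next
    case 2
    then obtain n' where n': "n' \<in> nd V th N j J" "n = contr V (th j) n'" using Suc.prems by auto
    have m: "m \<in> nd V th M j I" "contr V (th j) m = 0" using Suc.prems 2 by auto
    have w: "wedge 0 n' = 0" by (simp add: wedge_def fun_eq_iff zero_fun_apply)
    have "smul ((-1) ^ (k - card (I \<inter> {..<j}))) (wedge m n) = 0"
      using rule[OF m(1) n'(1)] unfolding m(2) w n'(2) by (simp only: add_0_left)
    thus ?thesis by (simp only: fs.scale_eq_0_iff power_eq_0_iff) simp
  next
    case 3
    thus ?thesis using Suc by simp
  qed
qed

lemma contr_neg_swap: "contr V \<eta> (contr V \<theta> y) = contr V \<theta> (contr V \<eta> (- y))"
  using contr_anticomm[of V \<eta> \<theta> y] by (simp only: contr.neg)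

text \<open>A further contraction anticommutes with those of the tree, so it maps kernels to kernels
  and images to images; only the start at level \<open>i\<close> has to be checked. The sign is
  absorbed by passing to \<open>- y\<close>.\<close>

lemma nd_transfer_from:
  assumes base: "\<And>x. x \<in> nd V th M i I \<Longrightarrow> contr V \<eta> x \<in> nd V th N i J"
    and IJ: "\<And>l. i \<le> l \<Longrightarrow> l \<in> I \<longleftrightarrow> l \<in> J" and "i \<le> j" and M: "fs.subspace M"
  shows "x \<in> nd V th M j I \<Longrightarrow> contr V \<eta> x \<in> nd V th N j J"
  using \<open>i \<le> j\<close>
proof (induction j arbitrary: x rule: dec_induct)
  case base
  thus ?case using assms(1) by simp
next
  case (step l)
  show ?case
  proof (cases "l \<in> I")
    case True
    then obtain y where y: "y \<in> nd V th M l I" "x = contr V (th l) y" using step.prems by auto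
    have "- y \<in> nd V th M l I" by (rule fs.subspace_neg[OF subspace_nd[OF M] y(1)])
    hence "contr V \<eta> (- y) \<in> nd V th N l J" by (rule step.IH)
    hence "contr V (th l) (contr V \<eta> (- y)) \<in> contr V (th l) ` nd V th N l J" by (rule imageI)
    moreover have "l \<in> J" using True IJ step.hyps by simp
    ultimately show ?thesis using y(2) contr_neg_swap[of V \<eta> "th l" y] by simp
  next
    case False
    hence x: "x \<in> nd V th M l I" "contr V (th l) x = 0" using step.prems by auto
    have "l \<notin> J" using False IJ step.hyps by simp
    moreover have "contr V (th l) (contr V \<eta> x) = 0" by (rule contr_contr_eq_0[OF x(2)])
    ultimately show ?thesis using step.IH[OF x(1)] by simp
  qed
qed

section \<open>Absorbing and generic linear forms\<close>

definition absorbing :: "'a::linorder set \<Rightarrow> ('a \<Rightarrow> 'k::field) \<Rightarrow> ('a set \<Rightarrow> 'k) set \<Rightarrow> bool" where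
  "absorbing V t M \<longleftrightarrow> (\<forall>\<eta>. \<forall>x\<in>M. contr V t x = 0 \<longrightarrow> contr V \<eta> x \<in> contr V t ` M)"

text \<open>The algebraic counterpart of shifting: contraction with an arbitrary form adds the index
  \<open>i\<close> to the node, as removing an arbitrary vertex of a face makes room for a shifted
  one.\<close>

lemma nd_absorb:
  assumes "absorbing V (th i) (nd V th M i I)" "i < j" "i \<notin> I" and M: "fs.subspace M"
    and x: "x \<in> nd V th M j I"
  shows "contr V \<eta> x \<in> nd V th M j (insert i I)"
proof (rule nd_transfer_from[OF _ _ _ M x, of "Suc i"])
  have e: "nd V th M i (insert i I) = nd V th M i I" by (rule nd_cong) auto
  show "contr V \<eta> x \<in> nd V th M (Suc i) (insert i I)" if "x \<in> nd V th M (Suc i) I" for x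
    using that assms(1,3) e by (simp add: absorbing_def)
qed (use assms(2) in auto)

text \<open>A linewise substitute for a nonempty Zariski open set: on each line through a good point
  all but finitely many points are good. Over an infinite field this is closed under finite
  conjunctions.\<close>

definition generic :: "(('a \<Rightarrow> 'k::field) \<Rightarrow> bool) \<Rightarrow> bool" where
  "generic P \<longleftrightarrow> (\<exists>\<theta>. P \<theta>) \<and> (\<forall>\<theta> \<eta>. P \<theta> \<longrightarrow> finite {t. \<not> P (\<lambda>v. \<theta> v + t * \<eta> v)})"

lemma generic_conj:
  fixes P Q :: "('a \<Rightarrow> 'k::field) \<Rightarrow> bool"
  assumes inf: "infinite (UNIV :: 'k set)" and P: "generic P" and Q: "generic Q"
  shows "generic (\<lambda>\<theta>. P \<theta> \<and> Q \<theta>)"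
  unfolding generic_def
proof (intro conjI allI impI)
  obtain \<theta> \<eta> where t: "P \<theta>" "Q \<eta>" using P Q by (auto simp: generic_def)
  \<comment> \<open>The line from a point of \<open>P\<close> at \<open>t = 0\<close> to a point of
    \<open>Q\<close> at \<open>t = 1\<close>; seen from the latter its parameter is
    \<open>1 - t\<close>.\<close>
  let ?l = "\<lambda>t v. \<theta> v + t * (\<eta> v - \<theta> v)"
  have p: "finite {t. \<not> P (?l t)}" using P t(1) unfolding generic_def by (elim conjE allE impE)
  have "finite {s. \<not> Q (\<lambda>v. \<eta> v + s * (\<theta> v - \<eta> v))}" using Q t(2) unfolding generic_def by (elim conjE allE impE)
  hence "finite ((\<lambda>s. 1 - s) ` {s. \<not> Q (\<lambda>v. \<eta> v + s * (\<theta> v - \<eta> v))})" by (rule finite_imageI)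
  moreover have "{t. \<not> Q (?l t)} \<subseteq> (\<lambda>s. 1 - s) ` {s. \<not> Q (\<lambda>v. \<eta> v + s * (\<theta> v - \<eta> v))}"
  proof
    fix t assume "t \<in> {t. \<not> Q (?l t)}"
    moreover have "(\<lambda>v. \<eta> v + (1 - t) * (\<theta> v - \<eta> v)) = ?l t" by (simp add: fun_eq_iff algebra_simps)
    ultimately show "t \<in> (\<lambda>s. 1 - s) ` {s. \<not> Q (\<lambda>v. \<eta> v + s * (\<theta> v - \<eta> v))}"
      by (intro image_eqI[of _ _ "1 - t"]) auto
  qed
  ultimately have q: "finite {t. \<not> Q (?l t)}" by (rule finite_subset[rotated])
  have "finite ({t. \<not> P (?l t)} \<union> {t. \<not> Q (?l t)})" using p q by simp
  from ex_new_if_finite[OF inf this] show "\<exists>\<theta>. P \<theta> \<and> Q \<theta>" by auto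
next
  fix \<theta> \<eta> assume "P \<theta> \<and> Q \<theta>"
  hence "finite {t. \<not> P (\<lambda>v. \<theta> v + t * \<eta> v)}" "finite {t. \<not> Q (\<lambda>v. \<theta> v + t * \<eta> v)}"
    using P Q by (simp_all add: generic_def)
  moreover have "{t. \<not> (P (\<lambda>v. \<theta> v + t * \<eta> v) \<and> Q (\<lambda>v. \<theta> v + t * \<eta> v))} =
      {t. \<not> P (\<lambda>v. \<theta> v + t * \<eta> v)} \<union> {t. \<not> Q (\<lambda>v. \<theta> v + t * \<eta> v)}" by auto
  ultimately show "finite {t. \<not> (P (\<lambda>v. \<theta> v + t * \<eta> v) \<and> Q (\<lambda>v. \<theta> v + t * \<eta> v))}" by simp
qed

lemma generic_ball:
  fixes P :: "'s \<Rightarrow> ('a \<Rightarrow> 'k::field) \<Rightarrow> bool"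
  assumes inf: "infinite (UNIV :: 'k set)" and "finite S" "\<And>s. s \<in> S \<Longrightarrow> generic (P s)"
  shows "generic (\<lambda>\<theta>. \<forall>s\<in>S. P s \<theta>)"
  using assms(2,3)
proof (induction S rule: finite_induct)
  case empty
  thus ?case by (simp add: generic_def)
next
  case (insert s S)
  have "generic (\<lambda>\<theta>. P s \<theta> \<and> (\<forall>s\<in>S. P s \<theta>))"
    by (rule generic_conj[OF inf]) (use insert in auto)
  thus ?case by simp
qed

definition max_rank :: "'a::linorder set \<Rightarrow> ('a set \<Rightarrow> 'k::field) set \<Rightarrow> ('a \<Rightarrow> 'k) \<Rightarrow> bool" where
  "max_rank V M \<theta> \<longleftrightarrow> (\<forall>\<eta>. fs.dim (contr V \<eta> ` M) \<le> fs.dim (contr V \<theta> ` M))"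

lemma generic_max_rank:
  assumes "fs.subspace M" "fs.fin_dim M"
  shows "generic (max_rank V M)"
  unfolding generic_def
proof (intro conjI allI impI)
  have b: "fs.dim (contr V \<eta> ` M) \<le> fs.dim M" for \<eta>
    using fs.rank_nullity[OF lin_contr[of V \<eta>] assms] by simp
  have "\<exists>\<theta>. \<forall>\<eta>. fs.dim (contr V \<eta> ` M) \<le> fs.dim (contr V \<theta> ` M)"
    using ex_has_greatest_nat[of "\<lambda>_. True" undefined "\<lambda>\<eta>. fs.dim (contr V \<eta> ` M)" "Suc (fs.dim M)"] b
    by (auto simp: less_Suc_eq_le)
  thus "\<exists>\<theta>. max_rank V M \<theta>" by (simp add: max_rank_def)
next
  fix \<theta> \<eta> assume m: "max_rank V M \<theta>"
  let ?l = "\<lambda>t v. \<theta> v + t * \<eta> v"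
  have f: "finite {t. fs.dim ((\<lambda>x. contr V \<theta> x + smul t (contr V \<eta> x)) ` M) < fs.dim (contr V \<theta> ` M)}"
    by (rule fs.finite_rank_drops[OF lin_contr lin_contr assms(2)])
  have "{t. \<not> max_rank V M (?l t)} \<subseteq>
      {t. fs.dim ((\<lambda>x. contr V \<theta> x + smul t (contr V \<eta> x)) ` M) < fs.dim (contr V \<theta> ` M)}"
  proof (rule subsetI, simp only: mem_Collect_eq, rule ccontr)
    fix t assume n: "\<not> max_rank V M (?l t)"
      "\<not> fs.dim ((\<lambda>x. contr V \<theta> x + smul t (contr V \<eta> x)) ` M) < fs.dim (contr V \<theta> ` M)"
    have "contr V (?l t) = (\<lambda>x. contr V \<theta> x + smul t (contr V \<eta> x))"
      by (rule ext) (rule contr_add_form)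
    hence "fs.dim (contr V \<theta> ` M) \<le> fs.dim (contr V (?l t) ` M)" using n(2) by simp
    hence "max_rank V M (?l t)" using m order_trans unfolding max_rank_def by blast
    thus False using n(1) by simp
  qed
  thus "finite {t. \<not> max_rank V M (?l t)}" using f by (rule finite_subset)
qed

lemma max_rank_absorbing:
  fixes M :: "('a::linorder set \<Rightarrow> 'k::field) set"
  assumes inf: "infinite (UNIV :: 'k set)" and M: "fs.subspace M" "fs.fin_dim M" and "max_rank V M \<theta>"
  shows "absorbing V \<theta> M"
  unfolding absorbing_def
proof (intro allI ballI impI)
  fix \<eta> x assume x: "x \<in> M" "contr V \<theta> x = 0"
  show "contr V \<eta> x \<in> contr V \<theta> ` M"
  proof (rule fs.kernel_maps_into_image_if_max_rank[OF lin_contr lin_contr M inf _ x])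
    fix t
    have "contr V (\<lambda>v. \<theta> v + t * \<eta> v) = (\<lambda>x. contr V \<theta> x + smul t (contr V \<eta> x))"
      by (rule HOL.ext) (rule contr_add_form)
    thus "fs.dim ((\<lambda>x. contr V \<theta> x + smul t (contr V \<eta> x)) ` M) \<le> fs.dim (contr V \<theta> ` M)"
      using assms(4) unfolding max_rank_def by metis
  qed
qed

definition off_span :: "'a set \<Rightarrow> nat \<Rightarrow> (nat \<Rightarrow> 'a \<Rightarrow> 'k::field) \<Rightarrow> ('a \<Rightarrow> 'k) \<Rightarrow> bool" where
  "off_span W j th \<theta> \<longleftrightarrow> (\<forall>c. \<exists>v\<in>W. \<theta> v \<noteq> (\<Sum>i<j. c i * th i v))"

text \<open>Restricted to \<open>Suc j\<close> points, \<open>j\<close> forms cannot span all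
  functions. Two bad parameters on a line would put \<open>\<theta>\<close> itself into the span, so
  each line through a good point has at most one.\<close>

lemma generic_off_span:
  fixes th :: "nat \<Rightarrow> 'a \<Rightarrow> 'k::field"
  assumes W: "finite W" "card W = Suc j"
  shows "generic (off_span W j th)"
  unfolding generic_def
proof (intro conjI allI impI)
  show "\<exists>\<theta>. off_span W j th \<theta>"
  proof (rule ccontr)
    assume n: "\<nexists>\<theta>. off_span W j th \<theta>"
    let ?e = "\<lambda>w v. if v = w then 1 else (0::'k)"
    let ?g = "\<lambda>i v. if v \<in> W then th i v else 0"
    have sp: "?e w \<in> fs.span (?g ` {..<j})" if w: "w \<in> W" for w
    proof -
      have "\<not> off_span W j th (?e w)" using n by blast
      then obtain c where c: "\<And>v. v \<in> W \<Longrightarrow> ?e w v = (\<Sum>i<j. c i * th i v)" by (auto simp: off_span_def)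
      have "?e w = (\<Sum>i<j. smul (c i) (?g i))"
      proof
        fix v show "?e w v = (\<Sum>i<j. smul (c i) (?g i)) v"
          unfolding fun_sum_apply using c[of v] w by (cases "v \<in> W") (auto simp: smul_apply)
      qed
      also have "\<dots> \<in> fs.span (?g ` {..<j})" by (intro fs.span_sum fs.span_scale fs.span_base) auto
      finally show ?thesis .
    qed
    have "fs.indep_family W ?e" by (rule indep_indicators[OF W(1)])
    moreover have "fs.fin_dim (?g ` {..<j})"
      unfolding fs.fin_dim_def using fs.span_superset by (intro exI[of _ "?g ` {..<j}"]) simp
    ultimately have "card W \<le> fs.dim (?g ` {..<j})"
      using W(1) sp by (intro fs.indep_family_card_le[of _ _ ?e]) auto
    also have "\<dots> \<le> card (?g ` {..<j})" by (rule fs.dim_le_card[OF fs.span_superset]) simp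
    also have "\<dots> \<le> j" using card_image_le[of "{..<j}" ?g] by simp
    finally show False using W by simp
  qed
next
  fix \<theta> \<eta> assume o: "off_span W j th \<theta>"
  let ?B = "{t. \<not> off_span W j th (\<lambda>v. \<theta> v + t * \<eta> v)}"
  have "t = s" if B: "t \<in> ?B" "s \<in> ?B" for t s
  proof (rule ccontr)
    assume ts: "t \<noteq> s"
    obtain c where c: "\<And>v. v \<in> W \<Longrightarrow> \<theta> v + t * \<eta> v = (\<Sum>i<j. c i * th i v)"
      using B(1) by (auto simp: off_span_def)
    obtain d where d: "\<And>v. v \<in> W \<Longrightarrow> \<theta> v + s * \<eta> v = (\<Sum>i<j. d i * th i v)"
      using B(2) by (auto simp: off_span_def)
    let ?c = "\<lambda>i. (t * d i - s * c i) / (t - s)"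
    have "\<theta> v = (\<Sum>i<j. ?c i * th i v)" if "v \<in> W" for v
    proof -
      have "(\<Sum>i<j. ?c i * th i v) = (t * (\<Sum>i<j. d i * th i v) - s * (\<Sum>i<j. c i * th i v)) / (t - s)"
        by (simp add: sum_distrib_left sum_subtractf[symmetric] sum_divide_distrib algebra_simps)
      also have "\<dots> = (t - s) * \<theta> v / (t - s)"
        unfolding c[OF that, symmetric] d[OF that, symmetric] by (simp add: algebra_simps)
      finally show ?thesis using ts by simp
    qed
    moreover obtain v where "v \<in> W" "\<theta> v \<noteq> (\<Sum>i<j. ?c i * th i v)"
      using o[unfolded off_span_def, THEN spec, of ?c] by (elim bexE)
    ultimately show False by simp
  qed
  hence "?B \<subseteq> {t}" if "t \<in> ?B" for t using that by blast
  thus "finite ?B" by (cases "?B = {}") (auto intro: finite_subset[of _ "{_}"])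
qed

lemma off_span_cong:
  "(\<And>i. i < j \<Longrightarrow> th i = th' i) \<Longrightarrow> off_span W j th \<theta> = off_span W j th' \<theta>"
  unfolding off_span_def by (intro all_cong1 bex_cong refl arg_cong[of _ _ Not] arg_cong2[of _ _ _ _ "(=)"] sum.cong) auto

text \<open>The conditions on \<open>th j\<close> mention only earlier forms and are finitely many,
  so the forms can be chosen one after the other; \<open>absorbing\<close> is obtained from
  maximality of rank on every node.\<close>

theorem generic_forms_exist:
  fixes Ms :: "('a::linorder set \<Rightarrow> 'k::field) set set"
  assumes inf: "infinite (UNIV :: 'k set)" and V: "finite V" and Ms: "finite Ms"
    "\<And>M. M \<in> Ms \<Longrightarrow> fs.subspace M" "\<And>M. M \<in> Ms \<Longrightarrow> fs.fin_dim M"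
  shows "\<exists>th. \<forall>j. (\<forall>M\<in>Ms. \<forall>I\<in>Pow {..<j}. absorbing V (th j) (nd V th M j I)) \<and>
    (\<forall>W\<in>{W. W \<subseteq> V \<and> card W = Suc j}. off_span W j th (th j))"
proof -
  let ?P = "\<lambda>th j \<theta>. (\<forall>s\<in>Ms \<times> Pow {..<j}. max_rank V (nd V th (fst s) j (snd s)) \<theta>) \<and>
    (\<forall>W\<in>{W. W \<subseteq> V \<and> card W = Suc j}. off_span W j th \<theta>)"
  have "\<exists>th. \<forall>j. ?P th j (th j)"
  proof (rule dependent_wellorder_choice)
    fix r th th' and j :: nat assume "\<And>i. i < j \<Longrightarrow> th i = (th' i :: 'a \<Rightarrow> 'k)"
    hence "nd V th M j I = nd V th' M j I" "off_span W j th r = off_span W j th' r" for M I W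
      by (intro nd_cong_forms off_span_cong; blast)+
    thus "?P th j r = ?P th' j r" by simp
  next
    fix j :: nat and th :: "nat \<Rightarrow> 'a \<Rightarrow> 'k"
    have "generic (\<lambda>\<theta>. \<forall>s\<in>Ms \<times> Pow {..<j}. max_rank V (nd V th (fst s) j (snd s)) \<theta>)"
      by (rule generic_ball[OF inf]) (use Ms in \<open>auto intro!: generic_max_rank subspace_nd fin_dim_nd\<close>)
    moreover have "generic (\<lambda>\<theta>. \<forall>W\<in>{W. W \<subseteq> V \<and> card W = Suc j}. off_span W j th \<theta>)"
      by (rule generic_ball[OF inf]) (use V finite_subset in \<open>auto intro!: generic_off_span\<close>)
    ultimately have "generic (?P th j)" by (rule generic_conj[OF inf])
    thus "\<exists>\<theta>. ?P th j \<theta>" by (simp only: generic_def)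
  qed
  then obtain th where th: "\<And>j. ?P th j (th j)" by blast
  have "absorbing V (th j) (nd V th M j I)" if "M \<in> Ms" "I \<in> Pow {..<j}" for j M I
  proof (rule max_rank_absorbing[OF inf subspace_nd[OF Ms(2)[OF that(1)]] fin_dim_nd[OF Ms(3)[OF that(1)]]])
    have "(M, I) \<in> Ms \<times> Pow {..<j}" using that by simp
    thus "max_rank V (nd V th M j I) (th j)" using th[of j] by fastforce
  qed
  thus ?thesis using th by (intro exI[of _ th]) blast
qed

text \<open>More than \<open>j\<close> coincidences would contain a set \<open>W\<close> of size
  \<open>Suc j\<close> on which \<open>th j\<close> is a combination of its predecessors. The list
  is reversed because \<open>flag\<close> has the latest form at its head.\<close>

lemma flag_if_off_span:
  assumes V: "finite V" and th: "\<And>j W. W \<subseteq> V \<Longrightarrow> card W = Suc j \<Longrightarrow> off_span W j th (th j)"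
  shows "flag V 0 (rev (map th [0..<j]))"
proof (induction j)
  case (Suc j)
  have "card {v\<in>V. th j v = (\<Sum>i<j. c i * (rev (map th [0..<j]) ! i) v)} \<le> j" for c
  proof (rule ccontr)
    let ?Z = "{v\<in>V. th j v = (\<Sum>i<j. c i * (rev (map th [0..<j]) ! i) v)}"
    assume "\<not> card ?Z \<le> j"
    hence "Suc j \<le> card ?Z" by simp
    then obtain W where W: "W \<subseteq> ?Z" "card W = Suc j" by (rule obtain_subset_with_card_n)
    have o: "off_span W j th (th j)" by (rule th) (use W in auto)
    then obtain v where v: "v \<in> W" "th j v \<noteq> (\<Sum>i<j. c (j - Suc i) * th i v)"
      using o[unfolded off_span_def, THEN spec, of "\<lambda>i. c (j - Suc i)"] by (elim bexE)
    have "(\<Sum>i<j. c i * (rev (map th [0..<j]) ! i) v) = (\<Sum>i<j. c i * th (j - Suc i) v)"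
      by (rule sum.cong) (simp_all add: rev_nth)
    also have "\<dots> = (\<Sum>i<j. c (j - Suc i) * th i v)"
      by (subst sum.nat_diff_reindex[symmetric]) (rule sum.cong, auto simp: Suc_diff_Suc)
    finally show False using v W(1) by auto
  qed
  thus ?case using Suc by simp
qed simp

text \<open>An iterated contraction by all forms fits into every branch. At an index outside
  \<open>I\<close> the contraction is moved inside onto \<open>u\<close>, which lowers the starting
  degree by one, while its square being zero gives membership in the kernel.\<close>

lemma contrs_in_nd:
  assumes K: "simplicial_complex K"
  shows "u \<in> ch (faces m K) \<Longrightarrow>
    contrs V (rev (map th [0..<j])) u \<in> nd V th (ch (faces (m - card ({..<j} - I)) K)) j I"
proof (induction j arbitrary: m u)
  case (Suc j)
  let ?L = "rev (map th [0..<j])"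
  show ?case
  proof (cases "j \<in> I")
    case True
    have "{..<Suc j} - I = {..<j} - I" using True by (auto simp: less_Suc_eq)
    thus ?thesis using True Suc.IH[OF Suc.prems] by simp
  next
    case False
    have "{..<Suc j} - I = insert j ({..<j} - I)" using False by (auto simp: less_Suc_eq)
    hence c: "m - card ({..<Suc j} - I) = m - 1 - card ({..<j} - I)" by simp
    have "contr V (th j) (smul ((-1) ^ length ?L) u) \<in> ch (faces (m - 1) K)"
      by (rule contr_faces[OF K fs.subspace_scale[OF subspace_ch Suc.prems]])
    hence "contr V (th j) (contrs V ?L u) \<in> nd V th (ch (faces (m - 1 - card ({..<j} - I)) K)) j I"
      unfolding contr_contrs_commute by (rule Suc.IH)
    thus ?thesis using False by (simp add: c)
  qed
qed simp

text \<open>Degree \<open>r - q\<close>, \<open>q\<close> forms and defect 0 exhaust the depth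
  \<open>r\<close> exactly, so \<open>killed_chain_is_contraction\<close> applies: such a chain is a
  contraction of an \<open>r\<close>-chain by \<open>th 0\<close>, ..., \<open>th (q-1)\<close> and
  hence lies in every node at depth \<open>q\<close>. Being killed by \<open>th q\<close> supplies
  the last kernel step.\<close>

lemma killed_subset_leaf:
  fixes th :: "nat \<Rightarrow> 'a::linorder \<Rightarrow> 'k::alg_closed_field"
  assumes V: "finite V" "V = \<Union>K" and K: "deep V (\<lambda>_. 1 :: 'k) r K"
    and th: "\<And>j W. W \<subseteq> V \<Longrightarrow> card W = Suc j \<Longrightarrow> off_span W j th (th j)"
    and q: "q \<le> r" and I: "I \<subseteq> {..<q}"
  shows "ch (faces (r - q) K) \<inter> killed V (th ` {..q}) \<subseteq> nd V th (ch (faces (card I + r - q) K)) (Suc q) I"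
proof
  fix x assume x: "x \<in> ch (faces (r - q) K) \<inter> killed V (th ` {..q})"
  have K': "simplicial_complex K" using K by (simp add: deep_def)
  let ?L = "rev (map th [0..<q])"
  have "flag (\<Union>K) 0 ?L" using flag_if_off_span[OF V(1) th, of q] V(2) by simp
  moreover have "x \<in> killed V (set ?L)" using x by (auto simp: killed_def)
  ultimately have "\<exists>u\<in>ch (faces (r - q + length ?L) K). contrs V ?L u = x"
    by (intro killed_chain_is_contraction[OF V(1) K, where b = 0]) (use x q in auto)
  then obtain u where u: "u \<in> ch (faces r K)" "contrs V ?L u = x" using q by auto
  have "card ({..<q} - I) = q - card I" using I by (simp add: card_Diff_subset finite_subset)
  moreover have "card I \<le> q" using card_mono[OF _ I] by simp
  ultimately have "r - card ({..<q} - I) = card I + r - q" using q by simp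
  hence "x \<in> nd V th (ch (faces (card I + r - q) K)) q I"
    using contrs_in_nd[OF K' u(1), of V th q I] u(2) by simp
  moreover have "q \<notin> I" using I by auto
  moreover have "contr V (th q) x = 0" using x by (auto simp: killed_def)
  ultimately show "x \<in> nd V th (ch (faces (card I + r - q) K)) (Suc q) I" by simp
qed

section \<open>Weights on Kneser graphs\<close>

definition ksubsets :: "nat \<Rightarrow> 'g set \<Rightarrow> 'g set set" where
  "ksubsets q G = {P. P \<subseteq> G \<and> card P = q}"

lemma finite_ksubsets: "finite G \<Longrightarrow> finite (ksubsets q G)"
  unfolding ksubsets_def by (rule finite_subset[of _ "Pow G"]) auto

lemma ksubsetsD:
  assumes "finite G" "P \<in> ksubsets q G"
  shows "P \<subseteq> G" "card P = q" "finite P"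
  using assms finite_subset[of P G] by (auto simp: ksubsets_def)

lemma card_disjoint_subsets:
  assumes "finite G" "P \<in> ksubsets q G"
  shows "card {Q\<in>ksubsets q G. P \<inter> Q = {}} = (card G - q) choose q"
proof -
  have P: "P \<subseteq> G" "card P = q" "finite P"
    using assms finite_subset by (auto simp: ksubsets_def)
  have "{Q\<in>ksubsets q G. P \<inter> Q = {}} = {Q. Q \<subseteq> G - P \<and> card Q = q}"
    by (auto simp: ksubsets_def)
  thus ?thesis using n_subsets[of "G - P" q] assms(1) P by (simp add: card_Diff_subset)
qed

context
  fixes G :: "'g set" and q :: nat
  assumes G: "finite G" "2 * q + 1 \<le> card G"
begin

lemma swap_closed_family_total:
  assumes A: "\<A> \<subseteq> ksubsets q G"
    and swap: "\<And>P x y. P \<in> \<A> \<Longrightarrow> x \<in> P \<Longrightarrow> y \<in> G - P \<Longrightarrow> insert y (P - {x}) \<in> \<A>"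
    and P0: "P0 \<in> ksubsets q G"
  shows "P \<in> \<A> \<Longrightarrow> P0 \<in> \<A>"
proof (induction "card (P0 - P)" arbitrary: P)
  case 0
  have PF: "P \<in> ksubsets q G" using A 0(2) by blast
  have f: "finite P" "finite P0" "card P = q" "card P0 = q"
    using ksubsetsD[OF G(1) PF] ksubsetsD[OF G(1) P0] by simp_all
  hence "P0 \<subseteq> P" using 0(1) by simp
  hence "P0 = P" using card_subset_eq[OF f(1)] f by simp
  thus ?case using 0 by simp
next
  case (Suc n)
  have PF: "P \<in> ksubsets q G" using A Suc.prems by blast
  have f: "finite P" "finite P0" "card P = q" "card P0 = q" "P0 \<subseteq> G"
    using ksubsetsD[OF G(1) PF] ksubsetsD[OF G(1) P0] by simp_all
  obtain y where y: "y \<in> P0" "y \<notin> P" using Suc(2) by (metis Diff_iff card.empty ex_in_conv nat.simps(3))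
  have "\<not> P \<subseteq> P0"
  proof
    assume "P \<subseteq> P0"
    hence "P = P0" using card_subset_eq[OF f(2)] f by simp
    thus False using y by simp
  qed
  then obtain x where x: "x \<in> P" "x \<notin> P0" by blast
  have "P0 - insert y (P - {x}) = P0 - P - {y}" using x by blast
  hence "n = card (P0 - insert y (P - {x}))" using Suc(2) y f by simp
  thus ?case using Suc(1) swap[OF Suc.prems x(1)] y f by blast
qed

text \<open>The graph is regular, so double counting edges gives the weak inequality. Equality would
  force all neighbours of the neighbourhood back into \<open>\<A>\<close>. Two sets that differ by
  one exchange cover \<open>q + 1\<close> points and have a common neighbour since
  \<open>2 * q + 1 \<le> card G\<close>; hence \<open>\<A>\<close> would be closed under exchanges
  and contain \<open>P0\<close>.\<close>

lemma kneser_neighbourhood_expands: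
  assumes A: "\<A> \<subseteq> ksubsets q G" "\<A> \<noteq> {}"
    and P0: "P0 \<in> ksubsets q G" "P0 \<notin> \<A>"
  shows "card \<A> < card {Q\<in>ksubsets q G. \<exists>P\<in>\<A>. P \<inter> Q = {}}"
proof (rule ccontr)
  let ?F = "ksubsets q G" and ?D = "(card G - q) choose q"
  let ?N = "{Q\<in>?F. \<exists>P\<in>\<A>. P \<inter> Q = {}}"
  assume "\<not> card \<A> < card ?N"
  hence le: "card ?N \<le> card \<A>" by simp
  have fin: "finite ?F" "finite \<A>" "finite ?N"
    using finite_ksubsets[OF G(1)] A(1) finite_subset by auto
  let ?E = "Sigma \<A> (\<lambda>P. {Q\<in>?F. P \<inter> Q = {}})"
  let ?E' = "Sigma ?N (\<lambda>Q. {P\<in>?F. Q \<inter> P = {}})"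
  have cE: "card ?E = card \<A> * ?D"
    using A(1) card_disjoint_subsets[OF G(1)] fin by (subst card_SigmaI) (auto simp: subset_iff)
  have cE': "card ?E' = card ?N * ?D"
    using card_disjoint_subsets[OF G(1)] fin by (subst card_SigmaI) auto
  have inj: "inj_on prod.swap ?E" by simp
  have sub: "prod.swap ` ?E \<subseteq> ?E'"
  proof (rule subsetI, elim imageE)
    fix a e assume e: "a = prod.swap e" "e \<in> ?E"
    obtain P Q where PQ: "e = (P, Q)" by (cases e)
    have "P \<in> \<A>" "Q \<in> ?F" "P \<inter> Q = {}" "P \<in> ?F" using e PQ A(1) by auto
    thus "a \<in> ?E'" using e(1) PQ by (auto simp: Int_commute)
  qed
  have fE': "finite ?E'" using fin by auto
  have "card ?E' \<le> card (prod.swap ` ?E)" using cE cE' le card_image[OF inj] by simp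
  hence eq: "prod.swap ` ?E = ?E'" using card_seteq[OF fE' sub] by simp
  have two: "P' \<in> \<A>" if "P \<in> \<A>" "Q \<in> ?F" "P \<inter> Q = {}" "P' \<in> ?F" "Q \<inter> P' = {}" for P Q P'
  proof -
    have "Q \<in> ?N" using that by blast
    hence "(Q, P') \<in> ?E'" using that(4,5) by simp
    hence "(Q, P') \<in> prod.swap ` ?E" unfolding eq .
    thus ?thesis by auto
  qed
  have swap: "insert y (P - {x}) \<in> \<A>" if "P \<in> \<A>" "x \<in> P" "y \<in> G - P" for P x y
  proof -
    have "P \<in> ?F" using A(1) that(1) by blast
    note P = ksubsetsD[OF G(1) this]
    have "card (G - insert y P) = card G - (q + 1)"
      using P that(3) by (subst card_Diff_subset) auto
    hence "q \<le> card (G - insert y P)" using G(2) by simp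
    then obtain Q where Q: "Q \<subseteq> G - insert y P" "card Q = q" by (rule obtain_subset_with_card_n)
    have "card (insert y (P - {x})) = q"
      using P that(2,3) card_Suc_Diff1[of P x] by simp
    hence "insert y (P - {x}) \<in> ?F" using P that by (auto simp: ksubsets_def)
    moreover have "Q \<in> ?F" using Q by (auto simp: ksubsets_def)
    ultimately show ?thesis using two[OF that(1), of Q "insert y (P - {x})"] Q(1) by auto
  qed
  obtain P where "P \<in> \<A>" using A(2) by blast
  hence "P0 \<in> \<A>" using swap_closed_family_total[OF A(1) swap P0(1)] by simp
  thus False using P0(2) by simp
qed

text \<open>\<open>\<B>\<close> avoids the neighbourhood of \<open>\<A>\<close>, which is strictly
  larger than \<open>\<A>\<close>. If \<open>\<A>\<close> is empty, it is \<open>P0\<close> missing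
  from \<open>\<B>\<close> that saves one.\<close>

lemma cross_intersecting_missing_point:
  assumes A: "\<A> \<subseteq> ksubsets q G" "P0 \<notin> \<A>" and B: "\<B> \<subseteq> ksubsets q G" "P0 \<notin> \<B>"
    and P0: "P0 \<in> ksubsets q G" and cross: "\<And>P Q. P \<in> \<A> \<Longrightarrow> Q \<in> \<B> \<Longrightarrow> P \<inter> Q \<noteq> {}"
  shows "card \<A> + card \<B> \<le> card (ksubsets q G) - 1"
proof (cases "\<A> = {}")
  case True
  have "\<B> \<subseteq> ksubsets q G - {P0}" using B by auto
  hence "card \<B> \<le> card (ksubsets q G - {P0})"
    using finite_ksubsets[OF G(1)] by (intro card_mono) auto
  thus ?thesis using True P0 by simp
next
  case False
  let ?F = "ksubsets q G"
  let ?N = "{Q\<in>?F. \<exists>P\<in>\<A>. P \<inter> Q = {}}"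
  have fin: "finite ?F" by (rule finite_ksubsets[OF G(1)])
  have "\<B> \<subseteq> ?F - ?N" using B(1) cross by blast
  hence "card \<B> \<le> card (?F - ?N)" using fin by (intro card_mono) auto
  also have "\<dots> = card ?F - card ?N" using fin by (subst card_Diff_subset) auto
  finally have "card \<B> \<le> card ?F - card ?N" .
  moreover have "card ?N \<le> card ?F" using fin by (intro card_mono) auto
  moreover have "card \<A> < card ?N" by (rule kneser_neighbourhood_expands[OF A(1) False P0 A(2)])
  ultimately show ?thesis by simp
qed

text \<open>Complementary superlevel sets of \<open>\<alpha>\<close> and \<open>\<beta>\<close> are cross-intersecting.\<close>

lemma kneser_weight_bound:
  fixes \<alpha> \<beta> :: "'g set \<Rightarrow> nat"
  assumes le: "\<And>P Q. P \<in> ksubsets q G \<Longrightarrow> Q \<in> ksubsets q G \<Longrightarrow> P \<inter> Q = {} \<Longrightarrow> \<alpha> P + \<beta> Q \<le> h"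
    and P0: "P0 \<in> ksubsets q G" "\<alpha> P0 = 0" "\<beta> P0 = 0"
  shows "(\<Sum>P\<in>ksubsets q G. \<alpha> P + \<beta> P) \<le> h * (card (ksubsets q G) - 1)"
proof -
  let ?F = "ksubsets q G"
  have fin: "finite ?F" by (rule finite_ksubsets[OF G(1)])
  have ex: "\<exists>Q\<in>?F. P \<inter> Q = {}" if "P \<in> ?F" for P
  proof -
    have "card {Q\<in>?F. P \<inter> Q = {}} \<noteq> 0"
      using card_disjoint_subsets[OF G(1) that] G(2) by simp
    thus ?thesis by (metis (mono_tags, lifting) card.empty empty_Collect_eq)
  qed
  have a: "\<alpha> P \<le> h" if P: "P \<in> ?F" for P
  proof -
    obtain Q where "Q \<in> ?F" "P \<inter> Q = {}" using ex[OF P] by blast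
    thus ?thesis using le[OF P] by fastforce
  qed
  have b: "\<beta> P \<le> h" if P: "P \<in> ?F" for P
  proof -
    obtain Q where "Q \<in> ?F" "Q \<inter> P = {}" using ex[OF P] by blast
    thus ?thesis using le[OF _ P] by fastforce
  qed
  have la: "(\<Sum>P\<in>?F. \<alpha> P) = (\<Sum>t\<in>{1..h}. card {P\<in>?F. t \<le> \<alpha> P})"
  proof -
    have "(\<Sum>P\<in>?F. \<alpha> P) = (\<Sum>P\<in>?F. card {t\<in>{1..h}. t \<le> \<alpha> P})"
    proof (rule sum.cong[OF refl])
      fix P assume "P \<in> ?F"
      hence "{t\<in>{1..h}. t \<le> \<alpha> P} = {1..\<alpha> P}" using a by fastforce
      thus "\<alpha> P = card {t\<in>{1..h}. t \<le> \<alpha> P}" by simp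
    qed
    also have "\<dots> = (\<Sum>t\<in>{1..h}. card {P\<in>?F. t \<le> \<alpha> P})"
      by (rule sum_multicount_gen[symmetric, where R = "\<lambda>t P. t \<le> \<alpha> P"]) (use fin in auto)
    finally show ?thesis .
  qed
  \<comment> \<open>Both sums are counted by levels, but \<open>\<beta>\<close> with the reversed
    threshold \<open>h + 1 - t\<close>: the two thresholds add up to more than \<open>h\<close>, so
    disjoint sets cannot reach both.\<close>
  have lb: "(\<Sum>P\<in>?F. \<beta> P) = (\<Sum>t\<in>{1..h}. card {P\<in>?F. h + 1 - t \<le> \<beta> P})"
  proof -
    have "(\<Sum>P\<in>?F. \<beta> P) = (\<Sum>P\<in>?F. card {t\<in>{1..h}. h + 1 - t \<le> \<beta> P})"
    proof (rule sum.cong[OF refl])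
      fix P assume P: "P \<in> ?F"
      have "{t\<in>{1..h}. h + 1 - t \<le> \<beta> P} = {h + 1 - \<beta> P..h}" using b[OF P] by auto
      thus "\<beta> P = card {t\<in>{1..h}. h + 1 - t \<le> \<beta> P}" using b[OF P] by simp
    qed
    also have "\<dots> = (\<Sum>t\<in>{1..h}. card {P\<in>?F. h + 1 - t \<le> \<beta> P})"
      by (rule sum_multicount_gen[symmetric, where R = "\<lambda>t P. h + 1 - t \<le> \<beta> P"]) (use fin in auto)
    finally show ?thesis .
  qed
  have "(\<Sum>P\<in>?F. \<alpha> P + \<beta> P) = (\<Sum>t\<in>{1..h}. card {P\<in>?F. t \<le> \<alpha> P} + card {P\<in>?F. h + 1 - t \<le> \<beta> P})"
    unfolding sum.distrib la lb ..
  also have "\<dots> \<le> (\<Sum>t\<in>{1..h}. card ?F - 1)"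
  proof (rule sum_mono)
    fix t assume t: "t \<in> {1..h}"
    show "card {P\<in>?F. t \<le> \<alpha> P} + card {P\<in>?F. h + 1 - t \<le> \<beta> P} \<le> card ?F - 1"
    proof (rule cross_intersecting_missing_point[OF _ _ _ _ P0(1)])
      fix P Q assume "P \<in> {P\<in>?F. t \<le> \<alpha> P}" "Q \<in> {P\<in>?F. h + 1 - t \<le> \<beta> P}"
      thus "P \<inter> Q \<noteq> {}" using le[of P Q] t by auto
    qed (use P0 t in auto)
  qed
  finally show ?thesis by simp
qed

end

text \<open>On \<open>2 * q\<close> points the disjoint partner of a \<open>q\<close>-set is its
  complement. The graph is a matching, and a single point of weight zero would yield no
  saving.\<close>

lemma complement_weight_bound:
  fixes \<alpha> \<beta> :: "'g set \<Rightarrow> nat"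
  assumes G: "finite G" "card G = 2 * q"
    and le: "\<And>P Q. P \<in> ksubsets q G \<Longrightarrow> Q \<in> ksubsets q G \<Longrightarrow> P \<inter> Q = {} \<Longrightarrow> \<alpha> P + \<beta> Q \<le> h"
  shows "(\<Sum>P\<in>ksubsets q G. \<alpha> P + \<beta> P) \<le> h * card (ksubsets q G)"
proof -
  let ?F = "ksubsets q G"
  have c: "G - P \<in> ?F" "G - (G - P) = P" if "P \<in> ?F" for P
    using that G finite_subset[of P G] by (auto simp: ksubsets_def card_Diff_subset)
  have "(\<Sum>P\<in>?F. \<beta> P) = (\<Sum>P\<in>?F. \<beta> (G - P))"
    by (rule sum.reindex_bij_witness[of _ "\<lambda>P. G - P" "\<lambda>P. G - P"]) (use c in auto)
  hence "(\<Sum>P\<in>?F. \<alpha> P + \<beta> P) = (\<Sum>P\<in>?F. \<alpha> P + \<beta> (G - P))" by (simp add: sum.distrib)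
  also have "\<dots> \<le> (\<Sum>P\<in>?F. h)" by (rule sum_mono, rule le) (use c in auto)
  finally show ?thesis by (simp add: mult.commute)
qed

section \<open>Cross-intersecting families of chains\<close>

text \<open>The depth is \<open>Suc q\<close> because a leaf ends with the kernel step at
  \<open>th q\<close>; in the use made of it, \<open>P\<close> contains only forms of index below
  \<open>q\<close>.\<close>

definition leaf :: "'a::linorder set \<Rightarrow> (nat \<Rightarrow> 'a \<Rightarrow> 'k::field) \<Rightarrow> ('g set \<Rightarrow> 'a set set) \<Rightarrow>
    nat \<Rightarrow> ('g + nat) set \<Rightarrow> ('a set \<Rightarrow> 'k) set" where
  "leaf V th \<D> q P = nd V th (ch (\<D> (Inl -` P))) (Suc q) (Inr -` P)"

text \<open>The forms \<open>th 0, th 1, \<dots>\<close> play the role of further shifted vertices: a set \<open>P\<close> of \<open>q\<close>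
  elements of \<open>G <+> {..<q}\<close> records which of the vertices in \<open>G\<close> and of the first \<open>q\<close> forms
  have been split off.\<close>

locale graded_forms =
  fixes V :: "'a::linorder set" and th :: "nat \<Rightarrow> 'a \<Rightarrow> 'k::alg_closed_field"
    and K :: "'a set set" and r :: nat and G :: "'g set"
  assumes finV: "finite V" and VK: "V = \<Union>K" and K: "deep V (\<lambda>_. 1 :: 'k) r K"
    and G: "finite G" "card G = r"
    and off: "\<And>j W. W \<subseteq> V \<Longrightarrow> card W = Suc j \<Longrightarrow> off_span W j th (th j)"
begin

lemma scK: "simplicial_complex K"
  using K by (simp add: deep_def)

definition ground :: "nat \<Rightarrow> ('g + nat) set" where
  "ground q = G <+> {..<q}"

text \<open>The common home of all leaves of index \<open>q\<close>: an upper bound for leaves of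
  any family and a lower bound for leaves of the full family.\<close>

definition base :: "nat \<Rightarrow> ('a set \<Rightarrow> 'k) set" where
  "base q = ch (faces (r - q) K) \<inter> killed V (th ` {..q})"

lemma ground_parts:
  assumes "P \<subseteq> ground q"
  shows "Inl -` P \<subseteq> G" "Inr -` P \<subseteq> {..<q}" "card P = card (Inl -` P) + card (Inr -` P)"
proof -
  show 1: "Inl -` P \<subseteq> G" "Inr -` P \<subseteq> {..<q}" using assms by (auto simp: ground_def)
  have "P = (Inl -` P) <+> (Inr -` P)" using assms by (auto simp: ground_def)
  hence "card P = card ((Inl -` P) <+> (Inr -` P))" by (rule arg_cong)
  also have "\<dots> = card (Inl -` P) + card (Inr -` P)"
    by (rule card_Plus) (rule finite_subset[OF 1(1) G(1)], rule finite_subset[OF 1(2)], simp)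
  finally show "card P = card (Inl -` P) + card (Inr -` P)" .
qed

lemma finite_ground: "finite (ground q)" and card_ground: "card (ground q) = r + q"
  using G by (simp_all add: ground_def card_Plus)

lemma base_fin_dim: "fs.fin_dim (base q)"
  unfolding base_def by (rule fs.fin_dim_mono[OF fin_dim_ch[OF finite_faces[OF scK]]]) blast

text \<open>Chains of degree 0 are multiples of the empty face. This bound is the source of the + 1
  in the theorem.\<close>

lemma base_dim_le_1: "fs.dim (base r) \<le> 1"
proof -
  have "fs.dim (base r) \<le> fs.dim (ch (faces 0 K) :: ('a set \<Rightarrow> 'k) set)"
    by (rule fs.dim_mono_fin_dim[OF fin_dim_ch[OF finite_faces[OF scK]]])
      (use fs.span_superset in \<open>auto simp: base_def\<close>)
  also have "\<dots> = card (faces 0 K)" by (rule dim_ch[OF finite_faces[OF scK]])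
  also have "faces 0 K = {{}}"
    using empty_face[OF scK] finite_face[OF scK] by (auto simp: faces_def)
  finally show ?thesis by simp
qed

lemma subspace_leaf: "fs.subspace (leaf V th \<D> q P)"
  unfolding leaf_def by (rule subspace_nd[OF subspace_ch])

lemma leaf_subset_base:
  assumes D: "\<And>S. S \<subseteq> G \<Longrightarrow> \<D> S \<subseteq> faces (r - card S) K"
    and P: "P \<in> ksubsets q (ground q)" and q: "q \<le> r"
  shows "leaf V th \<D> q P \<subseteq> base q"
proof
  fix x assume x: "x \<in> leaf V th \<D> q P"
  have P': "P \<subseteq> ground q" "card P = q" using P by (auto simp: ksubsets_def)
  note gp = ground_parts[OF P'(1)]
  have i: "Inr -` P \<inter> {..<Suc q} = Inr -` P" using gp(2) by auto
  have "ch (\<D> (Inl -` P)) \<subseteq> ch (faces (r - card (Inl -` P)) K)" by (rule ch_mono[OF D[OF gp(1)]])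
  from nd_ch[OF scK this, of V th "Suc q" "Inr -` P"]
  have "x \<in> ch (faces (r - card (Inl -` P) - card (Inr -` P)) K)" using x unfolding leaf_def i by blast
  hence "x \<in> ch (faces (r - q) K)" using gp(3) P'(2) by simp
  moreover have "contr V (th i) x = 0" if "i \<le> q" for i
    by (rule nd_killed[OF x[unfolded leaf_def]]) (use that in simp)
  ultimately show "x \<in> base q" by (simp add: base_def killed_def)
qed

lemma base_subset_full_leaf:
  assumes D: "\<D> (Inl -` P) = faces (r - card (Inl -` P)) K"
    and P: "P \<in> ksubsets q (ground q)" and q: "q \<le> r"
  shows "base q \<subseteq> leaf V th \<D> q P"
proof -
  have P': "P \<subseteq> ground q" "card P = q" using P by (auto simp: ksubsets_def)
  note gp = ground_parts[OF P'(1)]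
  have "card (Inl -` P) \<le> r" using card_mono[OF G(1) gp(1)] G(2) by simp
  hence "card (Inr -` P) + r - q = r - card (Inl -` P)" using gp(3) P'(2) by simp
  thus ?thesis using killed_subset_leaf[OF finV VK K off q gp(2)]
    unfolding leaf_def D base_def by simp
qed

lemma sum_card_eq_sum_leaves:
  assumes D: "\<And>S. S \<subseteq> G \<Longrightarrow> \<D> S \<subseteq> faces (r - card S) K"
  shows "(\<Sum>S\<in>Pow G. card (\<D> S)) =
    (\<Sum>q\<le>r. \<Sum>P\<in>ksubsets q (ground q). fs.dim (leaf V th \<D> q P))"
proof -
  let ?d = "\<lambda>S q I. fs.dim (nd V th (ch (\<D> S)) (Suc q) I)"
  \<comment> \<open>As \<open>card S \<le> r\<close> for \<open>S \<subseteq> G\<close>, the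
    condition means \<open>card S + card I = q\<close>, so that the pair amounts to a
    \<open>q\<close>-subset of \<open>ground q\<close>.\<close>
  let ?I = "\<lambda>q S. {I. I \<subseteq> {..<q} \<and> card I + r = r - card S + q}"
  have "(\<Sum>S\<in>Pow G. card (\<D> S)) = (\<Sum>S\<in>Pow G. \<Sum>q\<le>r. \<Sum>I\<in>?I q S. ?d S q I)"
  proof (rule sum.cong[OF refl])
    fix S assume "S \<in> Pow G"
    hence S: "\<D> S \<subseteq> faces (r - card S) K" using D by simp
    have "card (\<D> S) = fs.dim (ch (\<D> S) :: ('a set \<Rightarrow> 'k) set)"
      by (rule dim_ch[symmetric]) (rule finite_subset[OF S finite_faces[OF scK]])
    also have "\<dots> = (\<Sum>q\<le>r. \<Sum>I\<in>?I q S. ?d S q I)"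
      by (rule dim_eq_sum_leaves[OF scK subspace_ch ch_mono[OF S]]) simp
    finally show "card (\<D> S) = (\<Sum>q\<le>r. \<Sum>I\<in>?I q S. ?d S q I)" .
  qed
  also have "\<dots> = (\<Sum>q\<le>r. \<Sum>S\<in>Pow G. \<Sum>I\<in>?I q S. ?d S q I)" by (rule sum.swap)
  also have "\<dots> = (\<Sum>q\<le>r. \<Sum>P\<in>ksubsets q (ground q). fs.dim (leaf V th \<D> q P))"
  proof (rule sum.cong[OF refl])
    fix q assume "q \<in> {..r}"
    have fI: "finite (?I q S)" for S by (rule finite_subset[of _ "Pow {..<q}"]) auto
    have "(\<Sum>S\<in>Pow G. \<Sum>I\<in>?I q S. ?d S q I) = (\<Sum>(S, I)\<in>Sigma (Pow G) (?I q). ?d S q I)"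
      using G(1) fI by (subst sum.Sigma) auto
    also have "\<dots> = (\<Sum>P\<in>ksubsets q (ground q). fs.dim (leaf V th \<D> q P))"
    proof (rule sum.reindex_bij_witness[of _ "\<lambda>P. (Inl -` P, Inr -` P)" "\<lambda>(S, I). S <+> I"])
      fix a assume a: "a \<in> Sigma (Pow G) (?I q)"
      obtain S I where SI: "a = (S, I)" "S \<subseteq> G" "I \<subseteq> {..<q}" "card I + r = r - card S + q"
        using a by auto
      have v: "Inl -` (S <+> I) = S" "Inr -` (S <+> I) = I" by auto
      show "(Inl -` (case a of (S, I) \<Rightarrow> S <+> I), Inr -` (case a of (S, I) \<Rightarrow> S <+> I)) = a"
        using v SI(1) by simp
      have "S <+> I \<subseteq> ground q" using SI by (auto simp: ground_def)
      moreover have "card S \<le> r" using card_mono[OF G(1) SI(2)] G(2) by simp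
      ultimately show "(case a of (S, I) \<Rightarrow> S <+> I) \<in> ksubsets q (ground q)"
        using ground_parts(3)[of "S <+> I" q] v SI by (simp add: ksubsets_def)
      show "fs.dim (leaf V th \<D> q (case a of (S, I) \<Rightarrow> S <+> I)) = (case a of (S, I) \<Rightarrow> ?d S q I)"
        unfolding SI(1) leaf_def prod.case v ..
    next
      fix P assume "P \<in> ksubsets q (ground q)"
      hence P': "P \<subseteq> ground q" "card P = q" by (auto simp: ksubsets_def)
      note gp = ground_parts[OF P'(1)]
      show "(case (Inl -` P, Inr -` P) of (S, I) \<Rightarrow> S <+> I) = P"
        using P'(1) by (auto simp: ground_def)
      have "card (Inl -` P) \<le> r" using card_mono[OF G(1) gp(1)] G(2) by simp
      thus "(Inl -` P, Inr -` P) \<in> Sigma (Pow G) (?I q)" using gp P'(2) by auto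
    qed
    finally show "(\<Sum>S\<in>Pow G. \<Sum>I\<in>?I q S. ?d S q I) =
        (\<Sum>P\<in>ksubsets q (ground q). fs.dim (leaf V th \<D> q P))" .
  qed
  finally show ?thesis .
qed

end

text \<open>\<open>\<A> S\<close> stands for the members with trace \<open>S\<close> on
  \<open>G\<close>, with \<open>S\<close> taken away. \<open>shadow\<close> is stability under
  shifting towards \<open>i\<close>, and \<open>absorb\<close> its counterpart for forms. Both are
  asked of \<open>\<A>\<close> alone because only its chains get contracted.\<close>

locale cross_families = graded_forms V th K r G
  for V :: "'a::linorder set" and th :: "nat \<Rightarrow> 'a \<Rightarrow> 'k::alg_closed_field"
    and K :: "'a set set" and r :: nat and G :: "'g set" +
  fixes \<A> \<B> :: "'g set \<Rightarrow> 'a set set"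
  assumes A: "\<And>S. S \<subseteq> G \<Longrightarrow> \<A> S \<subseteq> faces (r - card S) K"
    and B: "\<And>S. S \<subseteq> G \<Longrightarrow> \<B> S \<subseteq> faces (r - card S) K"
    and A_empty: "\<A> {} = {}" and B_empty: "\<B> {} = {}"
    and cross: "\<And>S S' C C'. S \<subseteq> G \<Longrightarrow> S' \<subseteq> G \<Longrightarrow> S \<inter> S' = {} \<Longrightarrow> C \<in> \<A> S \<Longrightarrow> C' \<in> \<B> S' \<Longrightarrow> C \<inter> C' \<noteq> {}"
    and shadow: "\<And>S C w i. S \<subseteq> G \<Longrightarrow> C \<in> \<A> S \<Longrightarrow> w \<in> C \<Longrightarrow> i \<in> G - S \<Longrightarrow> C - {w} \<in> \<A> (insert i S)"
    and absorb: "\<And>S I j. S \<subseteq> G \<Longrightarrow> I \<subseteq> {..<j} \<Longrightarrow> absorbing V (th j) (nd V th (ch (\<A> S)) j I)"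
begin

lemma contr_leaf:
  assumes P: "P \<subseteq> ground q" and f: "f \<in> ground q - P" and x: "x \<in> leaf V th \<A> q P"
  shows "contr V \<eta> x \<in> leaf V th \<A> q (insert f P)"
proof (cases f)
  case (Inl i)
  have v: "Inl -` (insert f P) = insert i (Inl -` P)" "Inr -` (insert f P) = Inr -` P"
    using Inl by auto
  have i: "i \<in> G - Inl -` P" using f Inl by (auto simp: ground_def)
  show ?thesis unfolding leaf_def v
  proof (rule nd_transfer_from[OF _ _ _ subspace_ch x[unfolded leaf_def], of 0])
    fix y assume "y \<in> nd V th (ch (\<A> (Inl -` P))) 0 (Inr -` P)"
    hence "y \<in> ch (\<A> (Inl -` P))" by simp
    hence "contr V \<eta> y \<in> ch (\<A> (insert i (Inl -` P)))"
      by (rule contr_ch) (rule shadow[OF ground_parts(1)[OF P] _ _ i])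
    thus "contr V \<eta> y \<in> nd V th (ch (\<A> (insert i (Inl -` P)))) 0 (Inr -` P)" by simp
  qed auto
next
  case (Inr i)
  have v: "Inl -` (insert f P) = Inl -` P" "Inr -` (insert f P) = insert i (Inr -` P)"
    using Inr by auto
  have i: "i < q" "i \<notin> Inr -` P" using f Inr by (auto simp: ground_def)
  let ?I = "Inr -` P \<inter> {..<i}"
  have e: "nd V th M i (Inr -` P) = nd V th M i ?I" for M by (rule nd_cong) auto
  show ?thesis unfolding leaf_def v
  proof (rule nd_absorb[OF _ _ i(2) subspace_ch x[unfolded leaf_def]])
    show "absorbing V (th i) (nd V th (ch (\<A> (Inl -` P))) i (Inr -` P))"
      unfolding e by (rule absorb[OF ground_parts(1)[OF P]]) simp
  qed (use i in simp)
qed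

text \<open>Each point of \<open>F\<close> pays for one contraction, and there are as many points as
  the degree of \<open>x\<close>, so a nonzero chain can be brought down to a nonzero multiple of
  the empty face.\<close>

lemma leaf_contracts_to_unit:
  assumes "finite F" "P \<subseteq> ground q" "F \<subseteq> ground q - P" "x \<in> leaf V th \<A> q P"
    "x \<in> ch (faces (card F) K)" "x \<noteq> 0"
  shows "\<exists>m\<in>leaf V th \<A> q (P \<union> F). m {} \<noteq> 0 \<and> homog 0 m"
  using assms
proof (induction F arbitrary: P x rule: finite_induct)
  case empty
  have h: "homog 0 x" by (rule ch_faces_homog[OF scK]) (use empty.prems in simp)
  obtain \<tau> where t: "x \<tau> \<noteq> 0" using empty.prems(5) by (auto simp: fun_eq_iff zero_fun_apply)
  hence "\<tau> = {}" using h by (auto simp: homog_def)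
  thus ?case using t h empty.prems(3) by auto
next
  case (insert f F)
  obtain \<tau> where t: "x \<tau> \<noteq> 0" using insert.prems(5) by (auto simp: fun_eq_iff zero_fun_apply)
  have tf: "\<tau> \<in> faces (Suc (card F)) K" using chD[OF insert.prems(4) t] insert.hyps by simp
  hence tau: "\<tau> \<in> K" "card \<tau> = Suc (card F)" by (auto simp: faces_def)
  then obtain w where w: "w \<in> \<tau>" by fastforce
  have fint: "finite \<tau>" by (rule finite_face[OF scK tau(1)])
  have wV: "w \<in> V" using w tau(1) VK by blast
  \<comment> \<open>The coordinate form of a vertex \<open>w\<close> of a face in the support: its
    contraction is \<open>pd w x\<close>, which does not vanish at
    \<open>\<tau> - {w}\<close>.\<close>
  let ?\<eta> = "\<lambda>v. if v = w then 1 else (0::'k)"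
  let ?y = "contr V ?\<eta> x"
  have "?y (\<tau> - {w}) = (\<Sum>v\<in>V. if w = v then pd v x (\<tau> - {w}) else 0)"
    unfolding contr_apply by (rule sum.cong) auto
  also have "\<dots> = pd w x (\<tau> - {w})" using finV wV by simp
  also have "\<dots> = esgn (\<tau> - {w}) w * x \<tau>" using w fint by (simp add: pd_def insert_absorb)
  finally have "?y (\<tau> - {w}) \<noteq> 0" using t by simp
  hence y0: "?y \<noteq> 0" by (auto simp: zero_fun_apply)
  have "?y \<in> ch (faces (card (insert f F) - 1) K)" by (rule contr_faces[OF scK insert.prems(4)])
  hence yc: "?y \<in> ch (faces (card F) K)" using insert.hyps by simp
  have yl: "?y \<in> leaf V th \<A> q (insert f P)"
    by (rule contr_leaf[OF insert.prems(1) _ insert.prems(3)]) (use insert.prems(2) in simp)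
  have "insert f P \<subseteq> ground q" "F \<subseteq> ground q - insert f P"
    using insert.prems(1,2) insert.hyps(2) by auto
  from insert.IH[OF this yl yc y0] show ?case by simp
qed

text \<open>A common nonzero element of the two leaves contracts to a unit in a leaf of \<open>\<A>\<close> that is still
  disjoint from \<open>Q\<close>, and its wedge product with that unit cannot vanish.\<close>

lemma leaf_dims_disjoint:
  assumes P: "P \<in> ksubsets q (ground q)" and Q: "Q \<in> ksubsets q (ground q)"
    and PQ: "P \<inter> Q = {}" and q: "q \<le> r"
  shows "fs.dim (leaf V th \<A> q P) + fs.dim (leaf V th \<B> q Q) \<le> fs.dim (base q)"
proof (rule fs.dim_add_le_if_Int_zero[OF subspace_leaf leaf_subset_base[OF A P q]
      subspace_leaf leaf_subset_base[OF B Q q] base_fin_dim])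
  have False if x: "x \<in> leaf V th \<A> q P \<inter> leaf V th \<B> q Q" and n0: "x \<notin> {0}" for x
  proof -
    have P': "P \<subseteq> ground q" "card P = q" and Q': "Q \<subseteq> ground q" "card Q = q"
      using P Q by (auto simp: ksubsets_def)
    have fin: "finite P" "finite Q" using P'(1) Q'(1) finite_ground finite_subset by blast+
    let ?F = "ground q - (P \<union> Q)"
    have "card (P \<union> Q) = 2 * q" using card_Un_disjoint[OF fin PQ] P'(2) Q'(2) by simp
    \<comment> \<open>The \<open>r + q - 2 q\<close> points outside \<open>P\<close> and
      \<open>Q\<close> are exactly as many as the degree of \<open>x\<close> in
      \<open>base q\<close>.\<close>
    hence cF: "card ?F = r - q"
      using P'(1) Q'(1) fin card_ground by (subst card_Diff_subset) auto
    have "x \<in> base q" using leaf_subset_base[OF A P q] x by blast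
    hence xc: "x \<in> ch (faces (card ?F) K)" unfolding cF base_def by blast
    have xA: "x \<in> leaf V th \<A> q P" and xB: "x \<in> leaf V th \<B> q Q" using x by auto
    have x0: "x \<noteq> 0" using n0 by simp
    have sub: "?F \<subseteq> ground q - P" by blast
    have fF: "finite ?F" using finite_ground by simp
    obtain m where m: "m \<in> leaf V th \<A> q (P \<union> ?F)" "m {} \<noteq> 0" "homog 0 m"
      using leaf_contracts_to_unit[OF fF P'(1) sub xA xc x0] by blast
    have PF: "P \<union> ?F \<subseteq> ground q" using P'(1) by blast
    have dis: "(P \<union> ?F) \<inter> Q = {}" using PQ by blast
    have "wedge m x = 0"
    proof (rule nd_wedge[OF scK ch_mono[OF A[OF ground_parts(1)[OF PF]]] _ _ m(1)[unfolded leaf_def] xB[unfolded leaf_def]])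
      show "wedge m n = 0" if "m \<in> ch (\<A> (Inl -` (P \<union> ?F)))" "n \<in> ch (\<B> (Inl -` Q))" for m n :: "'a set \<Rightarrow> 'k"
      proof (rule wedge_eq_0_if_intersecting)
        fix C D assume "m C \<noteq> 0" "n D \<noteq> 0"
        hence "C \<in> \<A> (Inl -` (P \<union> ?F))" "D \<in> \<B> (Inl -` Q)" using chD that by blast+
        thus "C \<inter> D \<noteq> {}"
          by (intro cross[OF ground_parts(1)[OF PF] ground_parts(1)[OF Q'(1)]]) (use dis in auto)
      qed
      show "Inr -` (P \<union> ?F) \<inter> Inr -` Q = {}" using dis by auto
    qed
    moreover obtain \<tau> where t: "x \<tau> \<noteq> 0" using x0 by (auto simp: fun_eq_iff zero_fun_apply)
    moreover have "finite \<tau>"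
      using chD[OF xc t] finite_face[OF scK] by (auto simp: faces_def)
    ultimately show False using wedge_homog_0[OF m(3), of \<tau> x] m(2) by (simp add: zero_fun_apply)
  qed
  thus "leaf V th \<A> q P \<inter> leaf V th \<B> q Q \<subseteq> {0}" by blast
qed

theorem sum_card_bound:
  "(\<Sum>S\<in>Pow G. card (\<A> S) + card (\<B> S)) \<le> (\<Sum>S\<in>Pow G - {{}}. card (faces (r - card S) K)) + 1"
proof -
  let ?C = "\<lambda>q. card (ksubsets q (ground q))" and ?h = "\<lambda>q. fs.dim (base q)"
  define \<U> where "\<U> S = (if S = {} then {} else faces (r - card S) K)" for S :: "'g set"
  \<comment> \<open>The only \<open>q\<close>-set without a vertex of \<open>G\<close>. Its leaves
    start from the chains with trace \<open>{}\<close>, so they vanish for \<open>\<A>\<close>,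
    \<open>\<B>\<close> and \<open>\<U>\<close>.\<close>
  let ?P0 = "\<lambda>q. Inr ` {..<q} :: ('g + nat) set"
  have P0: "?P0 q \<in> ksubsets q (ground q)" for q
    by (auto simp: ksubsets_def ground_def card_image inj_on_def)
  have P0S: "Inl -` ?P0 q = {}" for q by auto
  have leaf0: "fs.dim (leaf V th \<D> q (?P0 q)) = 0" if "\<D> {} = {}" for \<D> :: "'g set \<Rightarrow> 'a set set" and q
  proof (rule fs.dim_zero_space)
    have "ch (\<D> (Inl -` ?P0 q)) \<subseteq> {0 :: 'a set \<Rightarrow> 'k}"
      unfolding P0S that by (auto simp: ch_def fun_eq_iff zero_fun_apply)
    moreover have "nd V th M j I \<subseteq> {0}" if "M \<subseteq> {0}" for M :: "('a set \<Rightarrow> 'k) set" and j I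
      using that by (induction j) (auto simp: contr.zero)
    ultimately show "leaf V th \<D> q (?P0 q) \<subseteq> {0}" unfolding leaf_def by blast
  qed
  have C1: "?C q \<ge> 1" for q
    using P0 finite_ksubsets[OF finite_ground] card_gt_0_iff[of "ksubsets q (ground q)"] by fastforce
  let ?w = "\<lambda>q P. fs.dim (leaf V th \<A> q P) + fs.dim (leaf V th \<B> q P)"
  have low: "(\<Sum>P\<in>ksubsets q (ground q). ?w q P) \<le> ?h q * (?C q - 1)" if "q < r" for q
  proof (rule kneser_weight_bound[where \<alpha> = "\<lambda>P. fs.dim (leaf V th \<A> q P)"
        and \<beta> = "\<lambda>P. fs.dim (leaf V th \<B> q P)", OF finite_ground _ _ P0])
    show "2 * q + 1 \<le> card (ground q)" using that by (simp add: card_ground)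
    show "fs.dim (leaf V th \<A> q (?P0 q)) = 0" by (rule leaf0[where \<D> = \<A>, OF A_empty])
    show "fs.dim (leaf V th \<B> q (?P0 q)) = 0" by (rule leaf0[where \<D> = \<B>, OF B_empty])
  qed (use leaf_dims_disjoint that in simp)
  have top: "(\<Sum>P\<in>ksubsets r (ground r). ?w r P) \<le> ?h r * ?C r"
    by (rule complement_weight_bound[OF finite_ground]) (use leaf_dims_disjoint card_ground in simp_all)
  \<comment> \<open>The matching at \<open>q = r\<close> misses the saving by one
    \<open>?h r\<close>, which is at most 1.\<close>
  have "?h r * ?C r = ?h r * (?C r - 1) + ?h r" using C1[of r] by (cases "?C r") auto
  hence top': "(\<Sum>P\<in>ksubsets r (ground r). ?w r P) \<le> ?h r * (?C r - 1) + 1"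
    using top base_dim_le_1 by linarith
  have "(\<Sum>S\<in>Pow G. card (\<A> S) + card (\<B> S)) = (\<Sum>q\<le>r. \<Sum>P\<in>ksubsets q (ground q). ?w q P)"
    unfolding sum.distrib
    by (rule arg_cong2[of _ _ _ _ "(+)"]; rule sum_card_eq_sum_leaves; rule A B)
  also have "\<dots> = (\<Sum>q<r. \<Sum>P\<in>ksubsets q (ground q). ?w q P) +
      (\<Sum>P\<in>ksubsets r (ground r). ?w r P)"
    by (simp only: lessThan_Suc_atMost[symmetric] sum.lessThan_Suc)
  also have "\<dots> \<le> (\<Sum>q<r. ?h q * (?C q - 1)) + (?h r * (?C r - 1) + 1)"
    by (intro add_mono sum_mono top') (use low in simp)
  also have "\<dots> = (\<Sum>q\<le>r. ?h q * (?C q - 1)) + 1"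
    by (simp only: lessThan_Suc_atMost[symmetric] sum.lessThan_Suc add.assoc)
  also have "(\<Sum>q\<le>r. ?h q * (?C q - 1)) \<le>
      (\<Sum>q\<le>r. \<Sum>P\<in>ksubsets q (ground q). fs.dim (leaf V th \<U> q P))"
  proof (rule sum_mono)
    fix q assume q: "q \<in> {..r}"
    let ?F = "ksubsets q (ground q)"
    have fin: "finite ?F" by (rule finite_ksubsets[OF finite_ground])
    have ge: "?h q \<le> fs.dim (leaf V th \<U> q P)" if P: "P \<in> ?F - {?P0 q}" for P
    proof -
      have P': "P \<subseteq> ground q" "card P = q" "P \<in> ?F" using P by (auto simp: ksubsets_def)
      note gp = ground_parts[OF P'(1)]
      have "Inl -` P \<noteq> {}"
      proof
        assume e: "Inl -` P = {}"
        hence "card (Inr -` P) = q" using gp(3) P'(2) by simp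
        hence "Inr -` P = {..<q}" using gp(2) card_subset_eq[of "{..<q}" "Inr -` P"] by simp
        hence "(Inl -` P) <+> (Inr -` P) = ?P0 q" using e by (simp add: Plus_def)
        moreover have "P = (Inl -` P) <+> (Inr -` P)" using P'(1) by (auto simp: ground_def)
        ultimately have "P = ?P0 q" by (rule trans[rotated])
        thus False using P by simp
      qed
      hence "\<U> (Inl -` P) = faces (r - card (Inl -` P)) K" by (simp add: \<U>_def)
      hence sub: "base q \<subseteq> leaf V th \<U> q P" using base_subset_full_leaf P'(3) q by simp
      have "fs.fin_dim (leaf V th \<U> q P)"
        unfolding leaf_def
        by (rule fin_dim_nd[OF fin_dim_ch]) (use finite_faces[OF scK] in \<open>simp add: \<U>_def\<close>)
      thus ?thesis by (rule fs.dim_mono_fin_dim[OF _ order_trans[OF sub fs.span_superset]])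
    qed
    have "?h q * (?C q - 1) = (\<Sum>P\<in>?F - {?P0 q}. ?h q)" using P0 by simp
    also have "\<dots> \<le> (\<Sum>P\<in>?F - {?P0 q}. fs.dim (leaf V th \<U> q P))" by (rule sum_mono[OF ge])
    also have "\<dots> \<le> (\<Sum>P\<in>?F. fs.dim (leaf V th \<U> q P))" by (rule sum_mono2[OF fin]) auto
    finally show "?h q * (?C q - 1) \<le> (\<Sum>P\<in>?F. fs.dim (leaf V th \<U> q P))" .
  qed
  also have "(\<Sum>q\<le>r. \<Sum>P\<in>ksubsets q (ground q). fs.dim (leaf V th \<U> q P)) = (\<Sum>S\<in>Pow G. card (\<U> S))"
    by (rule sum_card_eq_sum_leaves[symmetric]) (simp add: \<U>_def)
  also have "\<dots> = (\<Sum>S\<in>Pow G - {{}}. card (faces (r - card S) K))"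
    using G(1) by (intro sum.mono_neutral_cong_right) (auto simp: \<U>_def)
  finally show ?thesis by simp
qed

end

section \<open>Consequences of the Cohen-Macaulay property\<close>

lemma infinite_UNIV_alg_closed: "infinite (UNIV :: 'k::alg_closed_field set)"
proof
  assume fin: "finite (UNIV :: 'k set)"
  define p :: "'k poly" where "p = (\<Prod>a\<in>UNIV. [:- a, 1:]) + 1"
  have "degree (\<Prod>a\<in>UNIV. [:- a, 1:] :: 'k poly) = card (UNIV :: 'k set)"
    by (subst degree_prod_eq_sum_degree) auto
  moreover have "0 < card (UNIV :: 'k set)" using fin by (simp add: finite_UNIV_card_ge_0)
  ultimately have "0 < degree p" unfolding p_def by (subst degree_add_eq_left) auto
  then obtain x where "poly p x = 0" using alg_closed_imp_poly_has_root by blast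
  moreover have "poly (\<Prod>a\<in>UNIV. [:- a, 1:]) x = 0"
    unfolding poly_prod using fin by (auto intro!: bexI[of _ x])
  ultimately show False by (simp add: p_def)
qed

section \<open>Passing from the given field to its algebraic closure\<close>

lemma contr_additive_image:
  fixes f :: "'k::field \<Rightarrow> 'l::field"
  assumes add: "\<And>a b. f (a + b) = f a + f b"
  shows "contr V (\<lambda>_. 1) (\<lambda>\<sigma>. f (x \<sigma>)) = (\<lambda>\<tau>. f (contr V (\<lambda>_. 1) x \<tau>))"
proof
  fix \<tau>
  have "f 0 = f 0 + f 0" using add[of 0 0] by (simp only: add_0_right)
  hence f0: "f 0 = 0" by (simp only: add_cancel_right_right)
  have fneg: "f (- a) = - f a" for a
  proof -
    have "f a + f (- a) = f (a + - a)" by (rule add[symmetric])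
    hence "f a + f (- a) = 0" using f0 by (simp only: right_minus)
    thus ?thesis by (rule minus_unique[symmetric])
  qed
  have fsum: "f (\<Sum>v\<in>A. g v) = (\<Sum>v\<in>A. f (g v))" for g :: "'a \<Rightarrow> 'k" and A
    by (induction A rule: infinite_finite_induct) (simp_all add: f0 add)
  have fpow: "f ((-1) ^ n * a) = (-1) ^ n * f a" for n a
    by (induction n) (simp_all add: fneg)
  show "contr V (\<lambda>_. 1) (\<lambda>\<sigma>. f (x \<sigma>)) \<tau> = f (contr V (\<lambda>_. 1) x \<tau>)"
    unfolding contr_apply fsum by (rule sum.cong) (auto simp: pd_def esgn_def fpow f0)
qed

text \<open>Chains with values in an extension field split into coordinate chains with respect to a
  basis over the base field.\<close>

lemma exact_at_alg_closure:
  assumes ex: "exact_at V (\<lambda>_. 1 :: 'f::field) k L" and fin: "finite (faces k L)"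
  shows "exact_at V (\<lambda>_. 1 :: 'f alg_closure) k L"
  unfolding exact_at_def
proof (intro ballI impI)
  fix x :: "'a set \<Rightarrow> 'f alg_closure"
  assume x: "x \<in> ch (faces k L)" "contr V (\<lambda>_. 1) x = 0"
  interpret ac: vector_space "\<lambda>(a::'f) z. to_ac a * z"
    by unfold_locales (simp_all add: algebra_simps)
  define B where "B = ac.extend_basis {}"
  have B: "ac.independent B" "ac.span B = UNIV"
    unfolding B_def using ac.independent_extend_basis ac.span_extend_basis ac.independent_empty by auto
  define \<phi> where "\<phi> b z = ac.representation B z b" for b z
  have add: "\<phi> b (y + z) = \<phi> b y + \<phi> b z" for b y z
    unfolding \<phi>_def using B by (simp add: ac.representation_add)
  have \<phi>0: "\<phi> b 0 = 0" for b unfolding \<phi>_def by (simp add: ac.representation_zero)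
  define B0 where "B0 = (\<Union>\<sigma>\<in>faces k L. {b. \<phi> b (x \<sigma>) \<noteq> 0})"
  have finB0: "finite B0" unfolding B0_def \<phi>_def using fin ac.finite_representation by auto
  have rep: "(\<Sum>b\<in>B0. to_ac (\<phi> b (x \<tau>)) * b) = x \<tau>" for \<tau>
  proof (cases "\<tau> \<in> faces k L")
    case True
    have "(\<Sum>b\<in>B0. to_ac (\<phi> b (x \<tau>)) * b) = (\<Sum>b | \<phi> b (x \<tau>) \<noteq> 0. to_ac (\<phi> b (x \<tau>)) * b)"
      by (rule sum.mono_neutral_right[OF finB0]) (use True in \<open>auto simp: B0_def\<close>)
    also have "\<dots> = x \<tau>"
      unfolding \<phi>_def by (rule ac.sum_nonzero_representation_eq[OF B(1)]) (simp add: B(2))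
    finally show ?thesis .
  next
    case False
    hence "x \<tau> = 0" by (rule ch_eq_0[OF x(1)])
    thus ?thesis by (simp add: \<phi>0)
  qed
  have "\<exists>u. u \<in> ch (faces (Suc k) L) \<and> contr V (\<lambda>_. 1) u = (\<lambda>\<tau>. \<phi> b (x \<tau>))" for b
  proof -
    have A: "(\<lambda>\<tau>. \<phi> b (x \<tau>)) \<in> ch (faces k L)"
    proof (rule chI)
      fix \<tau> assume "\<phi> b (x \<tau>) \<noteq> 0"
      hence "x \<tau> \<noteq> 0" by (rule contrapos_nn) (simp add: \<phi>0)
      thus "\<tau> \<in> faces k L" by (rule chD[OF x(1)])
    qed
    have C: "contr V (\<lambda>_. 1) (\<lambda>\<tau>. \<phi> b (x \<tau>)) = 0"
      unfolding contr_additive_image[of "\<phi> b", OF add] x(2) by (simp add: fun_eq_iff \<phi>0 zero_fun_apply)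
    show ?thesis by (rule exact_atD[OF ex A C]) blast
  qed
  then obtain u where u: "\<And>b. u b \<in> ch (faces (Suc k) L)"
    "\<And>b. contr V (\<lambda>_. 1) (u b) = (\<lambda>\<tau>. \<phi> b (x \<tau>))" by metis
  define w where "w = (\<Sum>b\<in>B0. (\<lambda>\<tau>. to_ac (u b \<tau>) * b))"
  have "w \<in> ch (faces (Suc k) L)" unfolding w_def
  proof (rule fs.subspace_sum[OF subspace_ch], rule chI)
    fix b \<tau> assume "to_ac (u b \<tau>) * b \<noteq> 0"
    hence "u b \<tau> \<noteq> 0" by (rule contrapos_nn) simp
    thus "\<tau> \<in> faces (Suc k) L" by (rule chD[OF u(1)])
  qed
  moreover have "contr V (\<lambda>_. 1) w = x"
  proof
    fix \<tau>
    have "contr V (\<lambda>_. 1) w \<tau> = (\<Sum>b\<in>B0. contr V (\<lambda>_. 1) (\<lambda>\<tau>. to_ac (u b \<tau>) * b) \<tau>)"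
      unfolding w_def contr.sum fun_sum_apply ..
    also have "\<dots> = (\<Sum>b\<in>B0. to_ac (contr V (\<lambda>_. 1) (u b) \<tau>) * b)"
      by (rule sum.cong[OF refl], subst contr_additive_image[where f = "\<lambda>a. to_ac a * _"])
        (simp_all add: algebra_simps)
    also have "\<dots> = x \<tau>" unfolding u(2) by (rule rep)
    finally show "contr V (\<lambda>_. 1) w \<tau> = x \<tau>" .
  qed
  ultimately show "\<exists>u\<in>ch (faces (Suc k) L). contr V (\<lambda>_. 1) u = x" by blast
qed

lemma is_chain_iff: "is_chain K k c \<longleftrightarrow> c \<in> ch (faces k K)"
  by (auto simp: is_chain_def ch_def faces_def)

lemma bdry_eq_contr:
  fixes c :: "'a::linorder set \<Rightarrow> 'k::field"
  assumes V: "finite V" "\<Union>L \<subseteq> V" and L: "simplicial_complex L" and c: "c \<in> ch (faces k L)"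
  shows "bdry L c = contr V (\<lambda>_. 1) c"
proof
  fix \<tau>
  let ?S = "{v. v \<notin> \<tau> \<and> insert v \<tau> \<in> L}"
  have fin: "finite \<tau>" if "v \<in> ?S" for v
    using finite_face[OF L, of "insert v \<tau>"] that by simp
  have "(\<Sum>v\<in>?S. (-1) ^ card {u\<in>\<tau>. u < v} * c (insert v \<tau>)) = (\<Sum>v\<in>V. 1 * pd v c \<tau>)"
  proof (rule sum.mono_neutral_cong_left[OF V(1)])
    show "?S \<subseteq> V" using V(2) by auto
    have "c (insert v \<tau>) = 0" if "insert v \<tau> \<notin> L" for v
      by (rule ch_eq_0[OF c]) (use that in \<open>simp add: faces_def\<close>)
    thus "\<forall>v\<in>V - ?S. 1 * pd v c \<tau> = 0" by (auto simp: pd_def)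
  next
    fix v assume "v \<in> ?S"
    thus "(-1) ^ card {u\<in>\<tau>. u < v} * c (insert v \<tau>) = 1 * pd v c \<tau>"
      using fin by (simp add: pd_def esgn_def)
  qed
  thus "bdry L c \<tau> = contr V (\<lambda>_. 1) c \<tau>" by (simp add: bdry_def contr_apply)
qed

lemma exact_at_if_red_hom_vanishes:
  assumes V: "finite V" "\<Union>L \<subseteq> V" and L: "simplicial_complex L"
    and h: "red_hom_vanishes TYPE('f::field) L (int k - 1)"
  shows "exact_at V (\<lambda>_. 1 :: 'f) k L"
  unfolding exact_at_def
proof (intro ballI impI)
  fix x :: "'a set \<Rightarrow> 'f" assume x: "x \<in> ch (faces k L)" "contr V (\<lambda>_. 1) x = 0"
  have n: "nat (int k - 1 + 1) = k" "nat (int k - 1 + 2) = Suc k" by auto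
  have h': "\<forall>c :: 'a set \<Rightarrow> 'f. c \<in> ch (faces k L) \<and> bdry L c = (\<lambda>_. 0) \<longrightarrow>
      (\<exists>b :: 'a set \<Rightarrow> 'f. b \<in> ch (faces (Suc k) L) \<and> bdry L b = c)"
    using h unfolding red_hom_vanishes_def n is_chain_iff by simp
  have "bdry L x = (\<lambda>_. 0)"
    using bdry_eq_contr[OF V L x(1)] x(2) by (simp add: fun_eq_iff zero_fun_apply)
  with x(1) have "\<exists>b :: 'a set \<Rightarrow> 'f. b \<in> ch (faces (Suc k) L) \<and> bdry L b = x"
    by (intro h'[THEN spec, THEN mp] conjI)
  then obtain b where b: "b \<in> ch (faces (Suc k) L)" "bdry L b = x" by (elim exE conjE)
  thus "\<exists>u\<in>ch (faces (Suc k) L). contr V (\<lambda>_. 1) u = x"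
    using bdry_eq_contr[OF V L b(1)] by (intro bexI[of _ b]) simp_all
qed

text \<open>If no edge leaves \<open>C\<close>, fill the difference of \<open>{a}\<close> and
  \<open>{b}\<close> by a chain \<open>u\<close> of edges and keep the edges inside
  \<open>C\<close>. The boundary of this part is the part of the difference inside \<open>C\<close>,
  a single vertex with coefficient -1, which is impossible for a boundary.\<close>

lemma exact_at_1_connected:
  fixes L :: "'a::linorder set set"
  assumes V: "finite V" "\<Union>L \<subseteq> V" and L: "simplicial_complex L"
    and ex: "exact_at V (\<lambda>_. 1 :: 'k::field) 1 L"
    and a: "{a} \<in> L" "a \<notin> C" and b: "{b} \<in> L" "b \<in> C"
  shows "\<exists>v w. v \<in> C \<and> w \<notin> C \<and> {v, w} \<in> L"
proof (rule ccontr)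
  assume n: "\<nexists>v w. v \<in> C \<and> w \<notin> C \<and> {v, w} \<in> L"
  have aV: "a \<in> V" and bV: "b \<in> V" and ab: "a \<noteq> b" using a b V(2) by auto
  define c :: "'a set \<Rightarrow> 'k" where "c \<sigma> = (if \<sigma> = {a} then 1 else if \<sigma> = {b} then -1 else 0)" for \<sigma>
  have cc: "c \<in> ch (faces 1 L)" using a b by (auto simp: c_def ch_def faces_def split: if_splits)
  have "contr V (\<lambda>_. 1) c = 0"
  proof
    fix \<tau>
    show "contr V (\<lambda>_. 1) c \<tau> = 0 \<tau>"
    proof (cases "\<tau> = {}")
      case True
      have "contr V (\<lambda>_. 1) c {} = (\<Sum>v\<in>V. c {v})"
        unfolding contr_apply by (simp add: pd_def esgn_def)
      also have "\<dots> = (\<Sum>v\<in>{a, b}. c {v})"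
        by (rule sum.mono_neutral_right) (use V aV bV in \<open>auto simp: c_def\<close>)
      also have "\<dots> = 0" using ab by (simp add: c_def)
      finally show ?thesis using True by (simp add: zero_fun_apply)
    next
      case False
      have "pd v c \<tau> = 0" for v
        using False by (auto simp: pd_def c_def)
      thus ?thesis by (simp add: contr_apply zero_fun_apply)
    qed
  qed
  then obtain u where u: "u \<in> ch (faces 2 L)" "contr V (\<lambda>_. 1) u = c"
    using exact_atD[OF ex cc] by (metis Suc_1)
  define y where "y \<sigma> = (if \<sigma> \<subseteq> C then u \<sigma> else 0)" for \<sigma>
  have yv: "contr V (\<lambda>_. 1) y {v} = (if v \<in> C then c {v} else 0)" if v: "v \<in> V" for v
  proof (cases "v \<in> C")
    case True
    have "y (insert w {v}) = u (insert w {v})" for w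
    proof (cases "w \<in> C")
      case False
      hence "{v, w} \<notin> L" using n True by blast
      hence "u (insert w {v}) = 0" by (intro ch_eq_0[OF u(1)]) (simp add: faces_def insert_commute)
      thus ?thesis using False by (simp add: y_def)
    qed (use True in \<open>simp add: y_def\<close>)
    hence "pd w y {v} = pd w u {v}" for w by (simp add: pd_def)
    hence "contr V (\<lambda>_. 1) y {v} = contr V (\<lambda>_. 1) u {v}" by (simp add: contr_apply)
    thus ?thesis using True u(2) by simp
  next
    case False
    hence "pd w y {v} = 0" for w by (simp add: pd_def y_def)
    thus ?thesis using False by (simp add: contr_apply)
  qed
  have "contr V (\<lambda>_. 1) (contr V (\<lambda>_. 1) y) {} = (\<Sum>v\<in>V. contr V (\<lambda>_. 1) y {v})"
    unfolding contr_apply[of V "\<lambda>_. 1" "contr V (\<lambda>_. 1) y"] by (simp add: pd_def esgn_def)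
  also have "\<dots> = (\<Sum>v\<in>V. if v \<in> C then c {v} else 0)" by (rule sum.cong[OF refl yv])
  also have "\<dots> = (\<Sum>v\<in>{b}. if v \<in> C then c {v} else 0)"
    by (rule sum.mono_neutral_right) (use V bV a in \<open>auto simp: c_def\<close>)
  also have "\<dots> = -1" using b ab by (simp add: c_def)
  finally show False by (simp add: zero_fun_apply)
qed

lemma card_le_cdim:
  assumes "finite L" "B \<in> L"
  shows "int (card B) - 1 \<le> cdim L"
proof -
  have "card B \<le> Max (card ` L)" by (rule Max_ge) (use assms in auto)
  thus ?thesis by (simp add: cdim_def)
qed

text \<open>Purity: take a facet \<open>A\<close> that is too small and a face \<open>B\<close> of full size with \<open>A \<inter> B\<close> as large
  as possible; the link of \<open>A \<inter> B\<close> is connected, and an edge of it leaving the vertices that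
  extend to full size yields a better pair.\<close>

lemma cohen_macaulay_pure:
  fixes K :: "'a::linorder set set"
  assumes K: "simplicial_complex K" and cm: "cohen_macaulay TYPE('f::field) K"
    and le: "\<And>F. F \<in> K \<Longrightarrow> card F \<le> d" and full: "F0 \<in> K" "card F0 = d" and A0: "A0 \<in> K"
  shows "\<exists>B\<in>K. A0 \<subseteq> B \<and> card B = d"
proof (rule ccontr)
  assume no: "\<not> (\<exists>B\<in>K. A0 \<subseteq> B \<and> card B = d)"
  have finK: "finite K" using K by (simp add: simplicial_complex_def)
  note finF = finite_face[OF K]
  define small where "small A \<longleftrightarrow> A \<in> K \<and> \<not> (\<exists>B\<in>K. A \<subseteq> B \<and> card B = d)" for A
  let ?Pr = "{(A, B). small A \<and> B \<in> K \<and> card B = d}"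
  have finP: "finite ?Pr" by (rule finite_subset[of _ "K \<times> K"]) (use finK in \<open>auto simp: small_def\<close>)
  have "(A0, F0) \<in> ?Pr" using no A0 full by (simp add: small_def)
  hence ne: "?Pr \<noteq> {}" by blast
  let ?f = "\<lambda>(A, B). card (A \<inter> B)"
  have "Max (?f ` ?Pr) \<in> ?f ` ?Pr"
    by (rule Max_in[OF finite_imageI[OF finP]]) (simp only: image_is_empty ne not_False_eq_True)
  then obtain p where p: "p \<in> ?Pr" "?f p = Max (?f ` ?Pr)" by (elim imageE) (rule that[OF _ sym])
  obtain A B where AB: "p = (A, B)" by (cases p)
  have A: "small A" "A \<in> K" and B: "B \<in> K" "card B = d" using p(1) AB by (auto simp: small_def)
  have max: "card (A' \<inter> B') \<le> card (A \<inter> B)" if "small A'" "B' \<in> K" "card B' = d" for A' B'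
  proof -
    have "(A', B') \<in> ?Pr" using that by simp
    hence "?f (A', B') \<le> Max (?f ` ?Pr)" by (intro Max_ge finite_imageI finP imageI)
    thus ?thesis using p(2) AB by simp
  qed
  have up: "small A'" if "small A1" "A1 \<subseteq> A'" "A' \<in> K" for A1 A'
    using that unfolding small_def by blast
  define E where "E = A \<inter> B"
  have EK: "E \<in> K" unfolding E_def by (rule face_subset[OF K A(2)]) blast
  have finE: "finite E" by (rule finF[OF EK])
  have "\<not> A \<subseteq> B" using A(1) B by (auto simp: small_def)
  then obtain a where a: "a \<in> A" "a \<notin> B" by blast
  have cA: "card A < d" using le[OF A(2)] A by (cases "card A = d") (auto simp: small_def)
  have "E \<subset> A" using a by (auto simp: E_def)
  hence "card E < card A" by (rule psubset_card_mono[OF finF[OF A(2)]])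
  moreover have "card (B - E) = d - card E"
    using B(2) finE by (subst card_Diff_subset) (auto simp: E_def)
  \<comment> \<open>Since \<open>card E < card A < d\<close>, the link of \<open>E\<close> has
    dimension at least 1, as needed for its homology in dimension 0 to vanish.\<close>
  ultimately have c2: "2 \<le> card (B - E)" using cA by simp
  hence "B - E \<noteq> {}" by (intro notI) simp
  then obtain b where b: "b \<in> B" "b \<notin> E" by blast
  let ?L = "link K E"
  have L: "simplicial_complex ?L" by (rule complex_link[OF K EK])
  have "E \<union> (B - E) = B" by (auto simp: E_def)
  hence "B - E \<in> ?L" using B(1) face_subset[OF K B(1), of "B - E"] by (auto simp: link_def)
  hence "int (card (B - E)) - 1 \<le> cdim ?L"
    using card_le_cdim[of ?L "B - E"] L by (simp add: simplicial_complex_def)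
  hence "0 < cdim ?L" using c2 by simp
  hence "red_hom_vanishes TYPE('f) ?L (int 1 - 1)" using cm EK by (simp add: cohen_macaulay_def)
  moreover have finU: "finite (\<Union>?L)"
    using L finite_face[OF L] by (auto simp: simplicial_complex_def)
  ultimately have ex: "exact_at (\<Union>?L) (\<lambda>_. 1 :: 'f) 1 ?L"
    using exact_at_if_red_hom_vanishes[OF finU subset_refl L, where k = 1] by simp
  \<comment> \<open>The vertices that together with \<open>E\<close> extend to full size. By
    maximality of the pair, \<open>a\<close> is not among them, while \<open>b\<close> is; so some
    edge of the link leaves \<open>C\<close>.\<close>
  define C where "C = {v. \<exists>B'\<in>K. card B' = d \<and> insert v E \<subseteq> B'}"
  have mem: "{v} \<in> ?L" if "insert v E \<subseteq> F" "F \<in> K" "v \<notin> E" for v F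
    using that face_subset[OF K that(2), of "insert v E"]
      face_subset[OF K that(2), of "{v}"] by (auto simp: link_def)
  have grow: "False" if "small A'" "B' \<in> K" "card B' = d" "insert v E \<subseteq> A' \<inter> B'" "v \<notin> E" for A' B' v
  proof -
    have "card (insert v E) \<le> card (A' \<inter> B')"
      by (rule card_mono[OF _ that(4)]) (use finF[OF that(2)] in blast)
    thus False using max[OF that(1-3)] that(5) finE by (simp add: E_def[symmetric])
  qed
  have aE: "a \<notin> E" using a by (simp add: E_def)
  have "a \<notin> C"
  proof
    assume "a \<in> C"
    then obtain B' where "B' \<in> K" "card B' = d" "insert a E \<subseteq> B'" by (auto simp: C_def)
    thus False using grow[OF A(1), of B' a] a aE by (auto simp: E_def)
  qed
  moreover have "b \<in> C" using B b by (auto simp: C_def E_def)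
  moreover have "{a} \<in> ?L" by (rule mem[OF _ A(2) aE]) (use a in \<open>auto simp: E_def\<close>)
  moreover have "{b} \<in> ?L" by (rule mem[OF _ B(1) b(2)]) (use b in \<open>auto simp: E_def\<close>)
  ultimately obtain v w where vw: "v \<in> C" "w \<notin> C" "{v, w} \<in> ?L"
    using exact_at_1_connected[OF finU subset_refl L ex] by blast
  have vE: "v \<notin> E" and FK: "E \<union> {v, w} \<in> K" using vw(3) by (auto simp: link_def)
  obtain B' where B': "B' \<in> K" "card B' = d" "insert v E \<subseteq> B'" using vw(1) by (auto simp: C_def)
  \<comment> \<open>The end \<open>w\<close> outside \<open>C\<close> keeps this face from extending
    to full size, and the end \<open>v\<close> inside \<open>C\<close> makes it share
    \<open>insert v E\<close> with a full face: a larger intersection than the maximal one.\<close>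
  have "small (E \<union> {v, w})" unfolding small_def
  proof (intro conjI notI)
    assume "\<exists>B\<in>K. E \<union> {v, w} \<subseteq> B \<and> card B = d"
    hence "w \<in> C" by (auto simp: C_def)
    thus False using vw(2) by simp
  qed (rule FK)
  thus False using grow[OF _ B'(1,2) _ vE] B'(3) by blast
qed

section \<open>Shifting towards the distinguished vertices\<close>

definition shift_face :: "'a \<Rightarrow> 'a \<Rightarrow> 'a set set \<Rightarrow> 'a set \<Rightarrow> 'a set" where
  "shift_face w v \<A> F = (if w \<in> F \<and> v \<notin> F \<and> insert v (F - {w}) \<notin> \<A> then insert v (F - {w}) else F)"

lemma inj_on_shift_face: "inj_on (shift_face w v \<A>) \<A>"
proof (rule inj_onI)
  fix F H assume FH: "F \<in> \<A>" "H \<in> \<A>" and eq: "shift_face w v \<A> F = shift_face w v \<A> H"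
  have unshift: "insert w (insert v (E - {w}) - {v}) = E" if "w \<in> E" "v \<notin> E" for E using that by auto
  let ?m = "\<lambda>E. w \<in> E \<and> v \<notin> E \<and> insert v (E - {w}) \<notin> \<A>"
  show "F = H"
  proof (cases "?m F")
    case True
    hence sF: "shift_face w v \<A> F = insert v (F - {w})" by (simp add: shift_face_def)
    have "?m H"
    proof (rule ccontr)
      assume "\<not> ?m H"
      hence "shift_face w v \<A> H = H" unfolding shift_face_def by (rule if_not_P)
      thus False using eq sF FH(2) True by simp
    qed
    hence "shift_face w v \<A> H = insert v (H - {w})" by (simp add: shift_face_def)
    hence "insert w (insert v (F - {w}) - {v}) = insert w (insert v (H - {w}) - {v})"
      using eq sF by simp
    thus ?thesis using unshift[of F] unshift[of H] True \<open>?m H\<close> by simp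
  next
    case False
    hence sF: "shift_face w v \<A> F = F" unfolding shift_face_def by (rule if_not_P)
    have "\<not> ?m H"
    proof
      assume m: "?m H"
      hence "shift_face w v \<A> H = insert v (H - {w})" by (simp add: shift_face_def)
      thus False using m eq sF FH(1) by simp
    qed
    hence "shift_face w v \<A> H = H" unfolding shift_face_def by (rule if_not_P)
    thus ?thesis using eq sF by simp
  qed
qed

text \<open>The critical case is that \<open>F\<close> moves and \<open>H\<close> contains
  \<open>w\<close> but not \<open>v\<close> and stays. Then \<open>H\<close> was blocked by
  \<open>insert v (H - {w})\<close> already being in its family, and a common element of
  \<open>F\<close> with that set survives the move of \<open>F\<close>.\<close>

lemma shift_face_cross:
  assumes cross: "\<And>F H. F \<in> \<A> \<Longrightarrow> H \<in> \<B> \<Longrightarrow> F \<inter> H \<noteq> {}" and F: "F \<in> \<A>" and H: "H \<in> \<B>"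
  shows "shift_face w v \<A> F \<inter> shift_face w v \<B> H \<noteq> {}"
proof -
  have one: "insert v (F - {w}) \<inter> H \<noteq> {}"
    if cr: "\<And>F H. F \<in> \<C> \<Longrightarrow> H \<in> \<D> \<Longrightarrow> F \<inter> H \<noteq> {}" and F: "F \<in> \<C>" and H: "H \<in> \<D>"
      and m: "w \<in> F" "v \<notin> F" and n: "\<not> (w \<in> H \<and> v \<notin> H \<and> insert v (H - {w}) \<notin> \<D>)"
    for \<C> \<D> F H
  proof (cases "v \<in> H")
    case False
    show ?thesis
    proof (cases "w \<in> H")
      case True
      hence "insert v (H - {w}) \<in> \<D>" using n False by blast
      then obtain x where "x \<in> F" "x \<in> insert v (H - {w})" using cr[OF F] by blast
      thus ?thesis using m by auto
    next
      case wH: False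
      obtain x where "x \<in> F" "x \<in> H" using cr[OF F H] by blast
      thus ?thesis using wH by auto
    qed
  qed auto
  let ?m = "\<lambda>\<A> E. w \<in> E \<and> v \<notin> E \<and> insert v (E - {w}) \<notin> \<A>"
  have s: "?m \<C> E \<Longrightarrow> shift_face w v \<C> E = insert v (E - {w})" "\<not> ?m \<C> E \<Longrightarrow> shift_face w v \<C> E = E"
    for \<C> E unfolding shift_face_def by (rule if_P, assumption, rule if_not_P, assumption)
  have cross': "\<And>H F. H \<in> \<B> \<Longrightarrow> F \<in> \<A> \<Longrightarrow> H \<inter> F \<noteq> {}" using cross by blast
  consider "?m \<A> F" "?m \<B> H" | "?m \<A> F" "\<not> ?m \<B> H" | "\<not> ?m \<A> F" "?m \<B> H" | "\<not> ?m \<A> F" "\<not> ?m \<B> H"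
    by blast
  thus ?thesis
  proof cases
    case 1
    thus ?thesis unfolding s(1)[OF 1(1)] s(1)[OF 1(2)] by blast
  next
    case 2
    show ?thesis unfolding s(1)[OF 2(1)] s(2)[OF 2(2)]
      by (rule one[where \<C> = \<A> and \<D> = \<B>, OF cross F H _ _ 2(2)]) (use 2(1) in blast)+
  next
    case 3
    have "insert v (H - {w}) \<inter> F \<noteq> {}"
      by (rule one[where \<C> = \<B> and \<D> = \<A>, OF cross' H F _ _ 3(1)]) (use 3(2) in blast)+
    thus ?thesis unfolding s(2)[OF 3(1)] s(1)[OF 3(2)] by blast
  next
    case 4
    show ?thesis unfolding s(2)[OF 4(1)] s(2)[OF 4(2)] by (rule cross[OF F H])
  qed
qed

text \<open>Only vertices outside \<open>G\<close> are exchanged for vertices of \<open>G\<close>,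
  so the order of the shifted vertices drops out.\<close>

definition shift_stable :: "'a set \<Rightarrow> 'a set set \<Rightarrow> bool" where
  "shift_stable G \<A> \<longleftrightarrow>
    (\<forall>F\<in>\<A>. \<forall>w\<in>F - G. \<forall>v\<in>G - F. insert v (F - {w}) \<in> \<A>)"

text \<open>Both families are shifted by the same pair \<open>w\<close>, \<open>v\<close>, to keep
  them cross-intersecting. The total number of elements outside \<open>G\<close> never grows, and it
  drops for a family in which some member moves.\<close>

lemma exists_stable_families:
  assumes fin: "finite \<Omega>" and finF: "\<And>F. F \<in> \<Omega> \<Longrightarrow> finite F" and closed: "shift_stable G \<Omega>"
    and "\<A> \<subseteq> \<Omega>" "\<B> \<subseteq> \<Omega>" "\<A> \<noteq> {}" "\<B> \<noteq> {}" "\<And>F H. F \<in> \<A> \<Longrightarrow> H \<in> \<B> \<Longrightarrow> F \<inter> H \<noteq> {}"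
  shows "\<exists>\<A>' \<B>'. \<A>' \<subseteq> \<Omega> \<and> \<B>' \<subseteq> \<Omega> \<and> \<A>' \<noteq> {} \<and> \<B>' \<noteq> {} \<and>
    (\<forall>F\<in>\<A>'. \<forall>H\<in>\<B>'. F \<inter> H \<noteq> {}) \<and> card \<A>' = card \<A> \<and> card \<B>' = card \<B> \<and>
    shift_stable G \<A>' \<and> shift_stable G \<B>'"
  using assms(4-)
proof (induction "(\<Sum>F\<in>\<A>. card (F - G)) + (\<Sum>F\<in>\<B>. card (F - G))" arbitrary: \<A> \<B> rule: less_induct)
  case less
  show ?case
  proof (cases "shift_stable G \<A> \<and> shift_stable G \<B>")
    case True
    thus ?thesis using less.prems by (intro exI[of _ \<A>] exI[of _ \<B>]) simp
  next
    case False
    then obtain F w v where Fwv: "F \<in> \<A> \<and> insert v (F - {w}) \<notin> \<A> \<or> F \<in> \<B> \<and> insert v (F - {w}) \<notin> \<B>"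
      "w \<in> F" "w \<notin> G" "v \<in> G" "v \<notin> F" unfolding shift_stable_def by blast
    let ?A = "shift_face w v \<A> ` \<A>" and ?B = "shift_face w v \<B> ` \<B>"
    have sub: "shift_face w v \<C> ` \<C> \<subseteq> \<Omega>" if "\<C> \<subseteq> \<Omega>" for \<C>
      using that closed Fwv(3,4) by (auto simp: shift_face_def shift_stable_def)
    have le: "card (shift_face w v \<C> E - G) \<le> card (E - G)" if "E \<in> \<Omega>" for \<C> E
    proof -
      have "shift_face w v \<C> E - G \<subseteq> E - G" using Fwv(4) by (auto simp: shift_face_def)
      thus ?thesis using finF[OF that] by (intro card_mono) auto
    qed
    have lt: "card (shift_face w v \<C> F - G) < card (F - G)" if "F \<in> \<Omega>" "insert v (F - {w}) \<notin> \<C>" for \<C>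
    proof -
      have "shift_face w v \<C> F - G \<subset> F - G" using Fwv(2-5) that(2) by (auto simp: shift_face_def)
      thus ?thesis using finF[OF that(1)] by (intro psubset_card_mono) auto
    qed
    have sum: "(\<Sum>E\<in>shift_face w v \<C> ` \<C>. card (E - G)) = (\<Sum>E\<in>\<C>. card (shift_face w v \<C> E - G))" for \<C>
      using sum.reindex[OF inj_on_shift_face, of "\<lambda>E. card (E - G)" w v \<C>] by (simp only: o_def)
    have sum_le: "(\<Sum>E\<in>\<C>. card (shift_face w v \<C> E - G)) \<le> (\<Sum>E\<in>\<C>. card (E - G))" if "\<C> \<subseteq> \<Omega>" for \<C>
      by (rule sum_mono, rule le) (use that in blast)
    have sum_lt: "(\<Sum>E\<in>\<C>. card (shift_face w v \<C> E - G)) < (\<Sum>E\<in>\<C>. card (E - G))"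
      if "\<C> \<subseteq> \<Omega>" "F \<in> \<C>" "insert v (F - {w}) \<notin> \<C>" for \<C>
    proof (rule sum_strict_mono_ex1)
      show "finite \<C>" using that(1) fin by (rule finite_subset)
      show "\<forall>E\<in>\<C>. card (shift_face w v \<C> E - G) \<le> card (E - G)" using le that(1) by blast
      show "\<exists>E\<in>\<C>. card (shift_face w v \<C> E - G) < card (E - G)" using lt that by blast
    qed
    have meas: "(\<Sum>F\<in>?A. card (F - G)) + (\<Sum>F\<in>?B. card (F - G)) <
        (\<Sum>F\<in>\<A>. card (F - G)) + (\<Sum>F\<in>\<B>. card (F - G))"
      unfolding sum
      using Fwv(1) sum_le[OF less.prems(1)] sum_le[OF less.prems(2)]
        sum_lt[OF less.prems(1)] sum_lt[OF less.prems(2)] by (auto intro: add_less_le_mono add_le_less_mono)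
    have cr: "F \<inter> H \<noteq> {}" if "F \<in> ?A" "H \<in> ?B" for F H
      using that shift_face_cross[of \<A> \<B>, OF less.prems(5)] by blast
    have "card ?A = card \<A>" "card ?B = card \<B>" by (intro card_image inj_on_shift_face)+
    thus ?thesis
      using less.hyps[OF meas sub[OF less.prems(1)] sub[OF less.prems(2)] _ _ cr] less.prems(3,4) by simp
  qed
qed

text \<open>All common elements of \<open>F\<close> and \<open>H\<close> lie outside
  \<open>G\<close>. Exchange them in \<open>F\<close>, one at a time, for elements of
  \<open>G\<close> in neither set; \<open>F\<close> becomes disjoint from \<open>H\<close>.\<close>

lemma no_disjoint_trace:
  assumes A: "shift_stable G \<A>" and cross: "\<And>F H. F \<in> \<A> \<Longrightarrow> H \<in> \<B> \<Longrightarrow> F \<inter> H \<noteq> {}"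
    and H: "H \<in> \<B>" "finite H" and G: "finite G"
  shows "F \<in> \<A> \<Longrightarrow> F \<inter> H \<inter> G = {} \<Longrightarrow> card (F \<inter> H) \<le> card (G - (F \<union> H)) \<Longrightarrow> False"
proof (induction "card (F \<inter> H)" arbitrary: F)
  case 0
  hence "F \<inter> H = {}" using H(2) by simp
  thus ?case using cross[OF 0(2) H(1)] by simp
next
  case (Suc n)
  obtain w where w: "w \<in> F" "w \<in> H" using Suc(2) by (metis Int_iff card.empty ex_in_conv nat.simps(3))
  have "G - (F \<union> H) \<noteq> {}" using Suc.prems(3) Suc(2) by (intro notI) simp
  then obtain v where v: "v \<in> G" "v \<notin> F" "v \<notin> H" by blast
  have wG: "w \<notin> G" using Suc.prems(2) w by blast
  let ?F = "insert v (F - {w})"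
  have "?F \<in> \<A>" using A Suc.prems(1) w v wG by (simp add: shift_stable_def)
  moreover have e: "?F \<inter> H = F \<inter> H - {w}" using v by blast
  hence c: "card (?F \<inter> H) = n" using Suc(2) w H(2) by simp
  moreover have "?F \<inter> H \<inter> G = {}" using e Suc.prems(2) by blast
  moreover have "G - (?F \<union> H) = (G - (F \<union> H)) - {v}" using wG v w by blast
  hence "card (G - (?F \<union> H)) = card (G - (F \<union> H)) - 1" using v G by simp
  hence "card (?F \<inter> H) \<le> card (G - (?F \<union> H))" using c Suc.prems(3) Suc(2) by simp
  ultimately show ?case using Suc(1) by blast
qed

text \<open>If \<open>F\<close> avoids \<open>G\<close>, then \<open>F \<inter> H\<close> has at
  most \<open>card (H - G) = card (G - H)\<close> elements, so \<open>G\<close> has enough room for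
  the exchanges of \<open>no_disjoint_trace\<close>.\<close>

lemma stable_families_meet:
  assumes A: "shift_stable G \<A>" and cross: "\<And>F H. F \<in> \<A> \<Longrightarrow> H \<in> \<B> \<Longrightarrow> F \<inter> H \<noteq> {}"
    and G: "finite G" "card G = r" and H: "H \<in> \<B>" "finite H" "card H = r" and F: "F \<in> \<A>"
  shows "F \<inter> G \<noteq> {}"
proof
  assume e: "F \<inter> G = {}"
  have "card (F \<inter> H) \<le> card (H - G)" using e H(2) by (intro card_mono) auto
  also have "\<dots> = r - card (H \<inter> G)" using H card_Diff_subset_Int[of H G] by simp
  also have "\<dots> = card (G - H)" using G card_Diff_subset_Int[of G H] by (simp add: Int_commute)
  also have "G - H = G - (F \<union> H)" using e by blast
  finally show False using no_disjoint_trace[OF A cross H(1,2) G(1) F] e by blast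
qed

lemma card_family_by_trace:
  assumes fin: "finite \<F>" and G: "finite G" and finF: "\<And>F. F \<in> \<F> \<Longrightarrow> finite F"
  shows "card \<F> = (\<Sum>S\<in>Pow G. card {C. C \<inter> G = {} \<and> S \<union> C \<in> \<F>})"
proof -
  have fS: "finite {C. C \<inter> G = {} \<and> S \<union> C \<in> \<F>}" for S
  proof (rule finite_subset)
    show "{C. C \<inter> G = {} \<and> S \<union> C \<in> \<F>} \<subseteq> Pow (\<Union>\<F>)" by blast
    show "finite (Pow (\<Union>\<F>))" using fin finF by simp
  qed
  have "(\<Sum>S\<in>Pow G. card {C. C \<inter> G = {} \<and> S \<union> C \<in> \<F>}) =
      card (Sigma (Pow G) (\<lambda>S. {C. C \<inter> G = {} \<and> S \<union> C \<in> \<F>}))"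
    using G fS by (subst card_SigmaI) auto
  also have "\<dots> = card \<F>"
  proof (rule bij_betw_same_card[of "\<lambda>(S, C). S \<union> C"])
    show "bij_betw (\<lambda>(S, C). S \<union> C) (Sigma (Pow G) (\<lambda>S. {C. C \<inter> G = {} \<and> S \<union> C \<in> \<F>})) \<F>"
    proof (rule bij_betw_byWitness[where f' = "\<lambda>F. (F \<inter> G, F - G)"])
      show "(\<lambda>F. (F \<inter> G, F - G)) ` \<F> \<subseteq> Sigma (Pow G) (\<lambda>S. {C. C \<inter> G = {} \<and> S \<union> C \<in> \<F>})"
        by (auto simp: Int_Diff_Un)
      show "\<forall>F\<in>\<F>. (case (F \<inter> G, F - G) of (S, C) \<Rightarrow> S \<union> C) = F" by auto
    qed auto
  qed
  finally show ?thesis ..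
qed

text \<open>\<open>H\<close> has at least \<open>r\<close> elements besides \<open>F\<close>. As
  long as some element of \<open>G\<close> is missing from \<open>H\<close>, one of them lies
  outside \<open>G\<close> and can be exchanged for it without touching \<open>F\<close>.\<close>

lemma face_joins_shifting_set:
  assumes K: "simplicial_complex K" and G: "finite G" "card G = r"
    and shift: "\<And>F w v. F \<in> K \<Longrightarrow> w \<in> F - G \<Longrightarrow> v \<in> G - F \<Longrightarrow> insert v (F - {w}) \<in> K"
    and F: "F \<in> K" "card F = r"
  shows "H \<in> K \<Longrightarrow> F \<subseteq> H \<Longrightarrow> 2 * r \<le> card H \<Longrightarrow> G \<union> F \<in> K"
proof (induction "card (G - H)" arbitrary: H)
  case 0
  hence "G \<union> F \<subseteq> H" using G by auto
  thus ?case using face_subset[OF K 0(2)] by blast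
next
  case (Suc n)
  have finH: "finite H" "finite F" by (rule finite_face[OF K]; fact)+
  obtain v where v: "v \<in> G" "v \<notin> H" using Suc(2) by (metis Diff_iff card.empty ex_in_conv nat.simps(3))
  have "\<not> H - F \<subseteq> G"
  proof
    assume "H - F \<subseteq> G"
    hence "H - F \<subseteq> G - {v}" using v by blast
    hence "card (H - F) \<le> card (G - {v})" using G by (intro card_mono) auto
    also have "\<dots> < r" using psubset_card_mono[of G "G - {v}"] G v(1) by auto
    finally show False using Suc.prems F finH by (simp add: card_Diff_subset)
  qed
  then obtain w where w: "w \<in> H" "w \<notin> F" "w \<notin> G" by blast
  let ?H = "insert v (H - {w})"
  have "G - ?H = G - H - {v}" using w by blast
  hence "n = card (G - ?H)" using Suc(2) v G by simp
  moreover have "?H \<in> K" by (rule shift[OF Suc.prems(1)]) (use v w in auto)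
  moreover have "F \<subseteq> ?H" using Suc.prems(2) w by blast
  moreover have "card ?H = card H" using finH v(2) w(1) card_Suc_Diff1[of H w] by simp
  ultimately show ?case using Suc(1)[of ?H] Suc.prems(3) by simp
qed

text \<open>The only issue is that \<open>Max\<close> is attained: the range is finite, and -1
  belongs to it because the skeleton \<open>{{}}\<close> is trivially Cohen-Macaulay.\<close>

lemma depth_skeleton:
  assumes sc: "simplicial_complex \<Delta>"
  shows "cohen_macaulay TYPE('f::field) (skeleton (depth TYPE('f) \<Delta>) \<Delta>)"
    and "depth TYPE('f) \<Delta> \<le> cdim \<Delta>"
proof -
  let ?D = "{k. -1 \<le> k \<and> k \<le> cdim \<Delta> \<and> cohen_macaulay TYPE('f) (skeleton k \<Delta>)}"
  have "-1 \<le> cdim \<Delta>" by (simp add: cdim_def)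
  moreover have s: "skeleton (-1) \<Delta> = {{}}"
    using finite_face[OF sc] empty_face[OF sc] by (auto simp: skeleton_def)
  have "link {{}} A = {{}}" if "A \<in> {{}}" for A :: "'a set" using that by (auto simp: link_def)
  hence "cohen_macaulay TYPE('f) (skeleton (-1) \<Delta>)"
    unfolding cohen_macaulay_def s by (simp add: cdim_def red_hom_vanishes_def)
  ultimately have "?D \<noteq> {}" by blast
  moreover have "finite ?D" by (rule finite_subset[of _ "{-1..cdim \<Delta>}"]) auto
  ultimately have "depth TYPE('f) \<Delta> \<in> ?D" unfolding depth_def by (rule Max_in[rotated])
  thus "cohen_macaulay TYPE('f) (skeleton (depth TYPE('f) \<Delta>) \<Delta>)" "depth TYPE('f) \<Delta> \<le> cdim \<Delta>"
    by simp_all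
qed

text \<open>By purity the link of \<open>G \<union> C\<close> in \<open>Sk\<close> has dimension at
  least \<open>n - r - card C - 1\<close>, which exceeds \<open>k - 1\<close>. Exactness there
  carries over to the link in \<open>\<Delta>\<close>, since faces of size at most
  \<open>Suc k\<close> agree: together with \<open>G \<union> C\<close> they have at most
  \<open>2 * r \<le> n\<close> elements.\<close>

lemma deep_link_if_skeleton_cohen_macaulay:
  fixes \<Delta> :: "'a::linorder set set"
  assumes sc: "simplicial_complex \<Delta>" and GK: "G \<in> \<Delta>" and Gr: "card G = r" and n: "2 * r \<le> n"
    and Sk_iff: "\<And>F. F \<in> Sk \<longleftrightarrow> F \<in> \<Delta> \<and> card F \<le> n" and Sk: "simplicial_complex Sk"
    and cm: "cohen_macaulay TYPE('f::field) Sk" and pure: "\<And>A. A \<in> Sk \<Longrightarrow> \<exists>B\<in>Sk. A \<subseteq> B \<and> card B = n"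
  shows "deep (\<Union>(link \<Delta> G)) (\<lambda>_. 1 :: 'f alg_closure) r (link \<Delta> G)"
proof -
  note finF = finite_face[OF sc]
  have G: "finite G" "card G = r" using finF[OF GK] Gr by simp_all
  define \<Gamma> where "\<Gamma> = link \<Delta> G"
  have \<Gamma>: "simplicial_complex \<Gamma>" unfolding \<Gamma>_def by (rule complex_link[OF sc GK])
  define V where "V = \<Union>\<Gamma>"
  have finV: "finite V"
    unfolding V_def using \<Gamma> finite_face[OF \<Gamma>] by (auto simp: simplicial_complex_def)
  have deepF: "exact_at V (\<lambda>_. 1 :: 'f) k (link \<Gamma> C)" if C: "C \<in> \<Gamma>" and k: "k + card C < r" for C k
  proof -
    let ?A = "G \<union> C"
    have C': "G \<inter> C = {}" "?A \<in> \<Delta>" "C \<in> \<Delta>" using C by (auto simp: \<Gamma>_def link_def)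
    have finC: "finite C" by (rule finF[OF C'(3)])
    have cA: "card ?A = r + card C" using card_Un_disjoint[OF G(1) finC C'(1)] G(2) by simp
    have ASk: "?A \<in> Sk" using C'(2) cA k n by (simp add: Sk_iff)
    let ?L = "link Sk ?A"
    have L: "simplicial_complex ?L" by (rule complex_link[OF Sk ASk])
    have e: "link \<Gamma> C = link \<Delta> ?A" unfolding \<Gamma>_def by (rule link_link[OF sc C'(1)])
    have LU: "\<Union>?L \<subseteq> V"
    proof
      fix v assume "v \<in> \<Union>?L"
      then obtain B where B: "v \<in> B" "B \<in> ?L" by blast
      hence "B \<in> link \<Gamma> C" unfolding e by (auto simp: link_def Sk_iff)
      thus "v \<in> V" using B(1) by (auto simp: V_def link_def)
    qed
    obtain B where B: "B \<in> Sk" "?A \<subseteq> B" "card B = n" using pure[OF ASk] by blast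
    have "?A \<union> (B - ?A) = B" using B(2) by blast
    hence "B - ?A \<in> ?L" using B(1) face_subset[OF Sk B(1), of "B - ?A"] by (auto simp: link_def)
    hence "int (card (B - ?A)) - 1 \<le> cdim ?L"
      using card_le_cdim[of ?L "B - ?A"] L by (simp add: simplicial_complex_def)
    moreover have "card (B - ?A) = n - (r + card C)"
      using card_Diff_subset[OF _ B(2)] G(1) finC B(3) cA by simp
    ultimately have "int k - 1 < cdim ?L" using k n by linarith
    hence "red_hom_vanishes TYPE('f) ?L (int k - 1)" using cm ASk by (simp add: cohen_macaulay_def)
    hence ex: "exact_at V (\<lambda>_. 1 :: 'f) k ?L"
      by (rule exact_at_if_red_hom_vanishes[OF finV LU L])
    have fc: "faces j (link \<Gamma> C) = faces j ?L" if j: "j \<le> Suc k" for j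
    proof -
      have "card (?A \<union> B) \<le> n" if "B \<in> \<Delta>" "card B = j" for B
      proof -
        have "card (?A \<union> B) \<le> card ?A + card B" by (rule card_Un_le)
        thus ?thesis using that cA k j n by simp
      qed
      moreover have "j \<le> n" using j k n by simp
      ultimately show ?thesis unfolding e by (auto simp: faces_def link_def Sk_iff)
    qed
    show ?thesis using ex unfolding exact_at_def by (simp only: fc le_refl le_SucI)
  qed
  have "deep V (\<lambda>_. 1 :: 'f alg_closure) r \<Gamma>" unfolding deep_def
  proof (intro conjI ballI allI impI)
    show "simplicial_complex \<Gamma>" by (rule \<Gamma>)
    show "\<Union>\<Gamma> \<subseteq> V" by (simp add: V_def)
    fix C k assume C: "C \<in> \<Gamma>" and k: "k + card C < r"
    show "exact_at V (\<lambda>_. 1 :: 'f alg_closure) k (link \<Gamma> C)"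
      by (rule exact_at_alg_closure[OF deepF[OF C k] finite_faces[OF complex_link[OF \<Gamma> C]]])
  qed
  thus ?thesis by (simp only: V_def \<Gamma>_def)
qed

theorem theorem1p6:
  fixes \<Delta> :: "'a::linorder set set" and d :: int and r :: nat
    and \<A> \<B> :: "'a set set" and vs :: "'a list"
  assumes "simplicial_complex \<Delta>"
    and "depth TYPE('f::field) \<Delta> = d - 1"
    and "2 \<le> r" and "2 * int r \<le> d"
    and "\<A> \<noteq> {}" and "\<B> \<noteq> {}"
    and "\<A> \<subseteq> {F\<in>\<Delta>. card F = r}" and "\<B> \<subseteq> {F\<in>\<Delta>. card F = r}"
    and "cross_intersecting \<A> \<B>"
    and "distinct vs" and "length vs = r"
    and "shifted_wrt \<Delta> vs"
  shows "int (card \<A>) + int (card \<B>)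
           \<le> int (fcount r \<Delta>) - int (card {F\<in>\<Delta>. card F = r \<and> F \<inter> set vs = {}}) + 1"
proof -
  note sc = assms(1)
  note finF = finite_face[OF sc]
  have fin\<Delta>: "finite \<Delta>" using sc by (simp add: simplicial_complex_def)
  define G where "G = set vs"
  have G: "finite G" "card G = r" using assms(10,11) by (simp_all add: G_def distinct_card)
  have shift: "insert v (F - {w}) \<in> \<Delta>" if "F \<in> \<Delta>" "w \<in> F - G" "v \<in> G - F" for F w v
  proof -
    obtain i where "i < length vs" "v = vs ! i" using \<open>v \<in> G - F\<close> by (auto simp: G_def in_set_conv_nth)
    moreover from this have "w \<notin> set (take (Suc i) vs)" using \<open>w \<in> F - G\<close> by (auto simp: G_def dest: in_set_takeD)
    ultimately show ?thesis using assms(12) that by (auto simp: shifted_wrt_def)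
  qed
  define n where "n = nat d"
  have n: "d = int n" "2 * r \<le> n" using assms(3,4) by (auto simp: n_def)
  define Sk where "Sk = skeleton (d - 1) \<Delta>"
  have Sk_iff: "F \<in> Sk \<longleftrightarrow> F \<in> \<Delta> \<and> card F \<le> n" for F using n by (auto simp: Sk_def skeleton_def)
  have cm: "cohen_macaulay TYPE('f) Sk" and dc: "d - 1 \<le> cdim \<Delta>"
    using depth_skeleton[OF sc, where 'f = 'f] by (simp_all add: assms(2) Sk_def)
  have Sk: "simplicial_complex Sk" unfolding simplicial_complex_def
  proof (intro conjI ballI allI impI)
    have "{} \<in> Sk" using empty_face[OF sc] by (simp add: Sk_iff)
    thus "Sk \<noteq> {}" by blast
    show "finite Sk" by (rule finite_subset[OF _ fin\<Delta>]) (auto simp: Sk_iff)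
    fix A B assume "A \<in> Sk" "B \<subseteq> A"
    thus "B \<in> Sk" using face_subset[OF sc] card_mono[OF finF, of A B] by (fastforce simp: Sk_iff)
  qed
  \<comment> \<open>The depth does not exceed the dimension, so a largest face has at least
    \<open>n\<close> elements and can be trimmed.\<close>
  obtain F0 where F0: "F0 \<in> Sk" "card F0 = n"
  proof -
    have "Max (card ` \<Delta>) \<in> card ` \<Delta>" by (rule Max_in) (use fin\<Delta> empty_face[OF sc] in auto)
    then obtain F where F: "F \<in> \<Delta>" "card F = Max (card ` \<Delta>)" by auto
    hence "n \<le> card F" using dc n by (simp add: cdim_def)
    then obtain F' where F': "F' \<subseteq> F" "card F' = n" by (rule obtain_subset_with_card_n)
    hence "F' \<in> Sk" using face_subset[OF sc F(1)] by (simp add: Sk_iff)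
    thus thesis using that F'(2) by blast
  qed
  have pure: "\<exists>B\<in>Sk. A \<subseteq> B \<and> card B = n" if "A \<in> Sk" for A
    by (rule cohen_macaulay_pure[OF Sk cm _ F0 that]) (simp add: Sk_iff)
  \<comment> \<open>Purity first extends \<open>F\<close> to size \<open>n\<close>, which is at
    least \<open>2 * r\<close>, so that there is room to shift.\<close>
  have GF: "G \<union> F \<in> \<Delta>" if F: "F \<in> \<Delta>" "card F = r" for F
  proof -
    have "F \<in> Sk" using F n by (simp add: Sk_iff)
    then obtain B where B: "B \<in> Sk" "F \<subseteq> B" "card B = n" using pure by blast
    show ?thesis
      by (rule face_joins_shifting_set[OF sc G shift F _ B(2)]) (use B n in \<open>auto simp: Sk_iff\<close>)
  qed
  obtain A0 where "A0 \<in> \<A>" using assms(5) by blast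
  hence GK: "G \<in> \<Delta>" using GF[of A0] assms(7) face_subset[OF sc, of "G \<union> A0" G] by blast
  define \<Gamma> where "\<Gamma> = link \<Delta> G"
  have \<Gamma>: "simplicial_complex \<Gamma>" unfolding \<Gamma>_def by (rule complex_link[OF sc GK])
  define V where "V = \<Union>\<Gamma>"
  have finV: "finite V"
    unfolding V_def using \<Gamma> finite_face[OF \<Gamma>] by (auto simp: simplicial_complex_def)
  have deep: "deep V (\<lambda>_. 1 :: 'f alg_closure) r \<Gamma>"
    unfolding V_def \<Gamma>_def by (rule deep_link_if_skeleton_cohen_macaulay[OF sc GK G(2) n(2) Sk_iff Sk cm pure])
  define \<Omega> where "\<Omega> = {F\<in>\<Delta>. card F = r}"
  have fin\<Omega>: "finite \<Omega>" using fin\<Delta> by (simp add: \<Omega>_def)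
  have finF\<Omega>: "finite F" if "F \<in> \<Omega>" for F using finF that by (simp add: \<Omega>_def)
  have stable\<Omega>: "shift_stable G \<Omega>"
    unfolding shift_stable_def
  proof (intro ballI)
    fix F w v assume F: "F \<in> \<Omega>" "w \<in> F - G" "v \<in> G - F"
    have "card (insert v (F - {w})) = card F"
      using finF\<Omega>[OF F(1)] F(2,3) card_Suc_Diff1[of F w] by simp
    thus "insert v (F - {w}) \<in> \<Omega>" using F shift[of F w v] by (simp add: \<Omega>_def)
  qed
  have cr0: "F \<inter> H \<noteq> {}" if "F \<in> \<A>" "H \<in> \<B>" for F H
    using assms(9) that by (simp add: cross_intersecting_def)
  obtain \<A>' \<B>' where AB: "\<A>' \<subseteq> \<Omega>" "\<B>' \<subseteq> \<Omega>" "\<A>' \<noteq> {}" "\<B>' \<noteq> {}"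
    "\<forall>F\<in>\<A>'. \<forall>H\<in>\<B>'. F \<inter> H \<noteq> {}" "card \<A>' = card \<A>" "card \<B>' = card \<B>"
    "shift_stable G \<A>'" "shift_stable G \<B>'"
    using exists_stable_families[OF fin\<Omega> finF\<Omega> stable\<Omega> assms(7)[folded \<Omega>_def] assms(8)[folded \<Omega>_def] assms(5,6) cr0]
    by blast
  have crA: "F \<inter> H \<noteq> {}" and crB: "H \<inter> F \<noteq> {}" if "F \<in> \<A>'" "H \<in> \<B>'" for F H
    using AB(5) that by blast+
  obtain A1 B1 where AB1: "A1 \<in> \<A>'" "B1 \<in> \<B>'" using AB(3,4) by blast
  have in\<Omega>: "A1 \<in> \<Omega>" "B1 \<in> \<Omega>" using AB1 AB(1,2) by blast+
  have meetA: "F \<inter> G \<noteq> {}" if "F \<in> \<A>'" for F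
    by (rule stable_families_meet[OF AB(8) crA G AB1(2) finF\<Omega>[OF in\<Omega>(2)] _ that])
      (use in\<Omega>(2) in \<open>simp_all add: \<Omega>_def\<close>)
  have meetB: "F \<inter> G \<noteq> {}" if "F \<in> \<B>'" for F
    by (rule stable_families_meet[OF AB(9) crB G AB1(1) finF\<Omega>[OF in\<Omega>(1)] _ that])
      (use in\<Omega>(1) in \<open>simp_all add: \<Omega>_def\<close>)
  define tr where "tr \<F> S = {C. C \<inter> G = {} \<and> S \<union> C \<in> \<F>}" for \<F> :: "'a set set" and S
  \<comment> \<open>Up to size \<open>r\<close> the complex is the join of the simplex on
    \<open>G\<close> with \<open>\<Gamma>\<close>: one inclusion is \<open>GF\<close>, the other is
    closure under subsets.\<close>
  have tr_faces: "tr \<Omega> S = faces (r - card S) \<Gamma>" if S: "S \<subseteq> G" for S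
  proof (intro Set.set_eqI iffI)
    have finS: "finite S" using S G(1) by (rule finite_subset)
    have cS: "card S \<le> r" using card_mono[OF G(1) S] G(2) by simp
    {
      fix C assume "C \<in> tr \<Omega> S"
      hence C: "C \<inter> G = {}" "S \<union> C \<in> \<Delta>" "card (S \<union> C) = r" by (auto simp: tr_def \<Omega>_def)
      have finC: "finite C" using finF[OF C(2)] by simp
      have "card (S \<union> C) = card S + card C" by (rule card_Un_disjoint[OF finS finC]) (use S C(1) in blast)
      hence cC: "card C = r - card S" using C(3) by simp
      have "G \<union> (S \<union> C) = G \<union> C" using S by blast
      hence "G \<union> C \<in> \<Delta>" using GF[OF C(2,3)] by simp
      moreover have "C \<in> \<Delta>" by (rule face_subset[OF sc C(2)]) blast
      ultimately show "C \<in> faces (r - card S) \<Gamma>" using C(1) cC by (auto simp: faces_def \<Gamma>_def link_def)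
    next
      fix C assume "C \<in> faces (r - card S) \<Gamma>"
      hence C: "C \<in> \<Delta>" "G \<inter> C = {}" "G \<union> C \<in> \<Delta>" "card C = r - card S"
        by (auto simp: faces_def \<Gamma>_def link_def)
      have "card (S \<union> C) = card S + card C"
        by (rule card_Un_disjoint[OF finS finF[OF C(1)]]) (use S C(2) in blast)
      hence "card (S \<union> C) = r" using C(4) cS by simp
      moreover have "S \<union> C \<in> \<Delta>" by (rule face_subset[OF sc C(3)]) (use S in blast)
      ultimately show "C \<in> tr \<Omega> S" using C(2) by (auto simp: tr_def \<Omega>_def)
    }
  qed
  have tr_sub: "tr \<F> S \<subseteq> faces (r - card S) \<Gamma>" if "\<F> \<subseteq> \<Omega>" "S \<subseteq> G" for \<F> S
  proof -
    have "tr \<F> S \<subseteq> tr \<Omega> S" using that(1) by (auto simp: tr_def)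
    thus ?thesis by (simp only: tr_faces[OF that(2)])
  qed
  have card_tr: "card \<F> = (\<Sum>S\<in>Pow G. card (tr \<F> S))" if "\<F> \<subseteq> \<Omega>" for \<F>
    unfolding tr_def
    by (rule card_family_by_trace[OF finite_subset[OF that fin\<Omega>] G(1)]) (use finF\<Omega> that in blast)
  let ?Ms = "(\<lambda>S. ch (tr \<A>' S) :: ('a set \<Rightarrow> 'f alg_closure) set) ` Pow G"
  have "\<exists>th. \<forall>j. (\<forall>M\<in>?Ms. \<forall>I\<in>Pow {..<j}. absorbing V (th j) (nd V th M j I)) \<and>
      (\<forall>W\<in>{W. W \<subseteq> V \<and> card W = Suc j}. off_span W j th (th j))"
  proof (rule generic_forms_exist[OF infinite_UNIV_alg_closed finV])
    show "finite ?Ms" using G(1) by simp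
    fix M assume "M \<in> ?Ms"
    then obtain S where S: "S \<subseteq> G" "M = ch (tr \<A>' S)" by blast
    show "fs.subspace M" unfolding S(2) by (rule subspace_ch)
    show "fs.fin_dim M" unfolding S(2)
      by (rule fin_dim_ch[OF finite_subset[OF tr_sub[OF AB(1) S(1)] finite_faces[OF \<Gamma>]]])
  qed
  then obtain th where th0: "\<And>j. (\<forall>M\<in>?Ms. \<forall>I\<in>Pow {..<j}. absorbing V (th j) (nd V th M j I)) \<and>
      (\<forall>W\<in>{W. W \<subseteq> V \<and> card W = Suc j}. off_span W j th (th j))" by (elim exE) blast
  have th: "absorbing V (th j) (nd V th M j I)" if "M \<in> ?Ms" "I \<subseteq> {..<j}" for j M I
    using th0[of j] that by blast
  have off: "off_span W j th (th j)" if "W \<subseteq> V" "card W = Suc j" for j W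
    using th0[of j] that by blast
  interpret cross_families V th \<Gamma> r G "tr \<A>'" "tr \<B>'"
  proof (unfold_locales)
    show "finite V" by (rule finV)
    show "V = \<Union>\<Gamma>" by (rule V_def)
    show "deep V (\<lambda>_. 1 :: 'f alg_closure) r \<Gamma>" by (rule deep)
    show "finite G" "card G = r" by (rule G)+
    show "off_span W j th (th j)" if "W \<subseteq> V" "card W = Suc j" for j W by (rule off[OF that])
    show "tr \<A>' S \<subseteq> faces (r - card S) \<Gamma>" if "S \<subseteq> G" for S by (rule tr_sub[OF AB(1) that])
    show "tr \<B>' S \<subseteq> faces (r - card S) \<Gamma>" if "S \<subseteq> G" for S by (rule tr_sub[OF AB(2) that])
    show "tr \<A>' {} = {}" using meetA by (auto simp: tr_def)
    show "tr \<B>' {} = {}" using meetB by (auto simp: tr_def)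
    show "C \<inter> C' \<noteq> {}" if "S \<subseteq> G" "S' \<subseteq> G" "S \<inter> S' = {}" "C \<in> tr \<A>' S" "C' \<in> tr \<B>' S'" for S S' C C'
    proof -
      have "(S \<union> C) \<inter> (S' \<union> C') \<noteq> {}" using crA that(4,5) by (simp add: tr_def)
      moreover have "C \<inter> G = {}" "C' \<inter> G = {}" using that(4,5) by (simp_all add: tr_def)
      ultimately show ?thesis using that(1-3) by blast
    qed
    show "C - {w} \<in> tr \<A>' (insert i S)" if "S \<subseteq> G" "C \<in> tr \<A>' S" "w \<in> C" "i \<in> G - S" for S C w i
    proof -
      have C: "C \<inter> G = {}" "S \<union> C \<in> \<A>'" using that(2) by (auto simp: tr_def)
      have "w \<in> (S \<union> C) - G" "i \<in> G - (S \<union> C)" using that C(1) by blast+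
      hence "insert i ((S \<union> C) - {w}) \<in> \<A>'"
        using AB(8) C(2) unfolding shift_stable_def by blast
      moreover have "insert i ((S \<union> C) - {w}) = insert i S \<union> (C - {w})" using that C(1) by blast
      ultimately show ?thesis using C(1) by (auto simp: tr_def)
    qed
    show "absorbing V (th j) (nd V th (ch (tr \<A>' S)) j I)" if "S \<subseteq> G" "I \<subseteq> {..<j}" for S I j
      by (rule th[OF _ that(2)]) (use that(1) in blast)
  qed
  \<comment> \<open>The sum over nonempty traces counts \<open>?\<Omega>1\<close>; the empty trace
    is \<open>?\<Omega>0\<close>, whose size is the number \<open>\<gamma>\<close> that gets
    subtracted.\<close>
  let ?\<Omega>1 = "{F\<in>\<Omega>. F \<inter> G \<noteq> {}}" and ?\<Omega>0 = "{F\<in>\<Delta>. card F = r \<and> F \<inter> set vs = {}}"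
  have "card \<A> + card \<B> = (\<Sum>S\<in>Pow G. card (tr \<A>' S) + card (tr \<B>' S))"
    unfolding AB(6,7)[symmetric] card_tr[OF AB(1)] card_tr[OF AB(2)] by (rule sum.distrib[symmetric])
  also have "\<dots> \<le> (\<Sum>S\<in>Pow G - {{}}. card (faces (r - card S) \<Gamma>)) + 1" by (rule sum_card_bound)
  also have "(\<Sum>S\<in>Pow G - {{}}. card (faces (r - card S) \<Gamma>)) = (\<Sum>S\<in>Pow G. card (tr ?\<Omega>1 S))"
  proof (rule sum.mono_neutral_cong_left)
    show "finite (Pow G)" using G(1) by simp
    have "tr ?\<Omega>1 {} = {}" by (auto simp: tr_def)
    thus "\<forall>S\<in>Pow G - (Pow G - {{}}). card (tr ?\<Omega>1 S) = 0" by auto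
    fix S assume S: "S \<in> Pow G - {{}}"
    have "tr ?\<Omega>1 S = tr \<Omega> S" using S by (auto simp: tr_def)
    thus "card (faces (r - card S) \<Gamma>) = card (tr ?\<Omega>1 S)" using tr_faces S by simp
  qed blast
  also have "\<dots> = card ?\<Omega>1" by (rule card_tr[symmetric]) blast
  finally have main: "card \<A> + card \<B> \<le> card ?\<Omega>1 + 1" .
  have "\<Omega> = ?\<Omega>1 \<union> ?\<Omega>0" by (auto simp: \<Omega>_def G_def)
  hence "card \<Omega> = card (?\<Omega>1 \<union> ?\<Omega>0)" by (rule arg_cong)
  also have "\<dots> = card ?\<Omega>1 + card ?\<Omega>0"
    by (rule card_Un_disjoint) (use fin\<Omega> fin\<Delta> in \<open>auto simp: G_def\<close>)
  finally have "fcount r \<Delta> = card ?\<Omega>1 + card ?\<Omega>0" by (simp add: fcount_def \<Omega>_def)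
  thus ?thesis using main by simp
qed



end
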